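(* Let $(X_k)_{k\in\mathbf{Z}}$ be a stationary causal process $X_k=G(\ldots,\varepsilon_{k-1},\varepsilon_k)$ with $\mathbf{E}(X_k)=0$ and $X_k\in\mathcal{L}^2$. Assume that $$\sum_{k=0}^\infty \|\mathcal{P}_0X_k\|<\infty$$ and that the spectral density $f$ of $(X_k)$ satisfies $f_*:=\min_{\theta\in\mathbf{R}}f(\theta)>0$. Then for any fixed $p\in\mathbf{N}$, $$\sup_{J\in\Xi_{m,p}}\ \sup_{c\in\Omega_p}\ \sup_{x\in\mathbf{R}}\ \bigl|\mathbf{P}(Z_J'c\le x)-\Phi(x)\bigr|\to0\qquad\text{as }n\to\infty .$$
   Context: $(\varepsilon_k)_{k\in\mathbf{Z}}$ are i.i.d. random variables, $G$ is a measurable function such that $X_k=G(\ldots,\varepsilon_{k-1},\varepsilon_k)$ is a proper random variable, and $\mathcal{F}_k=(\ldots,\varepsilon_{k-1},\varepsilon_k)$. For a random variable $\xi$, $\|\xi\|=[\mathbf{E}(|\xi|^2)]^{1/2}$, $\xi\in\mathcal{L}^2$ means $\|\xi\|<\infty$, and $\mathcal{P}_k\xi=\mathbf{E}(\xi|\mathcal{F}_k)-\mathbf{E}(\xi|\mathcal{F}_{k-1})$. Let $r(k)=\mathbf{E}(X_0X_k)$ and $f(\lambda)=\frac1{2\pi}\sum_{k\in\mathbf{Z}}r(k)e^{ik\lambda}$ (the covariances are absolutely summable under the stated condition). Let $\theta_j=2\pi j/n$, $m=m_n=\lfloor(n-1)/2\rfloor$, and for $j=1,\ldots,m$ $$Z_j=\frac{\sum_{k=1}^nX_k\cos(k\theta_j)}{\sqrt{\pi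 nf(\theta_j)}},\qquad Z_{j+m}=\frac{\sum_{k=1}^nX_k\sin(k\theta_j)}{\sqrt{\pi nf(\theta_j)}}.$$ $\Omega_p=\{c\in\mathbf{R}^p:|c|=1\}$ is the Euclidean unit sphere; $\Xi_{m,p}=\{J\subset\{1,\ldots,2m\}:\#J=p\}$; for $J=\{j_1<\cdots<j_p\}$, $Z_J=(Z_{j_1},\ldots,Z_{j_p})'$. $\Phi$ is the standard normal distribution function. *)

theory Defs
  imports "HOL-Probability.Probability"
begin

text \<open>\<open>G\<close> receives the past in reversed order: argument \<open>i\<close> of the sequence is
  the innovation at time \<open>k - i\<close>.\<close>

definition causal_process :: "(int \<Rightarrow> 'a \<Rightarrow> real) \<Rightarrow> ((nat \<Rightarrow> real) \<Rightarrow> real) \<Rightarrow> int \<Rightarrow> 'a \<Rightarrow> real" where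
  "causal_process \<epsilon> G k \<omega> = G (\<lambda>i::nat. \<epsilon> (k - int i) \<omega>)"

definition past_algebra :: "'a measure \<Rightarrow> (int \<Rightarrow> 'a \<Rightarrow> real) \<Rightarrow> int \<Rightarrow> 'a measure" where
  "past_algebra M \<epsilon> k =
     sigma (space M) {\<epsilon> i -` A \<inter> space M |i A. i \<le> k \<and> A \<in> sets borel}"

definition proj_op :: "'a measure \<Rightarrow> (int \<Rightarrow> 'a \<Rightarrow> real) \<Rightarrow> int \<Rightarrow> ('a \<Rightarrow> real) \<Rightarrow> 'a \<Rightarrow> real" where
  "proj_op M \<epsilon> k \<xi> = (\<lambda>\<omega>. real_cond_exp M (past_algebra M \<epsilon> k) \<xi> \<omega>
                          - real_cond_exp M (past_algebra M \<epsilon> (k - 1)) \<xi> \<omega>)"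

text \<open>The Bochner integral is \<open>0\<close> for non-integrable functions, so \<open>rv_norm\<close> is the
  \<open>L\<^sup>2\<close>-norm only for square-integrable variables.\<close>

definition rv_norm :: "'a measure \<Rightarrow> ('a \<Rightarrow> real) \<Rightarrow> real" where
  "rv_norm M \<xi> = sqrt (\<integral>\<omega>. \<bar>\<xi> \<omega>\<bar>\<^sup>2 \<partial>M)"

definition autocov :: "'a measure \<Rightarrow> (int \<Rightarrow> 'a \<Rightarrow> real) \<Rightarrow> int \<Rightarrow> real" where
  "autocov M X k = (\<integral>\<omega>. X 0 \<omega> * X k \<omega> \<partial>M)"

text \<open>The sum is real for stationary \<open>X\<close>, because then \<open>r(-k) = r(k)\<close>; \<open>Re\<close> only
  changes the type.\<close>

definition spectral_density :: "'a measure \<Rightarrow> (int \<Rightarrow> 'a \<Rightarrow> real) \<Rightarrow> real \<Rightarrow> real" where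
  "spectral_density M X \<theta> =
     Re (1 / (2 * of_real pi)
         * (\<Sum>\<^sub>\<infinity>k\<in>(UNIV :: int set). of_real (autocov M X k) * exp (\<i> * of_int k * of_real \<theta>)))"

definition fourier_freq :: "nat \<Rightarrow> nat \<Rightarrow> real" where
  "fourier_freq n j = 2 * pi * real j / real n"

text \<open>For \<open>n = 0\<close> truncated subtraction gives \<open>0\<close> instead of \<open>-1\<close>; the index sets
  below are empty in either case.\<close>

definition num_freq :: "nat \<Rightarrow> nat" where
  "num_freq n = (n - 1) div 2"

text \<open>Meaningful for \<open>1 \<le> j \<le> 2 * num_freq n\<close> only.\<close>

definition fourier_coeff :: "'a measure \<Rightarrow> (int \<Rightarrow> 'a \<Rightarrow> real) \<Rightarrow> nat \<Rightarrow> nat \<Rightarrow> 'a \<Rightarrow> real" where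
  "fourier_coeff M X n j \<omega> =
     (let m = num_freq n in
      if j \<le> m then
        (\<Sum>k=1..n. X (int k) \<omega> * cos (real k * fourier_freq n j))
          / sqrt (pi * real n * spectral_density M X (fourier_freq n j))
      else
        (\<Sum>k=1..n. X (int k) \<omega> * sin (real k * fourier_freq n (j - m)))
          / sqrt (pi * real n * spectral_density M X (fourier_freq n (j - m))))"

text \<open>Vectors in \<open>\<real>\<^sup>p\<close> are functions on \<open>{..<p}\<close>; coordinates are counted from \<open>0\<close>.\<close>

definition euclid_sphere :: "nat \<Rightarrow> (nat \<Rightarrow> real) set" where
  "euclid_sphere p = {c \<in> {..<p} \<rightarrow>\<^sub>E UNIV. L2_set c {..<p} = 1}"

definition index_sets :: "nat \<Rightarrow> nat \<Rightarrow> nat set set" where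
  "index_sets m p = {J. J \<subseteq> {1..2 * m} \<and> card J = p}"

definition coeff_vec :: "'a measure \<Rightarrow> (int \<Rightarrow> 'a \<Rightarrow> real) \<Rightarrow> nat \<Rightarrow> nat set \<Rightarrow> nat \<Rightarrow> 'a \<Rightarrow> real" where
  "coeff_vec M X n J i = fourier_coeff M X n (sorted_list_of_set J ! i)"

end

theory Submission
  imports Defs
begin

text \<open>
  Reading the innovations backwards from time \<open>n\<close> turns the process into \<open>X\<^sub>k = G \<circ> shift\<^bsup>n-k\<^esup>\<close> on
  the one-sided Bernoulli shift, where conditioning on the past is integration over the first
  coordinate. Telescoping these conditional expectations and using orthogonality of martingale
  differences gives \<open>\<parallel>\<Sum>\<^sub>k b\<^sub>k (X\<^sub>k - Y\<^sub>k)\<parallel> \<le> \<delta> (\<Sum>\<^sub>k b\<^sub>k\<^sup>2)\<^bsup>1/2\<^esup>\<close> for all weights at once, where \<open>Y\<^sub>k\<close> is a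
  bounded function of finitely many innovations. For such \<open>Y\<close> and weights of order \<open>n\<^bsup>-1/2\<^esup>\<close>,
  cutting out a window around each summand (Tikhomirov's method) shows that the characteristic
  function \<open>\<phi>\<close> of the weighted sum nearly solves \<open>\<phi>'(t) = - t v \<phi>(t)\<close> with \<open>v\<close> its variance,
  hence is nearly Gaussian. Orthogonality of the trigonometric system over the Fourier frequencies
  makes the circulant version of the variance of \<open>Z\<^sub>J'c\<close> exactly \<open>1\<close>, and summability of the
  covariances bounds the boundary terms. Uniformity in \<open>J\<close> and \<open>c\<close> follows by applying
  the limit theorem along a sequence of worst pairs, uniformity in \<open>x\<close> by monotonicity of
  distribution functions and continuity of the limit.
\<close>

section \<open>Square-integrable functions\<close>

text \<open>The weights change with \<open>n\<close>, \<open>J\<close> and \<open>c\<close>, and the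
  estimates may use only a bound \<open>C / sqrt n\<close> on them, so every constant must be common
  to all weights. Mere L^2-closeness of \<open>G\<close> to a function of finitely many innovations
  is too weak: for a sum of \<open>n\<close> shifted errors the triangle inequality loses a factor
  of order \<open>sqrt n\<close>. The approximation is therefore made in each martingale difference
  of \<open>G\<close>, where orthogonality loses nothing, and the approximant is projected back to a
  martingale difference. The hypothesis on \<open>rv_norm M (proj_op M \<epsilon> 0 (X k))\<close>
  is exactly summability of the resulting constants.

  The variances of the approximating sums need not converge. Such a sum is compared with the
  Gaussian of its own variance, and that Gaussian with the target by Lipschitz continuity of
  \<open>exp (- x\<^sup>2 / 2)\<close> in the standard deviation.

  On reversed paths, averaging over one coordinate and shifting are adjoint operators. This replaces
  filtrations throughout; genuine conditional expectations occur only where the hypothesis is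
  carried over to path space.\<close>

definition square_integrable :: "'a measure \<Rightarrow> ('a \<Rightarrow> real) set" where
  "square_integrable M = {f \<in> borel_measurable M. integrable M (\<lambda>x. (f x)\<^sup>2)}"

lemma square_integrable_measurable [measurable_dest]:
  "f \<in> square_integrable M \<Longrightarrow> f \<in> borel_measurable M"
  by (simp add: square_integrable_def)

lemma square_integrable_square: "f \<in> square_integrable M \<Longrightarrow> integrable M (\<lambda>x. (f x)\<^sup>2)"
  by (simp add: square_integrable_def)

lemma square_integrable_mult:
  assumes f: "f \<in> square_integrable M" and g: "g \<in> square_integrable M"
  shows "integrable M (\<lambda>x. f x * g x)"
proof (rule Bochner_Integration.integrable_bound)
  show "integrable M (\<lambda>x. (f x)\<^sup>2 + (g x)\<^sup>2)"
    using assms by (auto intro: square_integrable_square)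
  have "f \<in> borel_measurable M" "g \<in> borel_measurable M"
    using assms by (auto intro: square_integrable_measurable)
  then show "(\<lambda>x. f x * g x) \<in> borel_measurable M" by measurable
  have "\<bar>a * b\<bar> \<le> a\<^sup>2 + b\<^sup>2" for a b :: real
  proof -
    have "2 * (\<bar>a\<bar> * \<bar>b\<bar>) \<le> a\<^sup>2 + b\<^sup>2" using sum_squares_bound[of "\<bar>a\<bar>" "\<bar>b\<bar>"] by (simp add: mult.assoc)
    moreover have "0 \<le> \<bar>a\<bar> * \<bar>b\<bar>" by simp
    ultimately show ?thesis unfolding abs_mult by linarith
  qed
  then show "AE x in M. norm (f x * g x) \<le> norm ((f x)\<^sup>2 + (g x)\<^sup>2)" by auto
qed

lemma square_integrable_cmult:
  "f \<in> square_integrable M \<Longrightarrow> (\<lambda>x. c * f x) \<in> square_integrable M"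
  unfolding square_integrable_def by (auto simp: power_mult_distrib)

lemma square_integrable_add:
  assumes f: "f \<in> square_integrable M" and g: "g \<in> square_integrable M"
  shows "(\<lambda>x. f x + g x) \<in> square_integrable M"
proof -
  have "integrable M (\<lambda>x. (f x)\<^sup>2 + (g x)\<^sup>2 + 2 * (f x * g x))"
    using assms by (intro Bochner_Integration.integrable_add integrable_mult_right
        square_integrable_square square_integrable_mult)
  moreover have "(\<lambda>x. f x + g x) \<in> borel_measurable M"
    using assms by (auto dest: square_integrable_measurable)
  ultimately show ?thesis
    by (simp add: square_integrable_def power2_sum mult.assoc)
qed

lemma square_integrable_diff:
  assumes "f \<in> square_integrable M" "g \<in> square_integrable M"
  shows "(\<lambda>x. f x - g x) \<in> square_integrable M"
  using square_integrable_add[OF assms(1) square_integrable_cmult[OF assms(2), of "-1"]] by simp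

lemma square_integrable_sum:
  assumes "\<And>i. i \<in> I \<Longrightarrow> f i \<in> square_integrable M"
  shows "(\<lambda>x. \<Sum>i\<in>I. f i x) \<in> square_integrable M"
  using assms
proof (induction I rule: infinite_finite_induct)
  case (insert i I)
  then show ?case by (simp add: square_integrable_add)
qed (simp_all add: square_integrable_def)

lemma (in finite_measure) square_integrable_bounded:
  assumes f: "f \<in> borel_measurable M" "\<And>x. x \<in> space M \<Longrightarrow> \<bar>f x\<bar> \<le> B"
  shows "f \<in> square_integrable M"
proof -
  have "integrable M (\<lambda>x. (f x)\<^sup>2)"
  proof (rule integrable_const_bound)
    show "AE x in M. norm ((f x)\<^sup>2) \<le> B\<^sup>2"
    proof (rule AE_I2)
      fix x assume "x \<in> space M"
      then have "\<bar>f x\<bar>\<^sup>2 \<le> B\<^sup>2" by (intro power_mono f) auto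
      then show "norm ((f x)\<^sup>2) \<le> B\<^sup>2" by simp
    qed
  qed (use f in measurable)
  then show ?thesis using f by (simp add: square_integrable_def)
qed

lemma (in finite_measure) square_integrable_integrable:
  "f \<in> square_integrable M \<Longrightarrow> integrable M f"
  using square_integrable_mult[OF _ square_integrable_bounded[of "\<lambda>_. 1" 1], of f]
  by simp

lemma rv_norm_nonneg: "0 \<le> rv_norm M f"
  by (simp add: rv_norm_def)

lemma rv_norm_square: "(rv_norm M f)\<^sup>2 = (\<integral>x. (f x)\<^sup>2 \<partial>M)"
  by (simp add: rv_norm_def)

lemma rv_norm_cmult: "rv_norm M (\<lambda>x. c * f x) = \<bar>c\<bar> * rv_norm M f"
  by (simp add: rv_norm_def power_mult_distrib real_sqrt_mult)

text \<open>Cauchy-Schwarz, from nonnegativity of the integral of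
  \<open>(u * f + v * g)\<^sup>2\<close> as a quadratic form in \<open>u\<close> and
  \<open>v\<close>.\<close>

lemma inner_le_rv_norm:
  assumes f: "f \<in> square_integrable M" and g: "g \<in> square_integrable M"
  shows "(\<integral>x. f x * g x \<partial>M) \<le> rv_norm M f * rv_norm M g"
proof -
  define a where "a = (\<integral>x. (f x)\<^sup>2 \<partial>M)"
  define b where "b = (\<integral>x. f x * g x \<partial>M)"
  define c where "c = (\<integral>x. (g x)\<^sup>2 \<partial>M)"
  have quad: "0 \<le> u\<^sup>2 * a + 2 * u * v * b + v\<^sup>2 * c" for u v
  proof -
    have "0 \<le> (\<integral>x. (u * f x + v * g x)\<^sup>2 \<partial>M)" by simp
    also have "\<dots> = (\<integral>x. u\<^sup>2 * (f x)\<^sup>2 + 2 * u * v * (f x * g x) + v\<^sup>2 * (g x)\<^sup>2 \<partial>M)"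
      by (intro Bochner_Integration.integral_cong) (auto simp: power2_eq_square algebra_simps)
    also have "\<dots> = u\<^sup>2 * a + 2 * u * v * b + v\<^sup>2 * c"
      using square_integrable_square[OF f] square_integrable_square[OF g] square_integrable_mult[OF f g]
      by (simp add: a_def b_def c_def)
    finally show ?thesis .
  qed
  have "c \<ge> 0" "a \<ge> 0" by (simp_all add: a_def c_def)
  have "b\<^sup>2 \<le> a * c"
  proof (cases "c = 0")
    case True
    have "b = 0"
    proof (rule ccontr)
      assume "b \<noteq> 0"
      \<comment> \<open>With \<open>c = 0\<close> the form is affine in \<open>v\<close>; this
        \<open>v\<close> makes the mixed term \<open>- (a + 1)\<close>.\<close>
      have "0 \<le> a - (a + 1)"
        using quad[of 1 "- (a + 1) / (2 * b)"] \<open>b \<noteq> 0\<close> True by (simp add: field_simps)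
      then show False by simp
    qed
    then show ?thesis using True by simp
  next
    case False
    have "0 \<le> c * (a * c - b\<^sup>2)"
      using quad[of c "- b"] by (simp add: power2_eq_square algebra_simps)
    then show ?thesis using False \<open>c \<ge> 0\<close> by (simp add: zero_le_mult_iff)
  qed
  then have "\<bar>b\<bar> \<le> sqrt (a * c)"
    using real_sqrt_le_mono by fastforce
  then have "b \<le> sqrt (a * c)" by simp
  then show ?thesis by (simp add: rv_norm_def real_sqrt_mult a_def b_def c_def)
qed

lemma rv_norm_add:
  assumes f: "f \<in> square_integrable M" and g: "g \<in> square_integrable M"
  shows "rv_norm M (\<lambda>x. f x + g x) \<le> rv_norm M f + rv_norm M g"
proof (rule power2_le_imp_le)
  have "(rv_norm M (\<lambda>x. f x + g x))\<^sup>2 = (\<integral>x. (f x)\<^sup>2 + (g x)\<^sup>2 + 2 * (f x * g x) \<partial>M)"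
    by (simp add: rv_norm_square power2_sum mult.assoc)
  also have "\<dots> = (rv_norm M f)\<^sup>2 + (rv_norm M g)\<^sup>2 + 2 * (\<integral>x. f x * g x \<partial>M)"
    using square_integrable_square[OF f] square_integrable_square[OF g] square_integrable_mult[OF f g]
    by (simp add: rv_norm_square)
  also have "\<dots> \<le> (rv_norm M f + rv_norm M g)\<^sup>2"
    using inner_le_rv_norm[OF f g] by (simp add: power2_sum mult.assoc)
  finally show "(rv_norm M (\<lambda>x. f x + g x))\<^sup>2 \<le> (rv_norm M f + rv_norm M g)\<^sup>2" .
qed (simp add: rv_norm_nonneg)

lemma rv_norm_minus_commute: "rv_norm M (\<lambda>x. f x - g x) = rv_norm M (\<lambda>x. g x - f x)"
  by (simp add: rv_norm_def power2_commute)

lemma rv_norm_triangle_diff: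
  assumes f: "f \<in> square_integrable M" and g: "g \<in> square_integrable M"
  shows "\<bar>rv_norm M f - rv_norm M g\<bar> \<le> rv_norm M (\<lambda>x. f x - g x)"
  using rv_norm_add[OF square_integrable_diff[OF f g] g]
    rv_norm_add[OF square_integrable_diff[OF g f] f] rv_norm_minus_commute[of M f g]
  by simp

lemma rv_norm_sum:
  assumes "\<And>i. i \<in> I \<Longrightarrow> f i \<in> square_integrable M"
  shows "rv_norm M (\<lambda>x. \<Sum>i\<in>I. f i x) \<le> (\<Sum>i\<in>I. rv_norm M (f i))"
  using assms
proof (induction I rule: infinite_finite_induct)
  case (insert i I)
  have "rv_norm M (\<lambda>x. f i x + (\<Sum>i\<in>I. f i x)) \<le> rv_norm M (f i) + rv_norm M (\<lambda>x. \<Sum>i\<in>I. f i x)"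
    using insert by (intro rv_norm_add square_integrable_sum) auto
  with insert show ?case by fastforce
qed (simp_all add: rv_norm_def)

lemma rv_norm_distr:
  assumes "T \<in> measurable M N" "f \<in> borel_measurable N"
  shows "rv_norm (distr M N T) f = rv_norm M (\<lambda>x. f (T x))"
  using assms by (simp add: rv_norm_def integral_distr)

lemma square_integrable_distr:
  assumes T: "T \<in> measurable M N" and f: "f \<in> square_integrable (distr M N T)"
  shows "(\<lambda>x. f (T x)) \<in> square_integrable M"
proof -
  have [measurable]: "f \<in> borel_measurable N"
    using f by (simp add: square_integrable_def)
  show ?thesis
    using f T by (simp add: square_integrable_def integrable_distr_eq)
qed

lemma (in prob_space) integral_le_rv_norm:
  assumes f: "f \<in> square_integrable M"
  shows "(\<integral>x. \<bar>f x\<bar> \<partial>M) \<le> rv_norm M f"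
proof -
  have "(\<lambda>x. \<bar>f x\<bar>) \<in> square_integrable M" "(\<lambda>x. 1) \<in> square_integrable M"
    using f square_integrable_bounded[of "\<lambda>_. 1" 1] by (auto simp: square_integrable_def)
  from inner_le_rv_norm[OF this] show ?thesis
    by (simp add: rv_norm_def prob_space)
qed

lemma (in prob_space) square_integral_le:
  assumes f: "f \<in> square_integrable M"
  shows "(\<integral>x. f x \<partial>M)\<^sup>2 \<le> (\<integral>x. (f x)\<^sup>2 \<partial>M)"
proof -
  have "\<bar>\<integral>x. f x \<partial>M\<bar> \<le> (\<integral>x. \<bar>f x\<bar> \<partial>M)" by (rule integral_abs_bound)
  also have "\<dots> \<le> rv_norm M f" by (rule integral_le_rv_norm[OF f])
  finally have "\<bar>\<integral>x. f x \<partial>M\<bar>\<^sup>2 \<le> (rv_norm M f)\<^sup>2" by (intro power_mono) auto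
  then show ?thesis by (simp add: rv_norm_square)
qed

section \<open>The one-sided Bernoulli shift\<close>

text \<open>Since \<open>space M = UNIV\<close>, every function on the naturals is a path, and no
  side conditions on membership in the space arise.\<close>

locale bernoulli_shift = sequence_space M for M :: "'b measure" +
  assumes space_M: "space M = UNIV"
begin

sublocale MS: pair_sigma_finite M S ..

lemma space_S: "space S = UNIV"
  by (simp add: space_PiM space_M)

text \<open>Coordinate \<open>i\<close> will be the innovation \<open>i\<close> steps back, so
  dropping \<open>k\<close> coordinates moves \<open>k\<close> steps into the past.\<close>

definition shift :: "nat \<Rightarrow> (nat \<Rightarrow> 'b) \<Rightarrow> nat \<Rightarrow> 'b" where
  "shift k x = (\<lambda>i. x (i + k))"

lemma shift_0 [simp]: "shift 0 x = x"
  by (simp add: shift_def)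

lemma shift_shift [simp]: "shift j (shift k x) = shift (j + k) x"
  by (simp add: shift_def add.assoc)

lemma shift_Suc_case_nat [simp]: "shift (Suc k) (case_nat y x) = shift k x"
  by (simp add: shift_def)

lemma measurable_component_S [measurable]: "(\<lambda>x. x i) \<in> measurable S M"
  by (rule measurable_component_singleton) simp

lemma measurable_shift [measurable]: "shift k \<in> measurable S S"
proof (rule measurable_PiM_single')
  show "shift k \<in> space S \<rightarrow> (\<Pi>\<^sub>E i\<in>UNIV. space M)"
    by (simp add: space_M)
qed (simp add: shift_def)

lemma measurable_case_nat_S [measurable]: "(\<lambda>(y, x). case_nat y x) \<in> measurable (M \<Otimes>\<^sub>M S) S"
  by (rule measurable_case_nat'[of fst _ _ snd, simplified split_beta'[symmetric]]) simp_all

lemma distr_shift: "distr S S (shift k) = S"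
proof -
  have "distr S (\<Pi>\<^sub>M i\<in>(UNIV::nat set). M) (\<lambda>x. \<lambda>i\<in>UNIV. x (i + k)) = (\<Pi>\<^sub>M i\<in>(UNIV::nat set). M)"
    by (rule distr_PiM_reindex[of UNIV "\<lambda>_. M" "\<lambda>i. i + k"]) (auto intro: M.prob_space_axioms)
  then show ?thesis by (simp add: shift_def[abs_def] restrict_UNIV)
qed

lemma integral_shift:
  fixes h :: "_ \<Rightarrow> _::{banach, second_countable_topology}"
  assumes [measurable]: "h \<in> borel_measurable S"
  shows "(\<integral>x. h (shift k x) \<partial>S) = (\<integral>x. h x \<partial>S)"
  by (subst (2) distr_shift[of k, symmetric]) (simp add: integral_distr)

lemma square_integrable_shift:
  assumes "h \<in> square_integrable S"
  shows "(\<lambda>x. h (shift k x)) \<in> square_integrable S"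
  by (rule square_integrable_distr[OF measurable_shift]) (simp add: distr_shift assms)

lemma rv_norm_shift:
  assumes "h \<in> borel_measurable S"
  shows "rv_norm S (\<lambda>x. h (shift k x)) = rv_norm S h"
  using rv_norm_distr[OF measurable_shift, of h k] assms by (simp add: distr_shift)

text \<open>The conditional expectation of \<open>h\<close> given all coordinates but the \<open>0\<close>-th.\<close>

definition avg :: "((nat \<Rightarrow> 'b) \<Rightarrow> real) \<Rightarrow> (nat \<Rightarrow> 'b) \<Rightarrow> real" where
  "avg h x = (\<integral>y. h (case_nat y x) \<partial>M)"

lemma borel_measurable_avg [measurable]:
  assumes [measurable]: "h \<in> borel_measurable S"
  shows "avg h \<in> borel_measurable S"
proof -
  have "(\<lambda>p. h (case_nat (snd p) (fst p))) \<in> borel_measurable (S \<Otimes>\<^sub>M M)"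
  proof -
    have "(\<lambda>p. (snd p, fst p)) \<in> measurable (S \<Otimes>\<^sub>M M) (M \<Otimes>\<^sub>M S)" by simp
    from measurable_compose[OF measurable_compose[OF this measurable_case_nat_S] assms]
    show ?thesis by simp
  qed
  then have "(\<lambda>(x, y). h (case_nat y x)) \<in> borel_measurable (S \<Otimes>\<^sub>M M)"
    by (simp add: split_beta')
  then show ?thesis
    unfolding avg_def[abs_def] by (rule M.borel_measurable_lebesgue_integral)
qed

lemma integrable_case_nat:
  fixes h :: "(nat \<Rightarrow> 'b) \<Rightarrow> real"
  assumes "integrable S h"
  shows "integrable (M \<Otimes>\<^sub>M S) (\<lambda>(y, x). h (case_nat y x))"
proof -
  have "integrable (distr (M \<Otimes>\<^sub>M S) S (\<lambda>(y, x). case_nat y x)) h"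
    by (simp add: PiM_iter assms)
  from integrable_distr[OF measurable_case_nat_S this] show ?thesis
    by (simp add: split_beta')
qed

lemma
  assumes "integrable S h"
  shows AE_integrable_case_nat: "AE x in S. integrable M (\<lambda>y. h (case_nat y x))"
    and integrable_avg: "integrable S (avg h)"
    and integral_avg: "(\<integral>x. avg h x \<partial>S) = (\<integral>x. h x \<partial>S)"
proof -
  note * = integrable_case_nat[OF assms]
  have [measurable]: "h \<in> borel_measurable S" using assms by simp
  show "AE x in S. integrable M (\<lambda>y. h (case_nat y x))"
    by (rule MS.AE_integrable_snd[OF *])
  show "integrable S (avg h)"
    unfolding avg_def[abs_def] by (rule MS.integrable_snd[OF *])
  have "(\<integral>x. avg h x \<partial>S) = (\<integral>p. (case p of (y, x) \<Rightarrow> h (case_nat y x)) \<partial>(M \<Otimes>\<^sub>M S))"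
    unfolding avg_def by (rule MS.integral_snd[OF *])
  also have "\<dots> = (\<integral>x. h x \<partial>distr (M \<Otimes>\<^sub>M S) S (\<lambda>(y, x). case_nat y x))"
    by (simp add: integral_distr split_beta')
  finally show "(\<integral>x. avg h x \<partial>S) = (\<integral>x. h x \<partial>S)" by (simp add: PiM_iter)
qed

lemma measurable_case_nat_section [measurable]: "(\<lambda>y. case_nat y x) \<in> measurable M S"
proof -
  have "(\<lambda>y. (y, x)) \<in> measurable M (M \<Otimes>\<^sub>M S)"
    by (rule measurable_Pair2') (simp add: space_S)
  from measurable_compose[OF this measurable_case_nat_S] show ?thesis by simp
qed

text \<open>Jensen's inequality in the averaged coordinate, for almost every remaining path,
  followed by \<open>integral_avg\<close> for the square.\<close>

lemma
  assumes h: "h \<in> square_integrable S"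
  shows square_integrable_avg: "avg h \<in> square_integrable S"
    and rv_norm_avg: "rv_norm S (avg h) \<le> rv_norm S h"
proof -
  have [measurable]: "h \<in> borel_measurable S" using h by (rule square_integrable_measurable)
  have i: "integrable S (\<lambda>x. (h x)\<^sup>2)" using h by (rule square_integrable_square)
  have le: "AE x in S. (avg h x)\<^sup>2 \<le> avg (\<lambda>x. (h x)\<^sup>2) x"
    using AE_integrable_case_nat[OF i]
  proof eventually_elim
    case (elim x)
    then have "(\<lambda>y. h (case_nat y x)) \<in> square_integrable M"
      by (simp add: square_integrable_def)
    from M.square_integral_le[OF this] show ?case by (simp add: avg_def)
  qed
  have sq: "integrable S (\<lambda>x. (avg h x)\<^sup>2)"
  proof (rule Bochner_Integration.integrable_bound[OF integrable_avg[OF i]])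
    show "AE x in S. norm ((avg h x)\<^sup>2) \<le> norm (avg (\<lambda>x. (h x)\<^sup>2) x)"
      using le by eventually_elim simp
  qed measurable
  then show "avg h \<in> square_integrable S" by (simp add: square_integrable_def)
  have "(\<integral>x. (avg h x)\<^sup>2 \<partial>S) \<le> (\<integral>x. avg (\<lambda>x. (h x)\<^sup>2) x \<partial>S)"
    by (rule integral_mono_AE[OF sq integrable_avg[OF i] le])
  then show "rv_norm S (avg h) \<le> rv_norm S h"
    by (simp add: rv_norm_def integral_avg[OF i])
qed

lemma avg_shift_Suc: "avg (\<lambda>x. f x * h (shift (Suc k) x)) x = avg f x * h (shift k x)"
  by (simp add: avg_def)

text \<open>The factor \<open>h (shift (Suc k) x)\<close> does not see coordinate 0 and leaves the
  integral over it. Iterated, this makes \<open>avg ^^ k\<close> the adjoint of composition with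
  \<open>shift k\<close>, the only property of conditional expectations that is used later.\<close>

lemma avg_adjoint:
  assumes f: "f \<in> square_integrable S" and h: "h \<in> square_integrable S"
  shows "(\<integral>x. f x * h (shift (Suc k) x) \<partial>S) = (\<integral>x. avg f x * h (shift k x) \<partial>S)"
proof -
  have "integrable S (\<lambda>x. f x * h (shift (Suc k) x))"
    by (intro square_integrable_mult f square_integrable_shift h)
  from integral_avg[OF this] show ?thesis
    by (simp add: avg_shift_Suc)
qed

lemma square_integrable_avg_pow: "f \<in> square_integrable S \<Longrightarrow> (avg ^^ k) f \<in> square_integrable S"
  by (induction k) (auto intro: square_integrable_avg)

lemma avg_pow_adjoint:
  assumes f: "f \<in> square_integrable S" and h: "h \<in> square_integrable S"
  shows "(\<integral>x. f x * h (shift k x) \<partial>S) = (\<integral>x. (avg ^^ k) f x * h x \<partial>S)"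
  using f
proof (induction k arbitrary: f)
  case (Suc k)
  then show ?case
    using Suc.IH[OF square_integrable_avg[OF Suc.prems]]
    by (simp add: avg_adjoint[OF Suc.prems h] funpow_swap1)
qed simp

lemma integral_avg_pow:
  assumes f: "f \<in> square_integrable S"
  shows "(\<integral>x. (avg ^^ k) f x \<partial>S) = (\<integral>x. f x \<partial>S)"
  using avg_pow_adjoint[OF f P.square_integrable_bounded[of "\<lambda>_. 1" 1], of k] by simp

lemma avg_shift_1: "avg (\<lambda>x. f (shift (Suc k) x)) = (\<lambda>x. f (shift k x))"
  by (simp add: avg_def fun_eq_iff M.prob_space)

text \<open>Linearity holds only almost everywhere: on exceptional paths a section is not integrable
  and its Bochner integral is the default \<open>0\<close>.\<close>

lemma avg_diff_AE:
  assumes "f \<in> square_integrable S" "g \<in> square_integrable S"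
  shows "AE x in S. avg (\<lambda>x. f x - g x) x = avg f x - avg g x"
proof -
  have "integrable S f" "integrable S g"
    using assms by (auto intro: P.square_integrable_integrable)
  from AE_integrable_case_nat[OF this(1)] AE_integrable_case_nat[OF this(2)]
  show ?thesis by eventually_elim (simp add: avg_def)
qed

text \<open>A function with vanishing \<open>avg\<close> is a martingale difference in reversed
  time. The second factor depends only on coordinates from \<open>j > i\<close> on, so averaging
  over coordinate \<open>i\<close> kills the product.\<close>

lemma orthogonal_shift:
  assumes u: "u \<in> square_integrable S" "AE x in S. avg u x = 0"
    and v: "v \<in> square_integrable S" and "i < j"
  shows "(\<integral>x. u (shift i x) * v (shift j x) \<partial>S) = 0"
proof -
  have [measurable]: "u \<in> borel_measurable S" "v \<in> borel_measurable S"
    using u v by (auto intro: square_integrable_measurable)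
  obtain k where j: "j = Suc k + i" using \<open>i < j\<close> less_iff_Suc_add[of i j] by (auto simp: add.commute)
  have "(\<integral>x. u (shift i x) * v (shift j x) \<partial>S) = (\<integral>x. u x * v (shift (Suc k) x) \<partial>S)"
    using integral_shift[of "\<lambda>x. u x * v (shift (Suc k) x)" i] by (simp add: j)
  also have "\<dots> = (\<integral>x. avg u x * v (shift k x) \<partial>S)"
    by (rule avg_adjoint[OF u(1) v])
  also have "\<dots> = (\<integral>x. 0 \<partial>S)"
    using u(2) by (intro integral_cong_AE) auto
  finally show ?thesis by simp
qed

lemma rv_norm_martingale_sum:
  assumes u: "u \<in> square_integrable S" "AE x in S. avg u x = 0" and I: "finite I"
  shows "rv_norm S (\<lambda>x. \<Sum>i\<in>I. b i * u (shift i x)) = rv_norm S u * sqrt (\<Sum>i\<in>I. (b i)\<^sup>2)"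
proof -
  have orth: "(\<integral>x. u (shift i x) * u (shift j x) \<partial>S) = (if i = j then (rv_norm S u)\<^sup>2 else 0)" for i j
  proof (cases i j rule: linorder_cases)
    case less
    then show ?thesis using orthogonal_shift[OF u u(1) less] by simp
  next
    case greater
    then show ?thesis using orthogonal_shift[OF u u(1) greater] by (simp add: mult.commute)
  next
    case equal
    have "u \<in> borel_measurable S" using u by (auto intro: square_integrable_measurable)
    then show ?thesis
      using equal integral_shift[of "\<lambda>x. (u x)\<^sup>2" j] unfolding rv_norm_square
      by (simp add: power2_eq_square)
  qed
  have int: "integrable S (\<lambda>x. u (shift i x) * u (shift j x))" for i j
    by (intro square_integrable_mult square_integrable_shift u)
  have "(\<integral>x. (\<Sum>i\<in>I. b i * u (shift i x))\<^sup>2 \<partial>S)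
      = (\<integral>x. (\<Sum>i\<in>I. \<Sum>j\<in>I. (b i * b j) * (u (shift i x) * u (shift j x))) \<partial>S)"
    by (simp add: power2_eq_square sum_product ac_simps)
  also have "\<dots> = (\<Sum>i\<in>I. \<Sum>j\<in>I. (b i * b j) * (\<integral>x. u (shift i x) * u (shift j x) \<partial>S))"
    using int by (simp add: Bochner_Integration.integral_sum)
  also have "\<dots> = (\<Sum>i\<in>I. (b i)\<^sup>2 * (rv_norm S u)\<^sup>2)"
    using I by (simp add: orth if_distrib power2_eq_square cong: if_cong)
  finally show ?thesis
    by (simp add: rv_norm_def[of S "\<lambda>x. \<Sum>i\<in>I. b i * u (shift i x)"] real_sqrt_mult rv_norm_nonneg
        flip: sum_distrib_right)
qed

end

section \<open>Approximation by cylinder functions\<close>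

context bernoulli_shift
begin

text \<open>A pointwise substitute for measurability with respect to the coordinates in
  \<open>I\<close>; together with Borel measurability on \<open>S\<close> it yields independence for
  disjoint \<open>I\<close> and \<open>J\<close>.\<close>

definition depends_on :: "nat set \<Rightarrow> ((nat \<Rightarrow> 'b) \<Rightarrow> 'c) \<Rightarrow> bool" where
  "depends_on I f \<longleftrightarrow> (\<forall>x y. (\<forall>i\<in>I. x i = y i) \<longrightarrow> f x = f y)"

lemma depends_onD: "depends_on I f \<Longrightarrow> (\<And>i. i \<in> I \<Longrightarrow> x i = y i) \<Longrightarrow> f x = f y"
  by (auto simp: depends_on_def)

lemma depends_on_mono: "depends_on I f \<Longrightarrow> I \<subseteq> J \<Longrightarrow> depends_on J f"
  by (auto simp: depends_on_def subset_eq)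

lemma depends_on_comp: "depends_on I f \<Longrightarrow> depends_on I (\<lambda>x. g (f x))"
  unfolding depends_on_def by metis

lemma depends_on_comp2:
  "depends_on I f \<Longrightarrow> depends_on I g \<Longrightarrow> depends_on I (\<lambda>x. h (f x) (g x))"
  unfolding depends_on_def by metis

lemma depends_on_sum: "(\<And>j. j \<in> J \<Longrightarrow> depends_on I (f j)) \<Longrightarrow> depends_on I (\<lambda>x. \<Sum>j\<in>J. f j x)"
  unfolding depends_on_def by (auto intro!: sum.cong)

lemma depends_on_shift:
  "depends_on {..<q} f \<Longrightarrow> depends_on {k..<k + q} (\<lambda>x. f (shift k x))"
proof -
  assume f: "depends_on {..<q} f"
  have "f (shift k x) = f (shift k y)" if "\<forall>i\<in>{k..<k + q}. x i = y i" for x y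
    using that by (intro depends_onD[OF f]) (auto simp: shift_def)
  then show ?thesis by (simp add: depends_on_def)
qed

text \<open>Boundedness is included because the later characteristic function estimate needs both a
  finite window and a uniform bound.\<close>

definition cylinder :: "((nat \<Rightarrow> 'b) \<Rightarrow> real) set" where
  "cylinder = {f \<in> borel_measurable S. (\<exists>q. depends_on {..<q} f) \<and> (\<exists>B. \<forall>x. \<bar>f x\<bar> \<le> B)}"

lemma cylinderI:
  "f \<in> borel_measurable S \<Longrightarrow> depends_on {..<q} f \<Longrightarrow> (\<And>x. \<bar>f x\<bar> \<le> B) \<Longrightarrow> f \<in> cylinder"
  by (auto simp: cylinder_def)

lemma cylinderE:
  assumes "f \<in> cylinder"
  obtains q B where "f \<in> borel_measurable S" "depends_on {..<q} f" "\<And>x. \<bar>f x\<bar> \<le> B"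
  using assms by (auto simp: cylinder_def)

lemma cylinder_square_integrable: "f \<in> cylinder \<Longrightarrow> f \<in> square_integrable S"
  by (erule cylinderE, rule P.square_integrable_bounded) auto

lemma cylinder_const: "(\<lambda>_. c) \<in> cylinder"
  by (rule cylinderI[of _ 0 "\<bar>c\<bar>"]) (auto simp: depends_on_def)

lemma cylinder_add:
  assumes "f \<in> cylinder" "g \<in> cylinder"
  shows "(\<lambda>x. f x + g x) \<in> cylinder"
proof -
  obtain q B where f: "f \<in> borel_measurable S" "depends_on {..<q} f" "\<And>x. \<bar>f x\<bar> \<le> B"
    using assms(1) unfolding cylinder_def by blast
  obtain q' B' where g: "g \<in> borel_measurable S" "depends_on {..<q'} g" "\<And>x. \<bar>g x\<bar> \<le> B'"
    using assms(2) unfolding cylinder_def by blast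
  note [measurable] = f(1) g(1)
  show ?thesis
  proof (rule cylinderI)
    show "(\<lambda>x. f x + g x) \<in> borel_measurable S" by measurable
    show "depends_on {..<max q q'} (\<lambda>x. f x + g x)"
      by (rule depends_on_comp2[where h = "(+)", OF depends_on_mono[OF f(2)] depends_on_mono[OF g(2)]]) auto
    show "\<bar>f x + g x\<bar> \<le> B + B'" for x
      using f(3)[of x] g(3)[of x] by linarith
  qed
qed

lemma cylinder_cmult:
  assumes "f \<in> cylinder"
  shows "(\<lambda>x. c * f x) \<in> cylinder"
proof -
  obtain q B where f: "f \<in> borel_measurable S" "depends_on {..<q} f" "\<And>x. \<bar>f x\<bar> \<le> B"
    using assms(1) unfolding cylinder_def by blast
  note [measurable] = f(1)
  show ?thesis
  proof (rule cylinderI)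
    show "(\<lambda>x. c * f x) \<in> borel_measurable S" by measurable
    show "depends_on {..<q} (\<lambda>x. c * f x)"
      by (rule depends_on_comp[OF f(2)])
    show "\<bar>c * f x\<bar> \<le> \<bar>c\<bar> * B" for x
      using f(3)[of x] by (simp add: abs_mult mult_left_mono)
  qed
qed

lemma cylinder_diff:
  "f \<in> cylinder \<Longrightarrow> g \<in> cylinder \<Longrightarrow> (\<lambda>x. f x - g x) \<in> cylinder"
  using cylinder_add[OF _ cylinder_cmult[of g "-1"], of f] by simp

lemma cylinder_sum:
  "(\<And>i. i \<in> I \<Longrightarrow> f i \<in> cylinder) \<Longrightarrow> (\<lambda>x. \<Sum>i\<in>I. f i x) \<in> cylinder"
  by (induction I rule: infinite_finite_induct) (auto intro: cylinder_const cylinder_add)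

lemma cylinder_shift:
  assumes "f \<in> cylinder"
  shows "(\<lambda>x. f (shift k x)) \<in> cylinder"
proof -
  obtain q B where f: "f \<in> borel_measurable S" "depends_on {..<q} f" "\<And>x. \<bar>f x\<bar> \<le> B"
    using assms(1) unfolding cylinder_def by blast
  note [measurable] = f(1)
  show ?thesis
  proof (rule cylinderI)
    show "(\<lambda>x. f (shift k x)) \<in> borel_measurable S" by measurable
    show "depends_on {..<k + q} (\<lambda>x. f (shift k x))"
      by (rule depends_on_mono[OF depends_on_shift[OF f(2)]]) auto
  qed (rule f(3))
qed

text \<open>Coordinate 0 is integrated out and the others are renumbered down by one, so the window
  loses one place; truncated subtraction is right for an empty window.\<close>

lemma depends_on_avg:
  assumes "depends_on {..<q} f"
  shows "depends_on {..<q - 1} (avg f)"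
proof -
  have "f (case_nat z x) = f (case_nat z y)" if "\<forall>i\<in>{..<q - 1}. x i = y i" for x y z
    using that by (intro depends_onD[OF assms]) (auto split: nat.split)
  then have "avg f x = avg f y" if "\<forall>i\<in>{..<q - 1}. x i = y i" for x y
    unfolding avg_def using that by (intro Bochner_Integration.integral_cong) auto
  then show ?thesis by (simp add: depends_on_def)
qed

lemma depends_on_avg_pow: "depends_on {..<q} f \<Longrightarrow> depends_on {..<q - k} ((avg ^^ k) f)"
proof (induction k)
  case (Suc k)
  from depends_on_avg[OF Suc.IH[OF Suc.prems]] show ?case by simp
qed simp

lemma cylinder_avg:
  assumes "f \<in> cylinder"
  shows "avg f \<in> cylinder"
proof -
  obtain q B where f: "f \<in> borel_measurable S" "depends_on {..<q} f" "\<And>x. \<bar>f x\<bar> \<le> B"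
    using assms(1) unfolding cylinder_def by blast
  note [measurable] = f(1)
  show ?thesis
  proof (rule cylinderI)
    show "avg f \<in> borel_measurable S" by measurable
    show "depends_on {..<q - 1} (avg f)" by (rule depends_on_avg[OF f(2)])
    show "\<bar>avg f x\<bar> \<le> B" for x
    proof -
      have "0 \<le> B" by (rule order_trans[OF abs_ge_zero f(3)])
      have "\<bar>avg f x\<bar> \<le> (\<integral>y. \<bar>f (case_nat y x)\<bar> \<partial>M)"
        unfolding avg_def by (rule integral_abs_bound)
      also have "\<dots> \<le> (\<integral>y. B \<partial>M)"
        using f \<open>0 \<le> B\<close> by (intro integral_mono M.integrable_const_bound[of _ B]) auto
      finally show ?thesis by (simp add: M.prob_space)
    qed
  qed
qed

definition approximable :: "((nat \<Rightarrow> 'b) \<Rightarrow> real) \<Rightarrow> bool" where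
  "approximable f \<longleftrightarrow> f \<in> square_integrable S \<and>
     (\<forall>\<delta>>0. \<exists>g\<in>cylinder. rv_norm S (\<lambda>x. f x - g x) < \<delta>)"

lemma approximableD: "approximable f \<Longrightarrow> \<delta> > 0 \<Longrightarrow> \<exists>g\<in>cylinder. rv_norm S (\<lambda>x. f x - g x) < \<delta>"
  by (auto simp: approximable_def)

lemma approximable_square_integrable: "approximable f \<Longrightarrow> f \<in> square_integrable S"
  by (auto simp: approximable_def)

lemma approximable_cylinder: "f \<in> cylinder \<Longrightarrow> approximable f"
  unfolding approximable_def
  by (intro conjI allI impI bexI[of _ f] cylinder_square_integrable) (auto simp: rv_norm_def)

lemma approximable_closed:
  assumes f: "f \<in> square_integrable S"
    and *: "\<And>\<delta>. \<delta> > 0 \<Longrightarrow> \<exists>g. approximable g \<and> rv_norm S (\<lambda>x. f x - g x) < \<delta>"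
  shows "approximable f"
  unfolding approximable_def
proof (intro conjI f allI impI)
  fix \<delta> :: real assume "\<delta> > 0"
  then obtain g where g: "approximable g" "rv_norm S (\<lambda>x. f x - g x) < \<delta> / 2"
    using *[of "\<delta> / 2"] by auto
  then obtain h where h: "h \<in> cylinder" "rv_norm S (\<lambda>x. g x - h x) < \<delta> / 2"
    using approximableD[of g "\<delta> / 2"] \<open>\<delta> > 0\<close> by auto
  have "rv_norm S (\<lambda>x. (f x - g x) + (g x - h x))
      \<le> rv_norm S (\<lambda>x. f x - g x) + rv_norm S (\<lambda>x. g x - h x)"
    by (intro rv_norm_add square_integrable_diff f approximable_square_integrable[OF g(1)]
        cylinder_square_integrable[OF h(1)])
  with g h have "rv_norm S (\<lambda>x. f x - h x) < \<delta>" by simp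
  with h(1) show "\<exists>g\<in>cylinder. rv_norm S (\<lambda>x. f x - g x) < \<delta>" by blast
qed

lemma approximable_add:
  assumes f: "approximable f" and g: "approximable g"
  shows "approximable (\<lambda>x. f x + g x)"
  unfolding approximable_def
proof (intro conjI allI impI square_integrable_add approximable_square_integrable f g)
  fix \<delta> :: real assume "\<delta> > 0"
  then obtain u v where u: "u \<in> cylinder" "rv_norm S (\<lambda>x. f x - u x) < \<delta> / 2"
    and v: "v \<in> cylinder" "rv_norm S (\<lambda>x. g x - v x) < \<delta> / 2"
    using approximableD[OF f, of "\<delta> / 2"] approximableD[OF g, of "\<delta> / 2"] by auto
  have "rv_norm S (\<lambda>x. (f x - u x) + (g x - v x))
      \<le> rv_norm S (\<lambda>x. f x - u x) + rv_norm S (\<lambda>x. g x - v x)"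
    by (intro rv_norm_add square_integrable_diff approximable_square_integrable[OF f]
        approximable_square_integrable[OF g] cylinder_square_integrable[OF u(1)]
        cylinder_square_integrable[OF v(1)])
  also have "\<dots> < \<delta>" using u v by simp
  finally have "rv_norm S (\<lambda>x. (f x + g x) - (u x + v x)) < \<delta>"
    by (simp add: algebra_simps)
  then show "\<exists>w\<in>cylinder. rv_norm S (\<lambda>x. (f x + g x) - w x) < \<delta>"
    by (intro bexI[of _ "\<lambda>x. u x + v x"] cylinder_add[OF u(1) v(1)])
qed

lemma approximable_cmult:
  assumes f: "approximable f"
  shows "approximable (\<lambda>x. c * f x)"
  unfolding approximable_def
proof (intro conjI allI impI square_integrable_cmult approximable_square_integrable f)
  fix \<delta> :: real assume "\<delta> > 0"
  then obtain u where u: "u \<in> cylinder" "rv_norm S (\<lambda>x. f x - u x) < \<delta> / (\<bar>c\<bar> + 1)"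
    using approximableD[OF f, of "\<delta> / (\<bar>c\<bar> + 1)"] by auto
  have "rv_norm S (\<lambda>x. c * (f x - u x)) \<le> \<bar>c\<bar> * (\<delta> / (\<bar>c\<bar> + 1))"
    using u by (simp only: rv_norm_cmult) (intro mult_left_mono, auto)
  also have "\<dots> < \<delta>" using \<open>\<delta> > 0\<close> by (simp add: field_simps)
  finally have "rv_norm S (\<lambda>x. c * f x - c * u x) < \<delta>"
    by (simp add: algebra_simps)
  then show "\<exists>w\<in>cylinder. rv_norm S (\<lambda>x. c * f x - w x) < \<delta>"
    by (intro bexI[of _ "\<lambda>x. c * u x"] cylinder_cmult[OF u(1)])
qed

text \<open>The squared errors are dominated by \<open>4 * (g x)\<^sup>2\<close>, so pointwise
  convergence becomes convergence in \<open>rv_norm\<close>, and approximable functions are closed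
  under that.\<close>

lemma approximable_dominated:
  assumes U: "\<And>n. approximable (U n)" and lim: "\<And>x. (\<lambda>n. U n x) \<longlonglongrightarrow> f x"
    and le: "\<And>n x. \<bar>U n x\<bar> \<le> g x" and g: "g \<in> square_integrable S"
    and [measurable]: "f \<in> borel_measurable S"
  shows "approximable f"
proof (rule approximable_closed)
  have [measurable]: "U n \<in> borel_measurable S" for n
    using approximable_square_integrable[OF U] by (rule square_integrable_measurable)
  have fle: "\<bar>f x\<bar> \<le> g x" for x
    by (rule LIMSEQ_le_const2[OF tendsto_rabs[OF lim]]) (use le in auto)
  have ig: "integrable S (\<lambda>x. 4 * (g x)\<^sup>2)"
    using square_integrable_square[OF g] by simp
  have sq: "(a - b)\<^sup>2 \<le> 4 * c\<^sup>2" if "\<bar>a\<bar> \<le> c" "\<bar>b\<bar> \<le> c" for a b c :: real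
  proof -
    have "\<bar>a - b\<bar>\<^sup>2 \<le> (2 * c)\<^sup>2" using that by (intro power_mono) auto
    then show ?thesis by (simp add: power_mult_distrib)
  qed
  show f: "f \<in> square_integrable S"
  proof -
    have "integrable S (\<lambda>x. (f x)\<^sup>2)"
    proof (rule Bochner_Integration.integrable_bound[OF ig])
      show "AE x in S. norm ((f x)\<^sup>2) \<le> norm (4 * (g x)\<^sup>2)"
        using sq[OF fle, of 0] order_trans[OF abs_ge_zero fle] by simp
    qed measurable
    then show ?thesis by (simp add: square_integrable_def)
  qed
  have "(\<lambda>n. \<integral>x. (f x - U n x)\<^sup>2 \<partial>S) \<longlonglongrightarrow> (\<integral>x. 0 \<partial>S)"
  proof (rule integral_dominated_convergence[OF _ _ ig])
    show "AE x in S. (\<lambda>n. (f x - U n x)\<^sup>2) \<longlonglongrightarrow> 0"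
    proof (rule AE_I2)
      fix x
      have "(\<lambda>n. (f x - U n x)\<^sup>2) \<longlonglongrightarrow> (f x - f x)\<^sup>2" by (intro tendsto_intros lim)
      then show "(\<lambda>n. (f x - U n x)\<^sup>2) \<longlonglongrightarrow> 0" by simp
    qed
    show "AE x in S. norm ((f x - U n x)\<^sup>2) \<le> 4 * (g x)\<^sup>2" for n
      using sq[OF fle le] by simp
  qed measurable
  then have "(\<lambda>n. rv_norm S (\<lambda>x. f x - U n x)) \<longlonglongrightarrow> sqrt 0"
    unfolding rv_norm_def by (intro tendsto_intros) simp
  then have *: "(\<lambda>n. rv_norm S (\<lambda>x. f x - U n x)) \<longlonglongrightarrow> 0" by simp
  fix \<delta> :: real assume "\<delta> > 0"
  from order_tendstoD(2)[OF * this] obtain n where "rv_norm S (\<lambda>x. f x - U n x) < \<delta>"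
    by (auto simp: eventually_sequentially)
  with U show "\<exists>g. approximable g \<and> rv_norm S (\<lambda>x. f x - g x) < \<delta>" by blast
qed

text \<open>Dynkin's pi-lambda argument: finite-dimensional boxes are cylinders, complements are
  linear combinations, and countable disjoint unions are dominated limits of finite ones.\<close>

lemma approximable_indicator:
  assumes "A \<in> sets S"
  shows "approximable (indicator A)"
proof -
  have "A \<in> sigma_sets (\<Pi>\<^sub>E i\<in>UNIV. space M) (prod_algebra UNIV (\<lambda>_::nat. M))"
    using assms by (simp add: sets_PiM)
  with Int_stable_prod_algebra prod_algebra_sets_into_space
  show ?thesis
  proof (induction A rule: sigma_sets_induct_disjoint)
    case (basic A)
    from basic obtain J E where A: "A = prod_emb UNIV (\<lambda>_. M) J (Pi\<^sub>E J E)" and J: "finite J"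
      and E: "\<And>i. i \<in> J \<Longrightarrow> E i \<in> sets M"
      by (elim prod_algebraE) auto
    have A': "x \<in> A \<longleftrightarrow> (\<forall>i\<in>J. x i \<in> E i)" for x
      by (auto simp: A prod_emb_def space_M PiE_iff)
    obtain q where q: "J \<subseteq> {..<q}" using finite_nat_bounded[OF J] by auto
    have "indicator A \<in> cylinder"
    proof (rule cylinderI)
      have "A \<in> sets S" using basic by (simp add: sets_PiM sigma_sets.Basic)
      then show "indicator A \<in> borel_measurable S" by simp
      show "depends_on {..<q} (indicator A :: _ \<Rightarrow> real)"
      proof -
        have "depends_on J (indicator A :: _ \<Rightarrow> real)"
          unfolding depends_on_def by (auto simp: indicator_def A')
        then show ?thesis by (rule depends_on_mono[OF _ q])
      qed
      show "\<bar>indicator A x :: real\<bar> \<le> 1" for x by (simp add: indicator_def)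
    qed
    then show ?case by (rule approximable_cylinder)
  next
    case empty
    then show ?case using approximable_cylinder[OF cylinder_const[of 0]] by (simp add: indicator_def[abs_def])
  next
    case (compl A)
    have "indicator ((\<Pi>\<^sub>E i\<in>UNIV. space M) - A) = (\<lambda>x. 1 + (-1) * indicator A x :: real)"
      by (auto simp: fun_eq_iff indicator_def space_M)
    moreover have "approximable (\<lambda>x. 1 + (-1) * indicator A x :: real)"
      by (intro approximable_add approximable_cylinder[OF cylinder_const] approximable_cmult compl)
    ultimately show ?case by metis
  next
    case (union A)
    have "A i \<in> sets S" for i using union by (auto simp: sets_PiM)
    then have m: "(\<Union>i. A i) \<in> sets S" by auto
    have "approximable (indicator (\<Union>i<n. A i))" for n
    proof (induction n)
      case 0
      then show ?case using approximable_cylinder[OF cylinder_const[of 0]] by (simp add: indicator_def[abs_def])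
    next
      case (Suc n)
      have "x \<notin> A i" if "x \<in> A n" "i < n" for x i
      proof -
        have "A i \<inter> A n = {}"
          using disjoint_family_onD[OF union(1), of i n] \<open>i < n\<close> by simp
        with that show ?thesis by auto
      qed
      then have "indicator (\<Union>i<Suc n. A i) = (\<lambda>x. indicator (\<Union>i<n. A i) x + indicator (A n) x :: real)"
        by (auto simp: fun_eq_iff indicator_def less_Suc_eq)
      with approximable_add[OF Suc union(3)] show ?case by simp
    qed
    then show ?case
    proof (rule approximable_dominated)
      show "(\<lambda>n. indicator (\<Union>i<n. A i) x :: real) \<longlonglongrightarrow> indicator (\<Union>i. A i) x" for x
        by (rule LIMSEQ_indicator_UN)
      show "\<bar>indicator (\<Union>i<n. A i) x :: real\<bar> \<le> 1" for n x
        by (simp add: indicator_def)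
      show "(\<lambda>_. 1) \<in> square_integrable S"
        by (intro cylinder_square_integrable cylinder_const)
      show "indicator (\<Union>i. A i) \<in> borel_measurable S" using m by simp
    qed
  qed
qed

text \<open>Square integrability is a premise of the conclusion so that the induction carries it: it
  passes down to the summands and to the members of an increasing sequence, which lie below the
  function.\<close>

lemma approximable_nonneg:
  assumes "f \<in> borel_measurable S" "\<And>x. 0 \<le> f x"
  shows "integrable S (\<lambda>x. (f x)\<^sup>2) \<Longrightarrow> approximable f"
  using assms
proof (induction rule: borel_measurable_induct_real)
  case (set A)
  then show ?case by (intro approximable_indicator)
next
  case (mult u c)
  show ?case
  proof (cases "c = 0")
    case True
    then show ?thesis using approximable_cylinder[OF cylinder_const[of 0]] by simp
  next
    case False
    then show ?thesis using mult by (intro approximable_cmult) (auto simp: power_mult_distrib)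
  qed
next
  case (add u v)
  have meas [measurable]: "u \<in> borel_measurable S" "v \<in> borel_measurable S" by fact+
  have nn: "0 \<le> u x" "0 \<le> v x" for x by fact+
  have "integrable S (\<lambda>x. (u x)\<^sup>2)"
    by (rule Bochner_Integration.integrable_bound[OF add.prems(1)])
       (auto intro!: AE_I2 power_mono simp: nn)
  moreover have "integrable S (\<lambda>x. (v x)\<^sup>2)"
    by (rule Bochner_Integration.integrable_bound[OF add.prems(1)])
       (auto intro!: AE_I2 power_mono simp: nn)
  ultimately show ?case using add.IH meas nn by (intro approximable_add) blast+
next
  case (seq U)
  have le: "U i x \<le> f x" for i x
  proof (rule incseq_le)
    show "incseq (\<lambda>i. U i x)" using \<open>incseq U\<close> by (simp add: incseq_def le_fun_def)
    show "(\<lambda>i. U i x) \<longlonglongrightarrow> f x"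
      using \<open>\<And>x. x \<in> space S \<Longrightarrow> (\<lambda>i. U i x) \<longlonglongrightarrow> f x\<close> by (simp add: space_S)
  qed
  have "integrable S (\<lambda>x. (U i x)\<^sup>2)" for i
    by (rule Bochner_Integration.integrable_bound[OF seq.prems])
       (use seq(1,2) le in \<open>auto intro!: power_mono\<close>)
  then have "approximable (U i)" for i using seq by auto
  then show ?case
  proof (rule approximable_dominated)
    show "f \<in> square_integrable S" using seq.prems assms by (simp add: square_integrable_def)
  qed (use seq le assms in \<open>auto simp: space_S\<close>)
qed

lemma square_integrable_approximable:
  assumes f: "f \<in> square_integrable S"
  shows "approximable f"
proof -
  have [measurable]: "f \<in> borel_measurable S" using f by (rule square_integrable_measurable)
  have "approximable (\<lambda>x. max 0 (g x))" if g: "g \<in> square_integrable S" for g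
  proof (rule approximable_nonneg)
    show "integrable S (\<lambda>x. (max 0 (g x))\<^sup>2)"
      by (rule Bochner_Integration.integrable_bound[OF square_integrable_square[OF g]])
         (use square_integrable_measurable[OF g] in \<open>auto simp: max_def\<close>)
  qed (use square_integrable_measurable[OF g] in auto)
  from approximable_add[OF this[OF f] approximable_cmult[OF this[OF square_integrable_cmult[OF f]], of "-1" "-1"]]
  have "approximable (\<lambda>x. max 0 (f x) + - 1 * max 0 (- 1 * f x))" .
  moreover have "max 0 (f x) + - 1 * max 0 (- 1 * f x) = f x" for x by (simp add: max_def)
  ultimately show ?thesis by simp
qed

text \<open>Triviality of the remote past in L^2 form. Let \<open>h = (avg ^^ k) G\<close> and let
  \<open>g\<close> be a cylinder function near \<open>G\<close>. Once \<open>k\<close> exceeds the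
  window of \<open>g\<close>, \<open>(avg ^^ k) g\<close> is constant and so orthogonal to the
  centred \<open>h\<close>. Hence the squared norm of \<open>h\<close> is the inner product of
  \<open>G - g\<close> with \<open>h\<close> composed with \<open>shift k\<close>, and
  Cauchy-Schwarz bounds the norm of \<open>h\<close> by that of \<open>G - g\<close>.\<close>

lemma rv_norm_avg_pow_tendsto_0:
  assumes G: "G \<in> square_integrable S" and mean: "(\<integral>x. G x \<partial>S) = 0"
  shows "(\<lambda>k. rv_norm S ((avg ^^ k) G)) \<longlonglongrightarrow> 0"
proof (rule order_tendstoI)
  fix \<delta> :: real assume "0 < \<delta>"
  then obtain g where g: "g \<in> cylinder" and less: "rv_norm S (\<lambda>x. G x - g x) < \<delta>"
    using approximableD[OF square_integrable_approximable[OF G]] by blast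
  from g obtain q where q: "depends_on {..<q} g" unfolding cylinder_def by blast
  have "rv_norm S ((avg ^^ k) G) < \<delta>" if "q \<le> k" for k
  proof -
    define h where "h = (avg ^^ k) G"
    have h: "h \<in> square_integrable S" unfolding h_def by (rule square_integrable_avg_pow[OF G])
    have gL: "g \<in> square_integrable S" by (rule cylinder_square_integrable[OF g])
    have "depends_on {} ((avg ^^ k) g)" using depends_on_avg_pow[OF q, of k] that by simp
    then have const: "(avg ^^ k) g x = (avg ^^ k) g (\<lambda>_. undefined)" for x
      by (rule depends_onD) simp
    have "(\<integral>x. g x * h (shift k x) \<partial>S) = (\<integral>x. (avg ^^ k) g x * h x \<partial>S)"
      by (rule avg_pow_adjoint[OF gL h])
    also have "\<dots> = (avg ^^ k) g (\<lambda>_. undefined) * (\<integral>x. h x \<partial>S)"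
      by (subst const) simp
    also have "(\<integral>x. h x \<partial>S) = 0"
      unfolding h_def by (simp add: integral_avg_pow[OF G] mean)
    finally have g0: "(\<integral>x. g x * h (shift k x) \<partial>S) = 0" by simp
    have "(rv_norm S h)\<^sup>2 = (\<integral>x. (avg ^^ k) G x * h x \<partial>S)"
      unfolding rv_norm_square by (simp add: h_def power2_eq_square)
    also have "\<dots> = (\<integral>x. G x * h (shift k x) \<partial>S)"
      by (rule avg_pow_adjoint[OF G h, symmetric])
    also have "\<dots> = (\<integral>x. (G x - g x) * h (shift k x) \<partial>S)"
      using square_integrable_mult[OF G square_integrable_shift[OF h]]
        square_integrable_mult[OF gL square_integrable_shift[OF h]] g0
      by (simp add: left_diff_distrib)
    also have "\<dots> \<le> rv_norm S (\<lambda>x. G x - g x) * rv_norm S (\<lambda>x. h (shift k x))"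
      by (intro inner_le_rv_norm square_integrable_diff square_integrable_shift G gL h)
    also have "rv_norm S (\<lambda>x. h (shift k x)) = rv_norm S h"
      by (rule rv_norm_shift[OF square_integrable_measurable[OF h]])
    finally have "(rv_norm S h)\<^sup>2 \<le> rv_norm S (\<lambda>x. G x - g x) * rv_norm S h" .
    then have "rv_norm S h = 0 \<or> rv_norm S h \<le> rv_norm S (\<lambda>x. G x - g x)"
      using rv_norm_nonneg[of S h] unfolding power2_eq_square mult_le_cancel_right by auto
    with less \<open>0 < \<delta>\<close> show ?thesis by (auto simp: h_def)
  qed
  then show "\<forall>\<^sub>F k in sequentially. rv_norm S ((avg ^^ k) G) < \<delta>"
    by (auto simp: eventually_sequentially)
qed (use rv_norm_nonneg in \<open>auto intro: always_eventually less_le_trans\<close>)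

section \<open>Approximation uniform in the weights\<close>

text \<open>The operator norm of \<open>b \<mapsto> \<Sum>i. b i * h (shift i x)\<close> from
  square-summable weights to L^2 is at most \<open>c\<close>.\<close>

definition sums_bounded :: "((nat \<Rightarrow> 'b) \<Rightarrow> real) \<Rightarrow> real \<Rightarrow> bool" where
  "sums_bounded h c \<longleftrightarrow> (\<forall>I b. finite I \<longrightarrow>
     rv_norm S (\<lambda>x. \<Sum>i\<in>I. b i * h (shift i x)) \<le> c * sqrt (\<Sum>i\<in>I. (b i)\<^sup>2))"

lemma square_integrable_shift_sum:
  "h \<in> square_integrable S \<Longrightarrow> (\<lambda>x. \<Sum>i\<in>I. b i * h (shift (k i) x)) \<in> square_integrable S"
  by (intro square_integrable_sum square_integrable_cmult square_integrable_shift)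

lemma sums_bounded_shift:
  assumes h: "h \<in> square_integrable S" and "sums_bounded h c"
  shows "sums_bounded (\<lambda>x. h (shift l x)) c"
  unfolding sums_bounded_def
proof (intro allI impI)
  fix I :: "nat set" and b :: "nat \<Rightarrow> real" assume I: "finite I"
  have "rv_norm S (\<lambda>x. \<Sum>i\<in>I. b i * h (shift l (shift i x)))
      = rv_norm S (\<lambda>x. (\<lambda>x. \<Sum>i\<in>I. b i * h (shift i x)) (shift l x))"
    by (simp add: add.commute)
  also have "\<dots> = rv_norm S (\<lambda>x. \<Sum>i\<in>I. b i * h (shift i x))"
    by (rule rv_norm_shift[OF square_integrable_measurable[OF square_integrable_shift_sum[OF h]]])
  finally show "rv_norm S (\<lambda>x. \<Sum>i\<in>I. b i * h (shift l (shift i x))) \<le> c * sqrt (\<Sum>i\<in>I. (b i)\<^sup>2)"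
    using assms(2) I by (simp add: sums_bounded_def)
qed

lemma sums_bounded_add:
  assumes f: "f \<in> square_integrable S" and g: "g \<in> square_integrable S"
    and fc: "sums_bounded f c" and gd: "sums_bounded g d"
  shows "sums_bounded (\<lambda>x. f x + g x) (c + d)"
  unfolding sums_bounded_def
proof (intro allI impI)
  fix I :: "nat set" and b :: "nat \<Rightarrow> real" assume I: "finite I"
  have "rv_norm S (\<lambda>x. \<Sum>i\<in>I. b i * (f (shift i x) + g (shift i x)))
      = rv_norm S (\<lambda>x. (\<Sum>i\<in>I. b i * f (shift i x)) + (\<Sum>i\<in>I. b i * g (shift i x)))"
    by (simp add: distrib_left sum.distrib)
  also have "\<dots> \<le> rv_norm S (\<lambda>x. \<Sum>i\<in>I. b i * f (shift i x)) + rv_norm S (\<lambda>x. \<Sum>i\<in>I. b i * g (shift i x))"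
    by (rule rv_norm_add[OF square_integrable_shift_sum[OF f] square_integrable_shift_sum[OF g]])
  also have "\<dots> \<le> c * sqrt (\<Sum>i\<in>I. (b i)\<^sup>2) + d * sqrt (\<Sum>i\<in>I. (b i)\<^sup>2)"
    using fc gd I unfolding sums_bounded_def by (intro add_mono) blast+
  finally show "rv_norm S (\<lambda>x. \<Sum>i\<in>I. b i * (f (shift i x) + g (shift i x)))
      \<le> (c + d) * sqrt (\<Sum>i\<in>I. (b i)\<^sup>2)"
    by (simp add: distrib_right)
qed

lemma sums_bounded_sum:
  assumes "finite L" "\<And>l. l \<in> L \<Longrightarrow> f l \<in> square_integrable S" "\<And>l. l \<in> L \<Longrightarrow> sums_bounded (f l) (c l)"
  shows "sums_bounded (\<lambda>x. \<Sum>l\<in>L. f l x) (\<Sum>l\<in>L. c l)"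
  using assms
proof (induction L rule: finite_induct)
  case empty
  then show ?case by (simp add: sums_bounded_def rv_norm_def)
next
  case (insert l L)
  have "sums_bounded (\<lambda>x. f l x + (\<Sum>l\<in>L. f l x)) (c l + (\<Sum>l\<in>L. c l))"
    using insert by (intro sums_bounded_add square_integrable_sum) auto
  with insert show ?case by simp
qed

lemma sums_bounded_mono:
  assumes "sums_bounded f c" "c \<le> d"
  shows "sums_bounded f d"
  unfolding sums_bounded_def
proof (intro allI impI)
  fix I :: "nat set" and b :: "nat \<Rightarrow> real" assume "finite I"
  then have "rv_norm S (\<lambda>x. \<Sum>i\<in>I. b i * f (shift i x)) \<le> c * sqrt (\<Sum>i\<in>I. (b i)\<^sup>2)"
    using assms(1) by (simp add: sums_bounded_def)
  also have "\<dots> \<le> d * sqrt (\<Sum>i\<in>I. (b i)\<^sup>2)"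
    using assms(2) by (intro mult_right_mono) (auto intro: sum_nonneg)
  finally show "rv_norm S (\<lambda>x. \<Sum>i\<in>I. b i * f (shift i x)) \<le> d * sqrt (\<Sum>i\<in>I. (b i)\<^sup>2)" .
qed

lemma sums_bounded_martingale:
  assumes "u \<in> square_integrable S" "AE x in S. avg u x = 0"
  shows "sums_bounded u (rv_norm S u)"
  using assms by (simp add: sums_bounded_def rv_norm_martingale_sum)

text \<open>\<open>innov G l\<close> is the function \<open>d\<close> of the past with \<open>\<P>\<^sub>0 X\<^sub>l = d(\<epsilon>\<^sub>0, \<epsilon>\<^sub>-\<^sub>1, \<dots>)\<close>.\<close>

definition innov :: "((nat \<Rightarrow> 'b) \<Rightarrow> real) \<Rightarrow> nat \<Rightarrow> (nat \<Rightarrow> 'b) \<Rightarrow> real" where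
  "innov G l x = (avg ^^ l) G x - (avg ^^ Suc l) G (shift 1 x)"

lemma square_integrable_innov:
  "G \<in> square_integrable S \<Longrightarrow> innov G l \<in> square_integrable S"
  unfolding innov_def[abs_def]
  by (intro square_integrable_diff square_integrable_shift square_integrable_avg_pow)

text \<open>Averaging undoes one shift, so the two terms of \<open>innov\<close> average to the same
  function.\<close>

lemma avg_innov:
  assumes G: "G \<in> square_integrable S"
  shows "AE x in S. avg (innov G l) x = 0"
proof -
  let ?f = "(avg ^^ l) G" and ?g = "(avg ^^ Suc l) G"
  have "AE x in S. avg (\<lambda>x. ?f x - ?g (shift 1 x)) x = avg ?f x - avg (\<lambda>x. ?g (shift 1 x)) x"
    by (intro avg_diff_AE square_integrable_shift square_integrable_avg_pow G)
  moreover have "avg (\<lambda>x. ?g (shift 1 x)) = avg ?f"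
    using avg_shift_1[of ?g 0] by simp
  ultimately show ?thesis by (simp add: innov_def[abs_def])
qed

text \<open>The martingale decomposition: the summands are the contributions of the single
  coordinates \<open>0\<close> to \<open>n - 1\<close>, and the last term is what the coordinates
  from \<open>n\<close> on still predict.\<close>

lemma avg_pow_telescope:
  "(avg ^^ L) G x = (\<Sum>l<n. innov G (L + l) (shift l x)) + (avg ^^ (L + n)) G (shift n x)"
  by (induction n) (simp_all add: innov_def)

text \<open>In the telescoped form each martingale difference contributes its own norm, whatever the
  weights. The remainder is bounded by the triangle inequality only; that suffices, since
  \<open>I\<close> and \<open>b\<close> are fixed while \<open>n\<close> tends to infinity.\<close>

lemma sums_bounded_avg_pow:
  assumes G: "G \<in> square_integrable S" and mean: "(\<integral>x. G x \<partial>S) = 0"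
    and sm: "summable (\<lambda>l. rv_norm S (innov G l))"
  shows "sums_bounded ((avg ^^ L) G) (\<Sum>l. rv_norm S (innov G (L + l)))"
  unfolding sums_bounded_def
proof (intro allI impI)
  fix I :: "nat set" and b :: "nat \<Rightarrow> real" assume I: "finite I"
  define s where "s = sqrt (\<Sum>i\<in>I. (b i)\<^sup>2)"
  define c where "c n = (\<Sum>l<n. rv_norm S (innov G (L + l)))" for n
  define r where "r n = (\<Sum>i\<in>I. \<bar>b i\<bar> * rv_norm S ((avg ^^ (L + n)) G))" for n
  let ?h = "(avg ^^ L) G"
  have sm': "summable (\<lambda>l. rv_norm S (innov G (L + l)))"
    using summable_ignore_initial_segment[OF sm, of L] by (simp add: add.commute)
  have le: "rv_norm S (\<lambda>x. \<Sum>i\<in>I. b i * ?h (shift i x)) \<le> c n * s + r n" for n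
  proof -
    let ?u = "\<lambda>x. \<Sum>l<n. innov G (L + l) (shift l x)"
    let ?v = "\<lambda>x. (avg ^^ (L + n)) G (shift n x)"
    have u: "?u \<in> square_integrable S"
      by (intro square_integrable_sum square_integrable_shift square_integrable_innov G)
    have v: "?v \<in> square_integrable S"
      by (intro square_integrable_shift square_integrable_avg_pow G)
    have "sums_bounded ?u (c n)"
      unfolding c_def
      by (intro sums_bounded_sum finite_lessThan square_integrable_shift square_integrable_innov
          sums_bounded_shift sums_bounded_martingale avg_innov G)
    then have 1: "rv_norm S (\<lambda>x. \<Sum>i\<in>I. b i * ?u (shift i x)) \<le> c n * s"
      using I by (simp add: sums_bounded_def s_def)
    have "rv_norm S (\<lambda>x. \<Sum>i\<in>I. b i * ?v (shift i x)) \<le> (\<Sum>i\<in>I. rv_norm S (\<lambda>x. b i * ?v (shift i x)))"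
      by (intro rv_norm_sum square_integrable_cmult square_integrable_shift[OF v])
    also have "\<dots> = r n"
      unfolding r_def rv_norm_cmult shift_shift
      by (intro sum.cong refl arg_cong2[where f = times] rv_norm_shift square_integrable_measurable
          square_integrable_avg_pow G)
    finally have 2: "rv_norm S (\<lambda>x. \<Sum>i\<in>I. b i * ?v (shift i x)) \<le> r n" .
    have "rv_norm S (\<lambda>x. \<Sum>i\<in>I. b i * ?h (shift i x))
        = rv_norm S (\<lambda>x. (\<Sum>i\<in>I. b i * ?u (shift i x)) + (\<Sum>i\<in>I. b i * ?v (shift i x)))"
      by (subst avg_pow_telescope[of L _ _ n]) (simp add: distrib_left sum.distrib)
    also have "\<dots> \<le> c n * s + r n"
      by (rule order_trans[OF rv_norm_add[OF square_integrable_shift_sum[OF u]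
              square_integrable_shift_sum[OF v]] add_mono[OF 1 2]])
    finally show ?thesis .
  qed
  have c: "c \<longlonglongrightarrow> (\<Sum>l. rv_norm S (innov G (L + l)))"
    unfolding c_def by (rule summable_LIMSEQ[OF sm'])
  have "(\<lambda>n. rv_norm S ((avg ^^ (L + n)) G)) \<longlonglongrightarrow> 0"
    using LIMSEQ_ignore_initial_segment[OF rv_norm_avg_pow_tendsto_0[OF G mean], of L]
    by (simp add: add.commute)
  then have "r \<longlonglongrightarrow> (\<Sum>i\<in>I. \<bar>b i\<bar> * 0)"
    unfolding r_def by (intro tendsto_intros)
  then have "(\<lambda>n. c n * s + r n) \<longlonglongrightarrow> (\<Sum>l. rv_norm S (innov G (L + l))) * s + 0"
    by (intro tendsto_intros c) simp
  then show "rv_norm S (\<lambda>x. \<Sum>i\<in>I. b i * ?h (shift i x))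
      \<le> (\<Sum>l. rv_norm S (innov G (L + l))) * sqrt (\<Sum>i\<in>I. (b i)\<^sup>2)"
    using le by (intro LIMSEQ_le_const[of "\<lambda>n. c n * s + r n"]) (auto simp: s_def)
qed

text \<open>A cylinder approximant \<open>g\<close> of \<open>d\<close> need not be a martingale
  difference, so its average is subtracted. Since \<open>avg d\<close> vanishes,
  \<open>avg g\<close> has the norm of \<open>avg (d - g)\<close>, at most that of
  \<open>d - g\<close>; the correction thus at most doubles the error, whence
  \<open>\<delta> / 2\<close> for \<open>g\<close>.\<close>

lemma martingale_difference_cylinder:
  assumes d: "d \<in> square_integrable S" "AE x in S. avg d x = 0" and "0 < \<delta>"
  obtains w where "w \<in> cylinder" "(\<integral>x. w x \<partial>S) = 0" "sums_bounded (\<lambda>x. d x - w x) \<delta>"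
proof -
  obtain g where g: "g \<in> cylinder" and less: "rv_norm S (\<lambda>x. d x - g x) < \<delta> / 2"
    using approximableD[OF square_integrable_approximable[OF d(1)], of "\<delta> / 2"] \<open>0 < \<delta>\<close> by auto
  have gL: "g \<in> square_integrable S" by (rule cylinder_square_integrable[OF g])
  define w where "w x = g x - avg g (shift 1 x)" for x
  have w: "w \<in> cylinder"
    unfolding w_def[abs_def] by (intro cylinder_diff cylinder_shift cylinder_avg g)
  have wL: "w \<in> square_integrable S" by (rule cylinder_square_integrable[OF w])
  have w0: "AE x in S. avg w x = 0"
  proof -
    have "AE x in S. avg (\<lambda>x. g x - avg g (shift 1 x)) x = avg g x - avg (\<lambda>x. avg g (shift 1 x)) x"
      by (intro avg_diff_AE gL square_integrable_shift square_integrable_avg)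
    moreover have "avg (\<lambda>x. avg g (shift 1 x)) = avg g"
      using avg_shift_1[of "avg g" 0] by simp
    ultimately show ?thesis by (simp add: w_def[abs_def])
  qed
  have "(\<integral>x. w x \<partial>S) = (\<integral>x. avg w x \<partial>S)"
    by (rule integral_avg[OF P.square_integrable_integrable[OF wL], symmetric])
  also have "\<dots> = (\<integral>x. 0 \<partial>S)"
    using w0 square_integrable_measurable[OF wL] by (intro integral_cong_AE) auto
  finally have mean: "(\<integral>x. w x \<partial>S) = 0" by simp
  have dw: "(\<lambda>x. d x - w x) \<in> square_integrable S" by (intro square_integrable_diff d wL)
  have "AE x in S. avg (\<lambda>x. d x - w x) x = 0"
    using avg_diff_AE[OF d(1) wL] d(2) w0 by eventually_elim simp
  then have bd: "sums_bounded (\<lambda>x. d x - w x) (rv_norm S (\<lambda>x. d x - w x))"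
    by (rule sums_bounded_martingale[OF dw])
  have dg: "(\<lambda>x. d x - g x) \<in> square_integrable S" by (intro square_integrable_diff d gL)
  have ag: "avg g \<in> square_integrable S" by (rule square_integrable_avg[OF gL])
  have [measurable]: "avg g \<in> borel_measurable S" "avg (\<lambda>x. d x - g x) \<in> borel_measurable S"
    by (rule square_integrable_measurable[OF ag],
        rule square_integrable_measurable[OF square_integrable_avg[OF dg]])
  have "AE x in S. avg (\<lambda>x. d x - g x) x = - avg g x"
    using avg_diff_AE[OF d(1) gL] d(2) by eventually_elim simp
  then have "AE x in S. (avg g x)\<^sup>2 = (avg (\<lambda>x. d x - g x) x)\<^sup>2"
    by eventually_elim simp
  then have "(\<integral>x. (avg g x)\<^sup>2 \<partial>S) = (\<integral>x. (avg (\<lambda>x. d x - g x) x)\<^sup>2 \<partial>S)"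
    by (rule integral_cong_AE[rotated 2]) measurable
  then have "rv_norm S (avg g) = rv_norm S (avg (\<lambda>x. d x - g x))"
    by (simp add: rv_norm_def)
  also have "\<dots> \<le> rv_norm S (\<lambda>x. d x - g x)" by (rule rv_norm_avg[OF dg])
  finally have ag_le: "rv_norm S (avg g) \<le> rv_norm S (\<lambda>x. d x - g x)" .
  have "rv_norm S (\<lambda>x. d x - w x) = rv_norm S (\<lambda>x. (d x - g x) + avg g (shift 1 x))"
    by (simp add: w_def algebra_simps)
  also have "\<dots> \<le> rv_norm S (\<lambda>x. d x - g x) + rv_norm S (\<lambda>x. avg g (shift 1 x))"
    by (intro rv_norm_add dg square_integrable_shift ag)
  also have "rv_norm S (\<lambda>x. avg g (shift 1 x)) = rv_norm S (avg g)"
    by (rule rv_norm_shift[OF square_integrable_measurable[OF ag]])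
  finally have "rv_norm S (\<lambda>x. d x - w x) \<le> \<delta>" using ag_le less by simp
  with w mean sums_bounded_mono[OF bd] show ?thesis by (intro that)
qed

text \<open>The first \<open>L\<close> martingale differences of \<open>G\<close> are replaced one
  by one; the rest, \<open>(avg ^^ L) G\<close> after a shift, is dropped, its constant being a tail
  of the convergent series.\<close>

lemma cylinder_approximation:
  assumes G: "G \<in> square_integrable S" and mean: "(\<integral>x. G x \<partial>S) = 0"
    and sm: "summable (\<lambda>l. rv_norm S (innov G l))" and "0 < \<delta>"
  obtains w where "w \<in> cylinder" "(\<integral>x. w x \<partial>S) = 0" "sums_bounded (\<lambda>x. G x - w x) \<delta>"
proof -
  have "\<exists>N. \<forall>n\<ge>N. norm (\<Sum>l. rv_norm S (innov G (l + n))) < \<delta> / 2"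
    using \<open>0 < \<delta>\<close> sm by (intro suminf_exist_split) auto
  then obtain L where "norm (\<Sum>l. rv_norm S (innov G (l + L))) < \<delta> / 2" by blast
  then have L: "(\<Sum>l. rv_norm S (innov G (L + l))) < \<delta> / 2"
    by (simp add: add.commute abs_less_iff)
  \<comment> \<open>The \<open>L\<close> replacements cost at most \<open>\<delta> / 2\<close>
    together; \<open>+ 1\<close> covers \<open>L = 0\<close>.\<close>
  define \<eta> where "\<eta> = \<delta> / (2 * (real L + 1))"
  have "0 < \<eta>" using \<open>0 < \<delta>\<close> by (simp add: \<eta>_def)
  have "\<exists>w. w \<in> cylinder \<and> (\<integral>x. w x \<partial>S) = 0 \<and> sums_bounded (\<lambda>x. innov G l x - w x) \<eta>" for l
    using martingale_difference_cylinder[OF square_integrable_innov[OF G] avg_innov[OF G] \<open>0 < \<eta>\<close>]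
    by metis
  then obtain w where w: "\<And>l. w l \<in> cylinder" "\<And>l. (\<integral>x. w l x \<partial>S) = 0"
    "\<And>l. sums_bounded (\<lambda>x. innov G l x - w l x) \<eta>" by metis
  define W where "W x = (\<Sum>l<L. w l (shift l x))" for x
  have wL: "w l \<in> square_integrable S" for l by (rule cylinder_square_integrable[OF w(1)])
  have dw: "(\<lambda>x. innov G l x - w l x) \<in> square_integrable S" for l
    by (intro square_integrable_diff square_integrable_innov G wL)
  have "sums_bounded (\<lambda>x. (\<Sum>l<L. innov G l (shift l x) - w l (shift l x)) + (avg ^^ L) G (shift L x))
      ((\<Sum>l<L. \<eta>) + (\<Sum>l. rv_norm S (innov G (L + l))))"
    by (intro sums_bounded_add square_integrable_sum square_integrable_shift[OF dw]
        square_integrable_shift square_integrable_avg_pow G sums_bounded_sum finite_lessThan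
        sums_bounded_shift[OF dw] w(3) sums_bounded_shift sums_bounded_avg_pow mean sm)
  moreover have "(\<Sum>l<L. innov G l (shift l x) - w l (shift l x)) + (avg ^^ L) G (shift L x) = G x - W x" for x
    using avg_pow_telescope[of 0 G x L] by (simp add: W_def sum_subtractf)
  moreover have "(\<Sum>l<L. \<eta>) + (\<Sum>l. rv_norm S (innov G (L + l))) \<le> \<delta>"
  proof -
    have "real L * \<eta> \<le> \<delta> / 2" using \<open>0 < \<delta>\<close> by (simp add: \<eta>_def field_simps)
    with L show ?thesis by simp
  qed
  ultimately have "sums_bounded (\<lambda>x. G x - W x) \<delta>"
    using sums_bounded_mono by simp
  moreover have "W \<in> cylinder"
    unfolding W_def[abs_def] by (intro cylinder_sum cylinder_shift w)
  moreover have "(\<integral>x. W x \<partial>S) = 0"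
    unfolding W_def
    using P.square_integrable_integrable[OF square_integrable_shift[OF wL]]
      integral_shift[OF square_integrable_measurable[OF wL]] w(2)
    by (simp add: Bochner_Integration.integral_sum)
  ultimately show ?thesis by (intro that)
qed

end

section \<open>Characteristic functions of weighted sums\<close>

lemma iexp_dist: "cmod (iexp x - iexp y) \<le> \<bar>x - y\<bar>"
proof -
  have "iexp x - iexp y = iexp y * (iexp (x - y) - 1)"
    by (simp add: algebra_simps flip: exp_add)
  then have "cmod (iexp x - iexp y) = cmod (iexp (x - y) - 1)"
    by (simp add: norm_mult)
  also have "\<dots> \<le> \<bar>x - y\<bar>"
    using iexp_approx1[of "x - y" 0] by simp
  finally show ?thesis .
qed

lemma iexp_quadratic: "cmod (iexp x - 1 - \<i> * x) \<le> x\<^sup>2 / 2"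
  using iexp_approx1[of x 1] by (simp add: algebra_simps numeral_2_eq_2 power2_eq_square)

text \<open>The derivative is at most 1 in modulus because \<open>\<bar>z\<bar> \<le> 1 + z\<^sup>2
  / 2 \<le> exp (z\<^sup>2 / 2)\<close>. Used with \<open>x\<close> and \<open>y\<close> equal to
  \<open>t\<close> times a standard deviation.\<close>

lemma gaussian_Lipschitz: "\<bar>exp (- x\<^sup>2 / 2) - exp (- y\<^sup>2 / 2)\<bar> \<le> \<bar>x - y :: real\<bar>"
proof -
  have "norm (exp (- x\<^sup>2 / 2) - exp (- y\<^sup>2 / 2)) \<le> 1 * norm (x - y)"
  proof (rule field_differentiable_bound[of UNIV])
    fix z :: real
    show "((\<lambda>z. exp (- z\<^sup>2 / 2)) has_field_derivative (- z * exp (- z\<^sup>2 / 2))) (at z within UNIV)"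
      by (auto intro!: derivative_eq_intros)
    have "\<bar>z\<bar> \<le> 1 + z\<^sup>2 / 2"
      using sum_squares_bound[of "\<bar>z\<bar>" 1] by simp
    also have "\<dots> \<le> exp (z\<^sup>2 / 2)" by (rule exp_ge_add_one_self)
    finally have "\<bar>z\<bar> * exp (- z\<^sup>2 / 2) \<le> exp (z\<^sup>2 / 2) * exp (- z\<^sup>2 / 2)"
      by (intro mult_right_mono) auto
    also have "\<dots> = 1" by (simp flip: exp_add)
    finally show "norm (- z * exp (- z\<^sup>2 / 2)) \<le> 1" by (simp add: abs_mult)
  qed auto
  then show ?thesis by simp
qed

text \<open>Multiplication by the integrating factor \<open>exp (v * s\<^sup>2 / 2)\<close> turns
  the approximate equation into a bound on a derivative. The mean value bound brings in
  \<open>exp (v * t\<^sup>2 / 2)\<close>, which cancels on dividing the factor out, so the result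
  does not depend on \<open>v\<close>.\<close>

lemma gaussian_ODE_estimate:
  fixes \<phi> D :: "real \<Rightarrow> complex" and v c :: real
  assumes deriv: "\<And>s. (\<phi> has_vector_derivative D s) (at s)"
    and ode: "\<And>s. cmod (D s + s * v * \<phi> s) \<le> c * s\<^sup>2"
    and "\<phi> 0 = 1" "0 \<le> v" "0 \<le> c"
  shows "cmod (\<phi> t - exp (- t\<^sup>2 * v / 2)) \<le> c * \<bar>t\<bar> ^ 3"
proof -
  define \<psi> where "\<psi> s = exp (v * s\<^sup>2 / 2) *\<^sub>R \<phi> s" for s
  define \<psi>' where "\<psi>' s = exp (v * s\<^sup>2 / 2) *\<^sub>R (D s + s * v * \<phi> s)" for s
  define X where "X = {- \<bar>t\<bar>..\<bar>t\<bar>}"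
  have "norm (\<psi> t - \<psi> 0) \<le> (c * t\<^sup>2 * exp (v * t\<^sup>2 / 2)) * norm (t - 0)"
  proof (rule differentiable_bound)
    show "convex X" by (simp add: X_def)
    show "t \<in> X" "0 \<in> X" by (auto simp: X_def)
    fix s assume s: "s \<in> X"
    have "(\<psi> has_vector_derivative \<psi>' s) (at s)"
      unfolding \<psi>_def \<psi>'_def
      by (auto intro!: derivative_eq_intros deriv simp: scaleR_conv_of_real algebra_simps)
    then show "(\<psi> has_derivative (\<lambda>h. h *\<^sub>R \<psi>' s)) (at s within X)"
      by (simp add: has_vector_derivative_def has_derivative_at_withinI)
    have s2: "s\<^sup>2 \<le> t\<^sup>2" using s by (auto simp: X_def abs_le_square_iff[symmetric])
    have "norm (\<psi>' s) = exp (v * s\<^sup>2 / 2) * cmod (D s + s * v * \<phi> s)"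
      by (simp add: \<psi>'_def)
    also have "\<dots> \<le> exp (v * t\<^sup>2 / 2) * (c * t\<^sup>2)"
      using s2 \<open>0 \<le> v\<close> \<open>0 \<le> c\<close>
      by (intro mult_mono order_trans[OF ode]) (auto intro!: mult_left_mono)
    finally show "onorm (\<lambda>h. h *\<^sub>R \<psi>' s) \<le> c * t\<^sup>2 * exp (v * t\<^sup>2 / 2)"
      by (intro onorm_le) (simp add: mult.commute mult_left_mono mult_right_mono)
  qed
  then have "norm (\<psi> t - 1) \<le> c * \<bar>t\<bar> ^ 3 * exp (v * t\<^sup>2 / 2)"
    using \<open>\<phi> 0 = 1\<close> by (simp add: \<psi>_def power2_eq_square power3_eq_cube algebra_simps abs_mult_self_eq)
  then have *: "exp (- t\<^sup>2 * v / 2) * norm (\<psi> t - 1) \<le> exp (- t\<^sup>2 * v / 2) * (c * \<bar>t\<bar> ^ 3 * exp (v * t\<^sup>2 / 2))"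
    by (intro mult_left_mono) auto
  have e: "exp (- t\<^sup>2 * v / 2) * exp (v * t\<^sup>2 / 2) = 1"
    by (simp add: mult.commute flip: exp_add)
  have "\<phi> t - exp (- t\<^sup>2 * v / 2) = exp (- t\<^sup>2 * v / 2) *\<^sub>R (\<psi> t - 1)"
    using e by (simp add: \<psi>_def scaleR_diff_right) (simp add: scaleR_conv_of_real)
  then have "cmod (\<phi> t - exp (- t\<^sup>2 * v / 2)) = exp (- t\<^sup>2 * v / 2) * norm (\<psi> t - 1)"
    by simp
  also have "\<dots> \<le> (c * \<bar>t\<bar> ^ 3) * (exp (- t\<^sup>2 * v / 2) * exp (v * t\<^sup>2 / 2))"
    using * by (simp only: mult_ac)
  finally show ?thesis unfolding e by simp
qed

text \<open>For bounded \<open>T\<close> the second-order Taylor remainder is at most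
  \<open>K\<^sup>2 * (t - s)\<^sup>2\<close> everywhere, so the difference quotient is controlled
  directly.\<close>

lemma (in prob_space) char_has_vector_derivative:
  assumes [measurable]: "T \<in> borel_measurable M" and K: "\<And>x. x \<in> space M \<Longrightarrow> \<bar>T x\<bar> \<le> K"
  shows "((\<lambda>t. CLINT x|M. iexp (t * T x)) has_vector_derivative
    (\<i> * (CLINT x|M. T x * iexp (s * T x)))) (at s)"
  unfolding has_vector_derivative_def
proof (rule has_derivativeI_sandwich[of 1])
  show "bounded_linear (\<lambda>h. h *\<^sub>R (\<i> * (CLINT x|M. T x * iexp (s * T x))))"
    by (rule bounded_linear_scaleR_left)
  have i1: "integrable M (\<lambda>x. iexp (t * T x))" for t
    by (rule integrable_const_bound[of _ 1]) auto
  have i2: "integrable M (\<lambda>x. T x * iexp (t * T x))" for t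
    by (rule integrable_const_bound[of _ K]) (auto simp: norm_mult intro!: AE_I2 K)
  show "norm ((CLINT x|M. iexp (t * T x)) - (CLINT x|M. iexp (s * T x))
      - (t - s) *\<^sub>R (\<i> * (CLINT x|M. T x * iexp (s * T x)))) / norm (t - s) \<le> K\<^sup>2 * \<bar>t - s\<bar>"
    if "t \<noteq> s" for t
  proof -
    have eq: "(CLINT x|M. iexp (t * T x)) - (CLINT x|M. iexp (s * T x))
        - (t - s) *\<^sub>R (\<i> * (CLINT x|M. T x * iexp (s * T x)))
      = (CLINT x|M. iexp (t * T x) - iexp (s * T x) - (t - s) * \<i> * (T x * iexp (s * T x)))"
      using i1 i2 by (simp add: scaleR_conv_of_real mult.assoc)
    have "norm ((CLINT x|M. iexp (t * T x)) - (CLINT x|M. iexp (s * T x))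
        - (t - s) *\<^sub>R (\<i> * (CLINT x|M. T x * iexp (s * T x))))
      \<le> (LINT x|M. norm (iexp (t * T x) - iexp (s * T x) - (t - s) * \<i> * (T x * iexp (s * T x))))"
      unfolding eq by (rule integral_norm_bound)
    also have "\<dots> \<le> (LINT x|M. K\<^sup>2 * (t - s)\<^sup>2)"
    proof (intro integral_mono)
      show "integrable M (\<lambda>x. norm (iexp (t * T x) - iexp (s * T x) - (t - s) * \<i> * (T x * iexp (s * T x))))"
        using i1 i2 by (intro integrable_norm Bochner_Integration.integrable_diff integrable_mult_right)
      fix x assume x: "x \<in> space M"
      have "iexp (t * T x) - iexp (s * T x) - (t - s) * \<i> * (T x * iexp (s * T x))
          = iexp (s * T x) * (iexp ((t - s) * T x) - 1 - \<i> * ((t - s) * T x))"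
        by (simp add: algebra_simps flip: exp_add)
      then have "norm (iexp (t * T x) - iexp (s * T x) - (t - s) * \<i> * (T x * iexp (s * T x)))
          = norm (iexp ((t - s) * T x) - 1 - \<i> * ((t - s) * T x))"
        by (simp add: norm_mult)
      also have "\<dots> \<le> ((t - s) * T x)\<^sup>2 / 2" using iexp_quadratic[of "(t - s) * T x"] by simp
      also have "\<dots> \<le> ((t - s) * T x)\<^sup>2" by simp
      also have "\<dots> = \<bar>T x\<bar>\<^sup>2 * (t - s)\<^sup>2" by (simp add: power_mult_distrib mult.commute)
      also have "\<dots> \<le> K\<^sup>2 * (t - s)\<^sup>2"
        using K[OF x] by (intro mult_right_mono power_mono) auto
      finally show "norm (iexp (t * T x) - iexp (s * T x) - (t - s) * \<i> * (T x * iexp (s * T x))) \<le> K\<^sup>2 * (t - s)\<^sup>2" .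
    qed simp
    also have "\<dots> = K\<^sup>2 * \<bar>t - s\<bar> * norm (t - s)"
      by (simp add: prob_space power2_eq_square abs_mult_self_eq mult.assoc flip: abs_mult)
    finally show ?thesis using that by (simp add: divide_le_eq)
  qed
  have "((\<lambda>t. K\<^sup>2 * \<bar>t - s\<bar>) \<longlongrightarrow> K\<^sup>2 * \<bar>s - s\<bar>) (at s)"
    by (intro tendsto_intros)
  then show "((\<lambda>t. K\<^sup>2 * \<bar>t - s\<bar>) \<longlongrightarrow> 0) (at s)" by simp
qed simp_all

context bernoulli_shift
begin

lemma indep_vars_components: "P.indep_vars (\<lambda>_. M) (\<lambda>i x. x i) UNIV"
proof -
  have "distr S M (\<lambda>x. x i) = M" for i
    using PiM_component[of i] by simp
  then show ?thesis
    by (subst P.indep_vars_iff_distr_eq_PiM) (auto simp: restrict_UNIV distr_id2)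
qed

lemma indep_var_depends_on:
  fixes f g :: "_ \<Rightarrow> 'c::topological_space"
  assumes f: "depends_on I f" "f \<in> borel_measurable S" and g: "depends_on J g" "g \<in> borel_measurable S"
    and IJ: "I \<inter> J = {}"
  shows "P.indep_var borel f borel g"
proof -
  \<comment> \<open>Completing a partial path by \<open>undefined\<close> lets a function that
    depends on \<open>K\<close> alone factor measurably through restriction to
    \<open>K\<close>.\<close>
  have ext: "(\<lambda>z i. if i \<in> K then z i else undefined) \<in> measurable (PiM K (\<lambda>_. M)) S" for K :: "nat set"
  proof (rule measurable_PiM_single')
    show "(\<lambda>z. if i \<in> K then z i else undefined) \<in> measurable (PiM K (\<lambda>_. M)) M" for i
      by (cases "i \<in> K") (auto simp: space_M intro: measurable_component_singleton)
  qed (simp add: space_M)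
  have "P.indep_var (PiM I (\<lambda>_. M)) (\<lambda>x. restrict x I) (PiM J (\<lambda>_. M)) (\<lambda>x. restrict x J)"
    using P.indep_var_restrict[OF indep_vars_components IJ] by simp
  from P.indep_var_compose[OF this measurable_compose[OF ext f(2)] measurable_compose[OF ext g(2)]]
  have "P.indep_var borel ((\<lambda>z. f (\<lambda>i. if i \<in> I then z i else undefined)) \<circ> (\<lambda>x. restrict x I))
    borel ((\<lambda>z. g (\<lambda>i. if i \<in> J then z i else undefined)) \<circ> (\<lambda>x. restrict x J))" .
  moreover have "(\<lambda>z. f (\<lambda>i. if i \<in> I then z i else undefined)) \<circ> (\<lambda>x. restrict x I) = f"
    by (auto simp: fun_eq_iff intro!: depends_onD[OF f(1)])
  moreover have "(\<lambda>z. g (\<lambda>i. if i \<in> J then z i else undefined)) \<circ> (\<lambda>x. restrict x J) = g"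
    by (auto simp: fun_eq_iff intro!: depends_onD[OF g(1)])
  ultimately show ?thesis by simp
qed

lemma integral_mult_depends_on:
  fixes f g :: "_ \<Rightarrow> 'c::{real_normed_field, banach, second_countable_topology}"
  assumes "depends_on I f" "integrable S f" "depends_on J g" "integrable S g" "I \<inter> J = {}"
  shows "(\<integral>x. f x * g x \<partial>S) = (\<integral>x. f x \<partial>S) * (\<integral>x. g x \<partial>S)"
  using assms by (intro P.indep_var_lebesgue_integral indep_var_depends_on) auto

text \<open>The condition says that \<open>j\<close> and \<open>k\<close> are less than
  \<open>r\<close> apart, written without truncated subtraction.\<close>

lemma near_card: "card {j. j < n \<and> j < k + r \<and> k < j + r} \<le> 2 * r" for k n r :: nat
proof -
  have "{j. j < n \<and> j < k + r \<and> k < j + r} \<subseteq> {k - r..<k + r}" by auto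
  from card_mono[OF _ this] show ?thesis by simp
qed

section \<open>Tikhomirov's estimate for a bounded function of finitely many coordinates\<close>

context
  fixes w :: "(nat \<Rightarrow> 'b) \<Rightarrow> real" and q :: nat and B :: real
  assumes w: "w \<in> borel_measurable S" "depends_on {..<q} w" "\<And>x. \<bar>w x\<bar> \<le> B" "(\<integral>x. w x \<partial>S) = 0"
begin

lemma w_bound_nonneg: "0 \<le> B"
  by (rule order_trans[OF abs_ge_zero w(3)])

definition psum :: "(nat \<Rightarrow> real) \<Rightarrow> nat set \<Rightarrow> (nat \<Rightarrow> 'b) \<Rightarrow> real" where
  "psum b K x = (\<Sum>j\<in>K. b j * w (shift j x))"

lemma psum_measurable [measurable]: "psum b K \<in> borel_measurable S"
proof -
  note [measurable] = w(1)
  show ?thesis unfolding psum_def[abs_def] by measurable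
qed

lemma w_shift_measurable [measurable]: "(\<lambda>x. w (shift k x)) \<in> borel_measurable S"
proof -
  note [measurable] = w(1)
  show ?thesis by measurable
qed

lemma psum_bound:
  assumes "\<And>j. j \<in> K \<Longrightarrow> \<bar>b j\<bar> \<le> \<beta>" "0 \<le> \<beta>" "card K \<le> N"
  shows "\<bar>psum b K x\<bar> \<le> N * (\<beta> * B)"
proof -
  have "\<bar>psum b K x\<bar> \<le> (\<Sum>j\<in>K. \<beta> * B)"
    unfolding psum_def
    by (rule order_trans[OF sum_abs sum_mono]) (auto simp: abs_mult intro!: mult_mono assms w(3))
  also have "\<dots> \<le> N * (\<beta> * B)"
    using assms w_bound_nonneg by (auto intro!: mult_right_mono)
  finally show ?thesis .
qed

lemma depends_on_psum:
  assumes "\<And>j. j \<in> K \<Longrightarrow> {j..<j + q} \<subseteq> I"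
  shows "depends_on I (psum b K)"
  unfolding psum_def[abs_def]
proof (rule depends_on_sum)
  fix j assume "j \<in> K"
  from depends_on_mono[OF depends_on_shift[OF w(2)] assms[OF this]]
  show "depends_on I (\<lambda>x. b j * w (shift j x))" by (rule depends_on_comp)
qed

lemma mean_w_shift: "(\<integral>x. w (shift k x) \<partial>S) = 0"
  by (simp add: integral_shift[OF w(1)] w(4))

lemma integrable_iexp_mult:
  fixes f h :: "_ \<Rightarrow> real" and c :: real
  assumes [measurable]: "f \<in> borel_measurable S" "h \<in> borel_measurable S" and c: "\<And>x. \<bar>f x\<bar> \<le> c"
  shows "integrable S (\<lambda>x. f x * iexp (t * h x))"
  by (rule P.integrable_const_bound[of _ c]) (auto simp: norm_mult c)

text \<open>With \<open>Y\<close> the summand at \<open>k\<close>, \<open>T\<close> splits as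
  \<open>T1 + U\<close>, where \<open>U\<close> collects the terms less than \<open>q\<close> away.
  \<open>Y\<close> is centred and independent of \<open>T1\<close>, so a first-order expansion in
  \<open>U\<close> leaves \<open>\<i> * t\<close> times the mean of
  \<open>Y * U * iexp (t * T1)\<close>. Widening the window to \<open>2 * q\<close> replaces
  \<open>T1\<close> by \<open>T2\<close>, which is independent of \<open>Y * U\<close>, and the mean
  factors; finally \<open>T2\<close> is changed back to \<open>T\<close>. The three steps cost 1, 3
  and 2 times \<open>B * s\<^sup>2 * t\<^sup>2\<close>, and \<open>s = 2 * q * (\<beta> * B)\<close>
  turns the total 6 into 24.\<close>

lemma char_local_estimate:
  assumes b: "\<And>j. j < n \<Longrightarrow> \<bar>b j\<bar> \<le> \<beta>" "0 \<le> \<beta>"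
  shows "cmod ((CLINT x|S. w (shift k x) * iexp (t * psum b {..<n} x))
      - \<i> * t * (\<integral>x. w (shift k x) * psum b {..<n} x \<partial>S) * (CLINT x|S. iexp (t * psum b {..<n} x)))
    \<le> 24 * q\<^sup>2 * B ^ 3 * \<beta>\<^sup>2 * t\<^sup>2"
proof -
  define near where "near r = {j. j < n \<and> j < k + r \<and> k < j + r}" for r
  define far where "far r = {..<n} - near r" for r
  define s where "s = 2 * q * (\<beta> * B)"
  define Y where "Y x = w (shift k x)" for x
  define T where "T = psum b {..<n}"
  define T1 where "T1 = psum b (far q)"
  define T2 where "T2 = psum b (far (2 * q))"
  define U where "U = psum b (near q)"
  note [measurable] = w(1)
  have [measurable]: "Y \<in> borel_measurable S" "T \<in> borel_measurable S" "T1 \<in> borel_measurable S"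
    "T2 \<in> borel_measurable S" "U \<in> borel_measurable S"
    unfolding Y_def[abs_def] T_def T1_def T2_def U_def by measurable
  have s: "0 \<le> s" using b(2) w_bound_nonneg by (simp add: s_def)
  have near: "near r \<subseteq> {..<n}" "finite (near r)" for r by (auto simp: near_def)
  have split: "T x = psum b (far r) x + psum b (near r) x" for r x
    unfolding T_def psum_def far_def by (rule sum.subset_diff[OF near(1)]) simp
  have near_le: "\<bar>psum b (near r) x\<bar> \<le> (2 * r) * (\<beta> * B)" for r x
    by (rule order_trans[OF psum_bound[OF b(1) b(2) near_card[of n k r, folded near_def]]])
       (use near in auto)
  have Y_le: "\<bar>Y x\<bar> \<le> B" for x by (simp add: Y_def w(3))
  have U_le: "\<bar>U x\<bar> \<le> s" for x using near_le[of q x] by (simp add: U_def s_def)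
  \<comment> \<open>The terms near within \<open>2 * q\<close> sum to at most \<open>2 * s\<close>,
    those within \<open>q\<close> to at most \<open>s\<close>; \<open>T1 - T2\<close> is the
    difference of the two sums.\<close>
  have T12: "\<bar>T1 x - T2 x\<bar> \<le> 3 * s" and TT2: "\<bar>T x - T2 x\<bar> \<le> 2 * s" for x
    using near_le[of q x] near_le[of "2 * q" x] split[of x q] split[of x "2 * q"]
    by (auto simp: T1_def T2_def s_def algebra_simps)
  have T_eq: "T x = T1 x + U x" for x using split[of x q] by (simp add: T1_def U_def)
  have dY: "depends_on {k..<k + q} Y" unfolding Y_def[abs_def] by (rule depends_on_shift[OF w(2)])
  have dT1: "depends_on (- {k..<k + q}) T1"
    unfolding T1_def by (rule depends_on_psum) (auto simp: far_def near_def)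
  \<comment> \<open>Summands near within \<open>q\<close> reach at most \<open>q\<close> coordinates
    below \<open>k\<close> and \<open>2 * q\<close> above it; summands at distance at least
    \<open>2 * q\<close> avoid this block.\<close>
  have dT2: "depends_on (- {k - q..<k + 2 * q}) T2"
    unfolding T2_def by (rule depends_on_psum) (auto simp: far_def near_def)
  have dU: "depends_on {k - q..<k + 2 * q} U"
    unfolding U_def by (rule depends_on_psum) (auto simp: near_def)
  have dYU: "depends_on {k - q..<k + 2 * q} (\<lambda>x. Y x * U x)"
    by (rule depends_on_comp2[OF depends_on_mono[OF dY] dU]) auto
  have YU_le: "\<bar>Y x * U x\<bar> \<le> B * s" for x
    unfolding abs_mult by (intro mult_mono Y_le U_le w_bound_nonneg) auto
  note int = integrable_iexp_mult
  have mean0: "(CLINT x|S. Y x * iexp (t * T1 x)) = 0"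
  proof -
    have "(CLINT x|S. Y x * iexp (t * T1 x)) = (CLINT x|S. complex_of_real (Y x)) * (CLINT x|S. iexp (t * T1 x))"
    proof (rule integral_mult_depends_on)
      show "depends_on {k..<k + q} (\<lambda>x. complex_of_real (Y x))" by (rule depends_on_comp[OF dY])
      show "depends_on (- {k..<k + q}) (\<lambda>x. iexp (t * T1 x))" by (rule depends_on_comp[OF dT1])
      show "integrable S (\<lambda>x. complex_of_real (Y x))"
        by (rule P.integrable_const_bound[of _ B]) (auto simp: Y_le)
      show "integrable S (\<lambda>x. iexp (t * T1 x))"
        by (rule P.integrable_const_bound[of _ 1]) auto
    qed auto
    then show ?thesis by (simp add: Y_def mean_w_shift)
  qed
  have fact: "(CLINT x|S. (Y x * U x) * iexp (t * T2 x)) = (\<integral>x. Y x * U x \<partial>S) * (CLINT x|S. iexp (t * T2 x))"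
  proof -
    have "(CLINT x|S. complex_of_real (Y x * U x) * iexp (t * T2 x))
        = (CLINT x|S. complex_of_real (Y x * U x)) * (CLINT x|S. iexp (t * T2 x))"
    proof (rule integral_mult_depends_on)
      show "depends_on {k - q..<k + 2 * q} (\<lambda>x. complex_of_real (Y x * U x))" by (rule depends_on_comp[OF dYU])
      show "depends_on (- {k - q..<k + 2 * q}) (\<lambda>x. iexp (t * T2 x))" by (rule depends_on_comp[OF dT2])
      show "integrable S (\<lambda>x. complex_of_real (Y x * U x))"
        by (rule P.integrable_const_bound[of _ "B * s"]) (use YU_le in \<open>auto simp flip: of_real_mult\<close>)
      show "integrable S (\<lambda>x. iexp (t * T2 x))"
        by (rule P.integrable_const_bound[of _ 1]) auto
    qed auto
    then show ?thesis unfolding integral_complex_of_real by simp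
  qed
  \<comment> \<open>\<open>U\<close> may be replaced by the whole sum in the covariance since
    \<open>Y\<close> and \<open>T1\<close> are uncorrelated; weighted and summed over
    \<open>k\<close>, these covariances give the variance of \<open>T\<close>.\<close>
  have YT: "(\<integral>x. Y x * T x \<partial>S) = (\<integral>x. Y x * U x \<partial>S)"
  proof -
    have T1_le: "\<bar>T1 x\<bar> \<le> n * (\<beta> * B)" for x
      unfolding T1_def
    proof (rule psum_bound)
      show "card (far q) \<le> n"
        using card_mono[of "{..<n}" "far q"] by (auto simp: far_def)
    qed (use b in \<open>auto simp: far_def\<close>)
    have iY: "integrable S Y" by (rule P.integrable_const_bound[of _ B]) (auto simp: Y_le)
    have iT1: "integrable S T1" by (rule P.integrable_const_bound[of _ "n * (\<beta> * B)"]) (auto simp: T1_le)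
    have iYU: "integrable S (\<lambda>x. Y x * U x)" by (rule P.integrable_const_bound[of _ "B * s"]) (use YU_le in auto)
    have "\<bar>Y x * T1 x\<bar> \<le> B * (n * (\<beta> * B))" for x
      unfolding abs_mult by (intro mult_mono Y_le T1_le w_bound_nonneg) auto
    then have iYT: "integrable S (\<lambda>x. Y x * T1 x)"
      by (intro P.integrable_const_bound[of _ "B * (n * (\<beta> * B))"]) auto
    have "(\<integral>x. Y x * T1 x \<partial>S) = (\<integral>x. Y x \<partial>S) * (\<integral>x. T1 x \<partial>S)"
      by (rule integral_mult_depends_on[OF dY iY dT1 iT1]) auto
    also have "\<dots> = 0" by (simp add: Y_def mean_w_shift)
    finally show ?thesis using iYT iYU by (simp add: T_eq distrib_left)
  qed
  define \<phi> where "\<phi> = (CLINT x|S. iexp (t * T x))"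
  define a where "a = (\<integral>x. Y x * U x \<partial>S)"
  have a_le: "\<bar>a\<bar> \<le> B * s"
  proof -
    have "\<bar>a\<bar> \<le> (\<integral>x. \<bar>Y x * U x\<bar> \<partial>S)" unfolding a_def by (rule integral_abs_bound)
    also have "\<dots> \<le> (\<integral>x. B * s \<partial>S)"
      by (intro integral_mono P.integrable_const_bound[of _ "B * s"])
         (use YU_le mult_nonneg_nonneg[OF w_bound_nonneg s] in auto)
    finally show ?thesis by (simp add: P.prob_space)
  qed
  have iYT: "integrable S (\<lambda>x. Y x * iexp (t * T x))" and iYT1: "integrable S (\<lambda>x. Y x * iexp (t * T1 x))"
    by (rule int; (rule Y_le | measurable))+
  have iYU1: "integrable S (\<lambda>x. (Y x * U x) * iexp (t * T1 x))" and iYU2: "integrable S (\<lambda>x. (Y x * U x) * iexp (t * T2 x))"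
    using int[of "\<lambda>x. Y x * U x" T1 "B * s" t] int[of "\<lambda>x. Y x * U x" T2 "B * s" t] YU_le by auto
  have step1: "cmod ((CLINT x|S. Y x * iexp (t * T x)) - \<i> * t * (CLINT x|S. (Y x * U x) * iexp (t * T1 x)))
      \<le> B * s\<^sup>2 * t\<^sup>2"
  proof -
    have "(CLINT x|S. Y x * iexp (t * T x)) - \<i> * t * (CLINT x|S. (Y x * U x) * iexp (t * T1 x))
       = (CLINT x|S. Y x * iexp (t * T x)) - (CLINT x|S. Y x * iexp (t * T1 x))
          - (CLINT x|S. \<i> * t * ((Y x * U x) * iexp (t * T1 x)))"
      using mean0 by simp
    also have "\<dots> = (CLINT x|S. Y x * iexp (t * T x) - Y x * iexp (t * T1 x)
          - \<i> * t * ((Y x * U x) * iexp (t * T1 x)))"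
      using iYT iYT1 iYU1 by (simp add: Bochner_Integration.integral_diff del: integral_mult_right_zero integral_mult_right)
    finally have eq: "(CLINT x|S. Y x * iexp (t * T x)) - \<i> * t * (CLINT x|S. (Y x * U x) * iexp (t * T1 x))
       = (CLINT x|S. Y x * iexp (t * T x) - Y x * iexp (t * T1 x) - \<i> * t * ((Y x * U x) * iexp (t * T1 x)))" .
    have pw: "cmod (Y x * iexp (t * T x) - Y x * iexp (t * T1 x) - \<i> * t * ((Y x * U x) * iexp (t * T1 x)))
        \<le> B * s\<^sup>2 * t\<^sup>2" for x
    proof -
      have "Y x * iexp (t * T x) - Y x * iexp (t * T1 x) - \<i> * t * ((Y x * U x) * iexp (t * T1 x))
          = Y x * iexp (t * T1 x) * (iexp (t * U x) - 1 - \<i> * (t * U x))"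
        by (simp add: T_eq algebra_simps exp_add)
      then have "cmod (Y x * iexp (t * T x) - Y x * iexp (t * T1 x) - \<i> * t * ((Y x * U x) * iexp (t * T1 x)))
          = \<bar>Y x\<bar> * cmod (iexp (t * U x) - 1 - \<i> * (t * U x))"
        by (simp add: norm_mult)
      also have "\<dots> \<le> B * ((t * U x)\<^sup>2 / 2)"
        using iexp_quadratic[of "t * U x"] by (intro mult_mono Y_le w_bound_nonneg) auto
      also have "(t * U x)\<^sup>2 / 2 \<le> \<bar>U x\<bar>\<^sup>2 * t\<^sup>2" by (simp add: power_mult_distrib)
      also have "\<bar>U x\<bar>\<^sup>2 * t\<^sup>2 \<le> s\<^sup>2 * t\<^sup>2"
        by (intro mult_right_mono power_mono U_le) auto
      finally show ?thesis using w_bound_nonneg by (simp add: mult_left_mono mult.assoc)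
    qed
    show ?thesis unfolding eq
      by (rule order_trans[OF integral_norm_bound])
         (intro P.integral_le_const integrable_norm Bochner_Integration.integrable_diff
           integrable_mult_right iYT iYT1 iYU1 AE_I2 pw)
  qed
  have step2: "cmod ((CLINT x|S. (Y x * U x) * iexp (t * T1 x)) - (CLINT x|S. (Y x * U x) * iexp (t * T2 x)))
      \<le> 3 * B * s\<^sup>2 * \<bar>t\<bar>"
  proof -
    have eq: "(CLINT x|S. (Y x * U x) * iexp (t * T1 x)) - (CLINT x|S. (Y x * U x) * iexp (t * T2 x))
      = (CLINT x|S. (Y x * U x) * iexp (t * T1 x) - (Y x * U x) * iexp (t * T2 x))"
      using iYU1 iYU2 by simp
    have pw: "cmod ((Y x * U x) * iexp (t * T1 x) - (Y x * U x) * iexp (t * T2 x)) \<le> 3 * B * s\<^sup>2 * \<bar>t\<bar>" for x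
    proof -
      have "cmod ((Y x * U x) * iexp (t * T1 x) - (Y x * U x) * iexp (t * T2 x))
          = \<bar>Y x * U x\<bar> * cmod (iexp (t * T1 x) - iexp (t * T2 x))"
        by (simp add: norm_mult abs_mult flip: right_diff_distrib)
      also have "\<dots> \<le> (B * s) * (\<bar>t\<bar> * (3 * s))"
      proof (intro mult_mono YU_le)
        have "cmod (iexp (t * T1 x) - iexp (t * T2 x)) \<le> \<bar>t\<bar> * \<bar>T1 x - T2 x\<bar>"
          using iexp_dist[of "t * T1 x" "t * T2 x"] by (simp add: abs_mult flip: right_diff_distrib)
        also have "\<dots> \<le> \<bar>t\<bar> * (3 * s)" by (intro mult_left_mono T12) auto
        finally show "cmod (iexp (t * T1 x) - iexp (t * T2 x)) \<le> \<bar>t\<bar> * (3 * s)" .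
      qed (use s w_bound_nonneg in auto)
      finally show ?thesis by (simp add: power2_eq_square mult_ac)
    qed
    show ?thesis unfolding eq
      by (rule order_trans[OF integral_norm_bound])
         (intro P.integral_le_const integrable_norm Bochner_Integration.integrable_diff iYU1 iYU2 AE_I2 pw)
  qed
  have step3: "cmod ((CLINT x|S. iexp (t * T2 x)) - \<phi>) \<le> 2 * s * \<bar>t\<bar>"
  proof -
    have i: "integrable S (\<lambda>x. iexp (t * h x))" if [measurable]: "h \<in> borel_measurable S" for h
      by (rule P.integrable_const_bound[of _ 1]) auto
    have eq: "(CLINT x|S. iexp (t * T2 x)) - \<phi> = (CLINT x|S. iexp (t * T2 x) - iexp (t * T x))"
      unfolding \<phi>_def by (rule Bochner_Integration.integral_diff[symmetric]) (intro i, measurable)+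
    have pw: "cmod (iexp (t * T2 x) - iexp (t * T x)) \<le> 2 * s * \<bar>t\<bar>" for x
    proof -
      have "cmod (iexp (t * T2 x) - iexp (t * T x)) \<le> \<bar>t\<bar> * \<bar>T x - T2 x\<bar>"
        using iexp_dist[of "t * T2 x" "t * T x"] by (simp add: abs_mult abs_minus_commute flip: right_diff_distrib)
      also have "\<dots> \<le> \<bar>t\<bar> * (2 * s)" by (intro mult_left_mono TT2) auto
      finally show ?thesis by (simp add: mult_ac)
    qed
    have "integrable S (\<lambda>x. iexp (t * T2 x) - iexp (t * T x))"
      by (intro Bochner_Integration.integrable_diff i) measurable
    then show ?thesis unfolding eq
      by (intro order_trans[OF integral_norm_bound] P.integral_le_const integrable_norm AE_I2 pw)
  qed
  let ?A = "CLINT x|S. Y x * iexp (t * T x)"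
  let ?B1 = "CLINT x|S. (Y x * U x) * iexp (t * T1 x)"
  let ?B2 = "CLINT x|S. (Y x * U x) * iexp (t * T2 x)"
  have eq: "?A - \<i> * t * a * \<phi> = (?A - \<i> * t * ?B1) + \<i> * t * (?B1 - ?B2)
      + \<i> * t * a * ((CLINT x|S. iexp (t * T2 x)) - \<phi>)"
    unfolding fact a_def[symmetric] by (simp add: algebra_simps)
  have "cmod (?A - \<i> * t * a * \<phi>) \<le> cmod (?A - \<i> * t * ?B1) + cmod (\<i> * t * (?B1 - ?B2))
      + cmod (\<i> * t * a * ((CLINT x|S. iexp (t * T2 x)) - \<phi>))"
    unfolding eq by (intro order_trans[OF norm_triangle_ineq] add_right_mono norm_triangle_ineq)
  also have "\<dots> \<le> B * s\<^sup>2 * t\<^sup>2 + \<bar>t\<bar> * (3 * B * s\<^sup>2 * \<bar>t\<bar>) + \<bar>t\<bar> * (B * s) * (2 * s * \<bar>t\<bar>)"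
    unfolding norm_mult norm_ii norm_of_real mult_1_left
    using s w_bound_nonneg
    by (intro add_mono mult_mono step1 step2 step3 a_le order_refl mult_nonneg_nonneg norm_ge_zero abs_ge_zero) auto
  also have "\<dots> = 6 * (B * s\<^sup>2 * t\<^sup>2)"
    by (simp add: power2_eq_square algebra_simps)
  finally have "cmod (?A - \<i> * t * a * \<phi>) \<le> 6 * (B * s\<^sup>2 * t\<^sup>2)" .
  then show ?thesis
    unfolding \<phi>_def a_def YT[symmetric] unfolding Y_def T_def
    by (simp add: s_def power2_eq_square power3_eq_cube mult_ac)
qed

text \<open>Multiplying the local estimate at \<open>k\<close> by \<open>\<i> * b k\<close> and
  summing over \<open>k\<close> gives the approximate equation for the characteristic function;
  \<open>n\<close> weights of size \<open>\<beta>\<close> against local errors of order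
  \<open>\<beta>\<^sup>2\<close> produce \<open>n * \<beta> ^ 3\<close>.\<close>

lemma char_psum_estimate:
  assumes b: "\<And>j. j < n \<Longrightarrow> \<bar>b j\<bar> \<le> \<beta>" "0 \<le> \<beta>"
  shows "cmod ((CLINT x|S. iexp (t * psum b {..<n} x)) - exp (- t\<^sup>2 * (\<integral>x. (psum b {..<n} x)\<^sup>2 \<partial>S) / 2))
    \<le> (24 * q\<^sup>2 * B ^ 3) * (n * \<beta> ^ 3) * \<bar>t\<bar> ^ 3"
proof -
  define T where "T = psum b {..<n}"
  define v where "v = (\<integral>x. (T x)\<^sup>2 \<partial>S)"
  define Y where "Y k x = w (shift k x)" for k x
  define \<phi> where "\<phi> s = (CLINT x|S. iexp (s * T x))" for s
  define c where "c = (24 * q\<^sup>2 * B ^ 3) * (n * \<beta> ^ 3)"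
  have [measurable]: "T \<in> borel_measurable S" "Y k \<in> borel_measurable S" for k
    unfolding T_def Y_def[abs_def] by measurable
  have T_le: "\<bar>T x\<bar> \<le> n * (\<beta> * B)" for x
    unfolding T_def by (rule psum_bound) (use b in auto)
  have Y_le: "\<bar>Y k x\<bar> \<le> B" for k x by (simp add: Y_def w(3))
  have T_eq: "T x = (\<Sum>k<n. b k * Y k x)" for x by (simp add: T_def psum_def Y_def)
  have c: "0 \<le> c" using w_bound_nonneg b(2) by (simp add: c_def)
  have iYT: "integrable S (\<lambda>x. Y k x * T x)" for k
    by (intro square_integrable_mult P.square_integrable_bounded[OF _ Y_le] P.square_integrable_bounded[OF _ T_le]) auto
  have v_eq: "v = (\<Sum>k<n. b k * (\<integral>x. Y k x * T x \<partial>S))"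
  proof -
    have "v = (\<integral>x. (\<Sum>k<n. b k * (Y k x * T x)) \<partial>S)"
      unfolding v_def power2_eq_square by (subst (1) T_eq) (simp add: sum_distrib_right mult.assoc)
    then show ?thesis using iYT by simp
  qed
  have "cmod (\<phi> t - exp (- t\<^sup>2 * v / 2)) \<le> c * \<bar>t\<bar> ^ 3"
  proof (rule gaussian_ODE_estimate)
    fix s :: real
    define D where "D = \<i> * (CLINT x|S. T x * iexp (s * T x))"
    show "(\<phi> has_vector_derivative (\<i> * (CLINT x|S. T x * iexp (s * T x)))) (at s)"
      unfolding \<phi>_def[abs_def]
      by (rule P.char_has_vector_derivative[where K = "n * (\<beta> * B)"]) (auto simp: T_le)
    have iY: "integrable S (\<lambda>x. Y k x * iexp (s * T x))" for k
      by (rule integrable_iexp_mult[OF _ _ Y_le]) auto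
    have "(CLINT x|S. T x * iexp (s * T x)) = (CLINT x|S. (\<Sum>k<n. b k * (Y k x * iexp (s * T x))))"
      by (subst (1) T_eq) (simp add: sum_distrib_right mult.assoc)
    also have "\<dots> = (\<Sum>k<n. b k * (CLINT x|S. Y k x * iexp (s * T x)))"
      using iY by simp
    finally have D: "D = \<i> * (\<Sum>k<n. b k * (CLINT x|S. Y k x * iexp (s * T x)))"
      by (simp add: D_def)
    have eq: "D + s * v * \<phi> s = \<i> * (\<Sum>k<n. b k * ((CLINT x|S. Y k x * iexp (s * T x))
        - \<i> * s * (\<integral>x. Y k x * T x \<partial>S) * \<phi> s))"
      unfolding D v_eq
      by (simp add: sum_distrib_left sum_distrib_right algebra_simps flip: sum.distrib)
    have "cmod (D + s * v * \<phi> s) \<le> (\<Sum>k<n. \<beta> * (24 * q\<^sup>2 * B ^ 3 * \<beta>\<^sup>2 * s\<^sup>2))"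
      unfolding eq norm_mult norm_ii mult_1_left
    proof (rule order_trans[OF norm_sum sum_mono], unfold norm_mult norm_of_real)
      fix k assume "k \<in> {..<n}"
      then show "\<bar>b k\<bar> * cmod ((CLINT x|S. Y k x * iexp (s * T x)) - \<i> * s * (\<integral>x. Y k x * T x \<partial>S) * \<phi> s)
          \<le> \<beta> * (24 * q\<^sup>2 * B ^ 3 * \<beta>\<^sup>2 * s\<^sup>2)"
        using char_local_estimate[OF b, where k = k and t = s] b w_bound_nonneg unfolding Y_def T_def \<phi>_def
        by (intro mult_mono) auto
    qed
    also have "\<dots> = c * s\<^sup>2"
      by (simp add: c_def power2_eq_square power3_eq_cube mult_ac)
    finally show "cmod ((\<i> * (CLINT x|S. T x * iexp (s * T x))) + s * v * \<phi> s) \<le> c * s\<^sup>2"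
      by (simp add: D_def)
  next
    show "\<phi> 0 = 1" by (simp add: \<phi>_def P.prob_space)
    show "0 \<le> v" by (simp add: v_def)
  qed (rule c)
  then show ?thesis by (simp add: \<phi>_def v_def T_def c_def)
qed

end

text \<open>\<open>C\<close> depends on \<open>w\<close> alone, so it is still available when
  \<open>w\<close> is fixed and \<open>n\<close> and the weights vary.\<close>

lemma char_cylinder_estimate:
  assumes "w \<in> cylinder" "(\<integral>x. w x \<partial>S) = 0"
  shows "\<exists>C. \<forall>n b \<beta> t. (\<forall>j<n. \<bar>b j\<bar> \<le> \<beta>) \<longrightarrow> 0 \<le> \<beta> \<longrightarrow>
    cmod ((CLINT x|S. iexp (t * (\<Sum>j<n. b j * w (shift j x))))
      - exp (- (t * rv_norm S (\<lambda>x. \<Sum>j<n. b j * w (shift j x)))\<^sup>2 / 2)) \<le> C * (n * \<beta> ^ 3) * \<bar>t\<bar> ^ 3"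
proof -
  obtain q B where w: "w \<in> borel_measurable S" "depends_on {..<q} w" "\<And>x. \<bar>w x\<bar> \<le> B"
    using assms(1) unfolding cylinder_def by blast
  show ?thesis
    using char_psum_estimate[OF w assms(2)]
    by (intro exI[of _ "24 * q\<^sup>2 * B ^ 3"]) (simp add: psum_def[OF w assms(2)] power_mult_distrib rv_norm_square)
qed

lemma char_dist_le:
  assumes f: "f \<in> square_integrable S" and g: "g \<in> square_integrable S"
  shows "cmod ((CLINT x|S. iexp (t * f x)) - (CLINT x|S. iexp (t * g x))) \<le> \<bar>t\<bar> * rv_norm S (\<lambda>x. f x - g x)"
proof -
  have [measurable]: "f \<in> borel_measurable S" "g \<in> borel_measurable S"
    using f g by (auto intro: square_integrable_measurable)
  have fg: "(\<lambda>x. f x - g x) \<in> square_integrable S" by (rule square_integrable_diff[OF f g])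
  have i: "integrable S (\<lambda>x. iexp (t * h x))" if [measurable]: "h \<in> borel_measurable S" for h
    by (rule P.integrable_const_bound[of _ 1]) auto
  have eq: "(CLINT x|S. iexp (t * f x)) - (CLINT x|S. iexp (t * g x)) = (CLINT x|S. iexp (t * f x) - iexp (t * g x))"
    by (rule Bochner_Integration.integral_diff[symmetric]) (intro i, measurable)+
  have "cmod (CLINT x|S. iexp (t * f x) - iexp (t * g x)) \<le> (\<integral>x. cmod (iexp (t * f x) - iexp (t * g x)) \<partial>S)"
    by (rule integral_norm_bound)
  also have "\<dots> \<le> (\<integral>x. \<bar>t\<bar> * \<bar>f x - g x\<bar> \<partial>S)"
  proof (rule integral_mono)
    show "integrable S (\<lambda>x. cmod (iexp (t * f x) - iexp (t * g x)))"
      by (intro integrable_norm Bochner_Integration.integrable_diff i) measurable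
    show "integrable S (\<lambda>x. \<bar>t\<bar> * \<bar>f x - g x\<bar>)"
      by (intro integrable_mult_right integrable_abs P.square_integrable_integrable fg)
    show "cmod (iexp (t * f x) - iexp (t * g x)) \<le> \<bar>t\<bar> * \<bar>f x - g x\<bar>" for x
      using iexp_dist[of "t * f x" "t * g x"] by (simp add: abs_mult flip: right_diff_distrib)
  qed
  also have "\<dots> = \<bar>t\<bar> * (\<integral>x. \<bar>f x - g x\<bar> \<partial>S)" by simp
  also have "\<dots> \<le> \<bar>t\<bar> * rv_norm S (\<lambda>x. f x - g x)"
    by (intro mult_left_mono P.integral_le_rv_norm fg) auto
  finally show ?thesis unfolding eq .
qed

text \<open>First \<open>w\<close> is fixed through \<open>\<delta>\<close>, then \<open>n\<close>
  grows. The distance to the limit splits into four parts: from \<open>T n\<close> to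
  \<open>W n\<close>, from \<open>W n\<close> to the Gaussian of its variance, from there to the
  Gaussian with the variance of \<open>T n\<close>, and from there to the standard one. The first
  and third are governed by \<open>\<delta>\<close>, the other two vanish.\<close>

lemma weighted_sum_char_tendsto:
  fixes b :: "nat \<Rightarrow> nat \<Rightarrow> real"
  assumes G: "G \<in> square_integrable S" and mean: "(\<integral>x. G x \<partial>S) = 0"
    and sm: "summable (\<lambda>l. rv_norm S (innov G l))"
    and b: "\<And>n i. i < n \<Longrightarrow> \<bar>b n i\<bar> \<le> C / sqrt n" and "0 \<le> C"
    and var: "(\<lambda>n. rv_norm S (\<lambda>x. \<Sum>i<n. b n i * G (shift i x))) \<longlonglongrightarrow> 1"
  shows "(\<lambda>n. CLINT x|S. iexp (t * (\<Sum>i<n. b n i * G (shift i x)))) \<longlonglongrightarrow> exp (- t\<^sup>2 / 2)"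
proof (rule LIMSEQ_I)
  fix e :: real assume "0 < e"
  define T where "T n x = (\<Sum>i<n. b n i * G (shift i x))" for n x
  \<comment> \<open>Chosen to make \<open>\<bar>t\<bar> * (\<delta> * C) \<le> e / 8\<close>; the
    additions of 1 avoid division by zero.\<close>
  define \<delta> where "\<delta> = e / (8 * ((\<bar>t\<bar> + 1) * (C + 1)))"
  have "0 < \<delta>" using \<open>0 < e\<close> \<open>0 \<le> C\<close> by (simp add: \<delta>_def)
  have small: "\<bar>t\<bar> * (\<delta> * C) \<le> e / 8"
  proof -
    have "\<bar>t\<bar> * C \<le> (\<bar>t\<bar> + 1) * (C + 1)" using \<open>0 \<le> C\<close> by (intro mult_mono) auto
    then have "(\<bar>t\<bar> * C) * \<delta> \<le> ((\<bar>t\<bar> + 1) * (C + 1)) * \<delta>"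
      using \<open>0 < \<delta>\<close> by (intro mult_right_mono) auto
    also have "\<dots> = e / 8"
    proof -
      have "x * (e / (8 * x)) = e / 8" if "x \<noteq> 0" for x using that by simp
      then show ?thesis unfolding \<delta>_def using \<open>0 \<le> C\<close> by auto
    qed
    finally show ?thesis by (simp add: mult_ac)
  qed
  obtain w where w: "w \<in> cylinder" "(\<integral>x. w x \<partial>S) = 0" and bd: "sums_bounded (\<lambda>x. G x - w x) \<delta>"
    by (rule cylinder_approximation[OF G mean sm \<open>0 < \<delta>\<close>])
  have wL: "w \<in> square_integrable S" by (rule cylinder_square_integrable[OF w(1)])
  define W where "W n x = (\<Sum>i<n. b n i * w (shift i x))" for n x
  have T: "T n \<in> square_integrable S" and W: "W n \<in> square_integrable S" for n
    unfolding T_def[abs_def] W_def[abs_def] by (rule square_integrable_shift_sum; fact)+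
  from char_cylinder_estimate[OF w]
  obtain K where K: "\<And>n b \<beta> t. (\<forall>j<n. \<bar>b j\<bar> \<le> \<beta>) \<Longrightarrow> 0 \<le> \<beta> \<Longrightarrow>
    cmod ((CLINT x|S. iexp (t * (\<Sum>j<n. b j * w (shift j x))))
      - exp (- (t * rv_norm S (\<lambda>x. \<Sum>j<n. b j * w (shift j x)))\<^sup>2 / 2)) \<le> K * (n * \<beta> ^ 3) * \<bar>t\<bar> ^ 3"
    by blast
  have TW: "rv_norm S (\<lambda>x. T n x - W n x) \<le> \<delta> * C" for n
  proof -
    have "(\<Sum>i<n. (b n i)\<^sup>2) \<le> (\<Sum>i<n. C\<^sup>2 / n)"
    proof (rule sum_mono)
      fix i assume "i \<in> {..<n}"
      then have "\<bar>b n i\<bar>\<^sup>2 \<le> (C / sqrt n)\<^sup>2" using b[of i n] by (intro power_mono) auto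
      then show "(b n i)\<^sup>2 \<le> C\<^sup>2 / n" by (simp add: power_divide)
    qed
    also have "\<dots> \<le> C\<^sup>2" by simp
    finally have "sqrt (\<Sum>i<n. (b n i)\<^sup>2) \<le> C" using \<open>0 \<le> C\<close> by (simp add: real_le_lsqrt)
    have "rv_norm S (\<lambda>x. T n x - W n x) = rv_norm S (\<lambda>x. \<Sum>i<n. b n i * (G (shift i x) - w (shift i x)))"
      by (simp add: T_def W_def right_diff_distrib sum_subtractf)
    also have "\<dots> \<le> \<delta> * sqrt (\<Sum>i<n. (b n i)\<^sup>2)"
      using bd by (simp add: sums_bounded_def)
    also have "\<dots> \<le> \<delta> * C" using \<open>0 < \<delta>\<close> \<open>sqrt (\<Sum>i<n. (b n i)\<^sup>2) \<le> C\<close> by (intro mult_left_mono) auto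
    finally show ?thesis .
  qed
  \<comment> \<open>With weights of size \<open>C / sqrt n\<close>, the cubic error is of order
    \<open>1 / sqrt n\<close>.\<close>
  have "(\<lambda>n. K * (real n * (C / sqrt (real n)) ^ 3) * \<bar>t\<bar> ^ 3) \<longlonglongrightarrow> 0"
  proof -
    have "(\<lambda>n. (K * C ^ 3 * \<bar>t\<bar> ^ 3) * (1 / sqrt (real n))) \<longlonglongrightarrow> (K * C ^ 3 * \<bar>t\<bar> ^ 3) * 0"
      by (intro tendsto_intros)
         (simp add: divide_inverse tendsto_inverse_0_at_top
           filterlim_compose[OF sqrt_at_top filterlim_real_sequentially])
    moreover have "K * (real n * (C / sqrt (real n)) ^ 3) * \<bar>t\<bar> ^ 3 = (K * C ^ 3 * \<bar>t\<bar> ^ 3) * (1 / sqrt (real n))" for n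
      by (cases "n = 0") (simp_all add: power3_eq_cube field_simps)
    ultimately show ?thesis by simp
  qed
  then have ev1: "\<forall>\<^sub>F n in sequentially. K * (real n * (C / sqrt (real n)) ^ 3) * \<bar>t\<bar> ^ 3 < e / 4"
    using \<open>0 < e\<close> by (intro order_tendstoD(2)) auto
  have "(\<lambda>n. exp (- (t * rv_norm S (T n))\<^sup>2 / 2)) \<longlonglongrightarrow> exp (- (t * 1)\<^sup>2 / 2)"
    using var unfolding T_def[abs_def] by (intro tendsto_intros) auto
  then have ev2: "\<forall>\<^sub>F n in sequentially. \<bar>exp (- (t * rv_norm S (T n))\<^sup>2 / 2) - exp (- t\<^sup>2 / 2)\<bar> < e / 4"
    using \<open>0 < e\<close> by (auto dest!: tendstoD[of _ _ _ "e / 4"] simp: dist_real_def)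
  from ev1 ev2 have "\<forall>\<^sub>F n in sequentially. cmod ((CLINT x|S. iexp (t * T n x)) - exp (- t\<^sup>2 / 2)) < e"
  proof eventually_elim
    case (elim n)
    let ?\<phi>T = "CLINT x|S. iexp (t * T n x)" and ?\<phi>W = "CLINT x|S. iexp (t * W n x)"
    let ?gT = "exp (- (t * rv_norm S (T n))\<^sup>2 / 2)" and ?gW = "exp (- (t * rv_norm S (W n))\<^sup>2 / 2)"
    have tTW: "\<bar>t\<bar> * rv_norm S (\<lambda>x. T n x - W n x) \<le> e / 8"
      by (rule order_trans[OF mult_left_mono[OF TW] small]) simp
    have 1: "cmod (?\<phi>T - ?\<phi>W) \<le> e / 8"
      by (rule order_trans[OF char_dist_le[OF T W] tTW])
    have 2: "cmod (?\<phi>W - ?gW) < e / 4"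
      using K[of n "b n" "C / sqrt n" t, folded W_def] b \<open>0 \<le> C\<close> elim(1) by (simp add: order_le_less_trans)
    have 3: "\<bar>?gW - ?gT\<bar> \<le> e / 8"
    proof -
      have "\<bar>?gW - ?gT\<bar> \<le> \<bar>t * rv_norm S (W n) - t * rv_norm S (T n)\<bar>" by (rule gaussian_Lipschitz)
      also have "\<dots> = \<bar>t\<bar> * \<bar>rv_norm S (T n) - rv_norm S (W n)\<bar>"
        by (simp add: abs_mult abs_minus_commute flip: right_diff_distrib)
      also have "\<dots> \<le> \<bar>t\<bar> * rv_norm S (\<lambda>x. T n x - W n x)"
        by (intro mult_left_mono rv_norm_triangle_diff T W) auto
      finally show ?thesis using tTW by linarith
    qed
    have eq: "?\<phi>T - exp (- t\<^sup>2 / 2) = (?\<phi>T - ?\<phi>W) + (?\<phi>W - ?gW) + of_real (?gW - ?gT) + of_real (?gT - exp (- t\<^sup>2 / 2))"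
      by simp
    have "cmod (?\<phi>T - exp (- t\<^sup>2 / 2)) \<le> cmod (?\<phi>T - ?\<phi>W) + cmod (?\<phi>W - ?gW) + cmod (of_real (?gW - ?gT))
        + cmod (of_real (?gT - exp (- t\<^sup>2 / 2)))"
      unfolding eq by (intro order_trans[OF norm_triangle_ineq] add_right_mono norm_triangle_ineq)
    also have "\<dots> < e" using 1 2 3 elim(2) \<open>0 < e\<close> unfolding norm_of_real by linarith
    finally show ?case .
  qed
  then show "\<exists>N. \<forall>n\<ge>N. cmod ((CLINT x|S. iexp (t * (\<Sum>i<n. b n i * G (shift i x)))) - exp (- t\<^sup>2 / 2)) < e"
    unfolding T_def eventually_sequentially .
qed

end

section \<open>The variance of trigonometric sums\<close>

text \<open>If \<open>n\<close> divides \<open>s\<close>, all summands agree. Otherwise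
  multiplication by \<open>2 * sin (\<alpha> / 2)\<close>, which is nonzero, telescopes the sum, and
  the two end terms differ by \<open>s\<close> full turns.\<close>

lemma sum_cos_period:
  fixes s :: int and \<beta> :: real
  assumes "0 < n"
  shows "(\<Sum>k=1..n. cos (real k * (2 * pi * s / n) + \<beta>)) = (if int n dvd s then n * cos \<beta> else 0)"
proof (cases "int n dvd s")
  case True
  then obtain u where u: "s = int n * u" by (elim dvdE)
  have "cos (real k * (2 * pi * s / n) + \<beta>) = cos \<beta>" for k
  proof -
    have "real k * (2 * pi * s / n) + \<beta> = \<beta> + of_int (int k * u) * (2 * pi)"
      using \<open>0 < n\<close> by (simp add: u field_simps)
    then show ?thesis
      by (simp only: cos_add sin_int_2pin cos_int_2pin mult.commute[of _ "2 * pi"])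
  qed
  then show ?thesis using True by simp
next
  case False
  define \<alpha> where "\<alpha> = 2 * pi * s / n"
  have "sin (\<alpha> / 2) \<noteq> 0"
  proof
    assume "sin (\<alpha> / 2) = 0"
    then obtain i :: int where "\<alpha> / 2 = of_int i * pi" by (auto simp: sin_zero_iff_int2)
    then have "real_of_int s = real_of_int (i * int n)" using \<open>0 < n\<close> by (simp add: \<alpha>_def field_simps)
    then have "s = i * int n" by (simp only: of_int_eq_iff)
    with False show False by simp
  qed
  have "2 * sin (\<alpha> / 2) * (\<Sum>k=1..m. cos (real k * \<alpha> + \<beta>)) = sin ((m + 1 / 2) * \<alpha> + \<beta>) - sin (\<alpha> / 2 + \<beta>)" for m
  proof (induction m)
    case (Suc m)
    have "2 * sin (\<alpha> / 2) * cos (real (Suc m) * \<alpha> + \<beta>)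
        = sin ((real (Suc m) + 1 / 2) * \<alpha> + \<beta>) - sin ((m + 1 / 2) * \<alpha> + \<beta>)"
      using sin_add[of "real (Suc m) * \<alpha> + \<beta>" "\<alpha> / 2"] sin_diff[of "real (Suc m) * \<alpha> + \<beta>" "\<alpha> / 2"]
      by (simp add: algebra_simps)
    with Suc show ?case by (simp add: algebra_simps)
  qed simp
  from this[of n] have "2 * sin (\<alpha> / 2) * (\<Sum>k=1..n. cos (real k * \<alpha> + \<beta>))
      = sin ((n + 1 / 2) * \<alpha> + \<beta>) - sin (\<alpha> / 2 + \<beta>)" .
  also have "(n + 1 / 2) * \<alpha> + \<beta> = (\<alpha> / 2 + \<beta>) + of_int s * (2 * pi)"
    using \<open>0 < n\<close> by (simp add: \<alpha>_def field_simps)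
  also have "sin \<dots> = sin (\<alpha> / 2 + \<beta>)"
    by (simp only: sin_add[of "\<alpha> / 2 + \<beta>"] sin_int_2pin cos_int_2pin mult.commute[of _ "2 * pi"])
  finally show ?thesis using False \<open>sin (\<alpha> / 2) \<noteq> 0\<close> by (simp add: \<alpha>_def)
qed

lemma summable_on_mult_bounded:
  fixes r F :: "'i \<Rightarrow> real"
  assumes r: "r summable_on A" and F: "\<And>h. h \<in> A \<Longrightarrow> \<bar>F h\<bar> \<le> C"
  shows "(\<lambda>h. norm (r h * F h)) summable_on A"
proof -
  have "(\<lambda>h. norm (C * r h)) summable_on A"
    using r by (intro summable_on_iff_abs_summable_on_real[THEN iffD1] summable_on_cmult_right)
  then show ?thesis
  proof (rule Infinite_Sum.abs_summable_on_comparison_test)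
    fix h assume "h \<in> A"
    then have "\<bar>F h\<bar> \<le> \<bar>C\<bar>" using F[of h] by simp
    then have "\<bar>F h\<bar> * \<bar>r h\<bar> \<le> \<bar>C\<bar> * \<bar>r h\<bar>" by (rule mult_right_mono) simp
    then show "norm (r h * F h) \<le> norm (C * r h)" by (simp add: abs_mult mult.commute)
  qed
qed

lemma summable_on_sum:
  fixes f :: "'i \<Rightarrow> 'j \<Rightarrow> real"
  assumes "\<And>i. i \<in> I \<Longrightarrow> f i summable_on A"
  shows "(\<lambda>x. \<Sum>i\<in>I. f i x) summable_on A"
  using assms by (induction I rule: infinite_finite_induct) (auto intro: summable_on_add)

lemma infsum_sum:
  fixes f :: "'i \<Rightarrow> 'j \<Rightarrow> real"
  assumes "\<And>i. i \<in> I \<Longrightarrow> f i summable_on A"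
  shows "(\<Sum>\<^sub>\<infinity>x\<in>A. \<Sum>i\<in>I. f i x) = (\<Sum>i\<in>I. infsum (f i) A)"
  using assms
proof (induction I rule: infinite_finite_induct)
  case (insert i I)
  then have "(\<lambda>x. \<Sum>i\<in>I. f i x) summable_on A" by (intro summable_on_sum) auto
  with insert show ?case by (simp add: infsum_add)
qed simp_all

text \<open>Writing \<open>sin x = cos (x - \<pi>/2)\<close>, cosine and sine coefficients differ only in a phase.\<close>

definition trig_freq :: "nat \<Rightarrow> nat \<Rightarrow> nat" where
  "trig_freq n j = (if j \<le> num_freq n then j else j - num_freq n)"

definition trig_phase :: "nat \<Rightarrow> nat \<Rightarrow> real" where
  "trig_phase n j = (if j \<le> num_freq n then 0 else pi / 2)"

text \<open>The time argument ranges over all integers because the circulant sums use the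
  \<open>n\<close>-periodic continuation beyond \<open>1\<close> and \<open>n\<close>.\<close>

definition trig :: "nat \<Rightarrow> nat \<Rightarrow> int \<Rightarrow> real" where
  "trig n j k = cos (of_int k * fourier_freq n (trig_freq n j) - trig_phase n j)"

text \<open>The product formula gives cosines of frequencies \<open>a - b\<close> and
  \<open>a + b\<close>. Both \<open>a\<close> and \<open>b\<close> lie strictly between
  \<open>0\<close> and \<open>n / 2\<close>, so \<open>n\<close> never divides \<open>a + b\<close>,
  and it divides \<open>a - b\<close> only if they are equal.\<close>

lemma trig_orthogonal:
  assumes n: "0 < n" and j: "j \<in> {1..2 * num_freq n}" and j': "j' \<in> {1..2 * num_freq n}"
  shows "(\<Sum>k=1..n. trig n j (int k) * trig n j' (int k + h)) =
    (if trig_freq n j = trig_freq n j'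
     then n / 2 * cos (of_int h * fourier_freq n (trig_freq n j) + (trig_phase n j - trig_phase n j')) else 0)"
proof -
  define a b where "a = trig_freq n j" and "b = trig_freq n j'"
  define \<phi> \<psi> where "\<phi> = trig_phase n j" and "\<psi> = trig_phase n j'"
  have ab: "1 \<le> a" "2 * a < n" "1 \<le> b" "2 * b < n"
    using j j' n by (auto simp: a_def b_def trig_freq_def num_freq_def)
  define \<beta>1 where "\<beta>1 = \<psi> - \<phi> - of_int h * fourier_freq n b"
  define \<beta>2 where "\<beta>2 = of_int h * fourier_freq n b - \<phi> - \<psi>"
  have "trig n j (int k) * trig n j' (int k + h)
      = (cos (real k * (2 * pi * of_int (int a - int b) / n) + \<beta>1)
        + cos (real k * (2 * pi * of_int (int a + int b) / n) + \<beta>2)) / 2" for k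
  proof -
    have "cos x * cos y = (cos (x - y) + cos (x + y)) / 2" for x y :: real
      by (simp add: cos_add cos_diff)
    from this[of "real k * fourier_freq n a - \<phi>" "(real k + of_int h) * fourier_freq n b - \<psi>"]
    show ?thesis
      unfolding trig_def a_def[symmetric] b_def[symmetric] \<phi>_def[symmetric] \<psi>_def[symmetric]
      by (simp add: \<beta>1_def \<beta>2_def fourier_freq_def algebra_simps add_divide_distrib diff_divide_distrib)
  qed
  then have "(\<Sum>k=1..n. trig n j (int k) * trig n j' (int k + h))
      = ((\<Sum>k=1..n. cos (real k * (2 * pi * of_int (int a - int b) / n) + \<beta>1))
        + (\<Sum>k=1..n. cos (real k * (2 * pi * of_int (int a + int b) / n) + \<beta>2))) / 2"
    by (simp only: add_divide_distrib sum_divide_distrib sum.distrib)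
  also have "\<dots> = (if int n dvd int a - int b then n * cos \<beta>1 else 0) / 2"
  proof -
    have "\<not> int n dvd int a + int b"
    proof
      assume "int n dvd int a + int b"
      then have "int n \<le> int a + int b" using ab by (intro zdvd_imp_le) auto
      then show False using ab by simp
    qed
    then show ?thesis by (simp only: sum_cos_period[OF n]) simp
  qed
  also have "int n dvd int a - int b \<longleftrightarrow> a = b"
  proof
    assume d: "int n dvd int a - int b"
    have "int a - int b = 0"
    proof (rule ccontr)
      assume "int a - int b \<noteq> 0"
      from dvd_imp_le_int[OF this d] ab show False by linarith
    qed
    then show "a = b" by simp
  qed simp
  also have "(if a = b then n * cos \<beta>1 else 0) / 2
      = (if a = b then n / 2 * cos (of_int h * fourier_freq n a + (\<phi> - \<psi>)) else 0)"
  proof -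
    have "cos (\<psi> - \<phi> - of_int h * fourier_freq n b) = cos (of_int h * fourier_freq n b + (\<phi> - \<psi>))"
      using cos_minus[of "of_int h * fourier_freq n b + (\<phi> - \<psi>)"] by (simp add: algebra_simps)
    then show ?thesis by (auto simp: \<beta>1_def)
  qed
  finally show ?thesis by (simp add: a_def b_def \<phi>_def \<psi>_def)
qed

definition cos_series :: "(int \<Rightarrow> real) \<Rightarrow> real \<Rightarrow> real" where
  "cos_series r \<theta> = (\<Sum>\<^sub>\<infinity>h. r h * cos (of_int h * \<theta>))"

text \<open>Expanding the cosine leaves a sine series, which is odd in \<open>h\<close> and vanishes
  for even \<open>r\<close>.\<close>

lemma cos_series_shift:
  fixes r :: "int \<Rightarrow> real"
  assumes r: "r summable_on UNIV" and even: "\<And>h. r (- h) = r h"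
  shows "(\<Sum>\<^sub>\<infinity>h. r h * cos (of_int h * \<theta> + \<delta>)) = cos \<delta> * cos_series r \<theta>"
proof -
  have sc: "(\<lambda>h. r h * cos (of_int h * \<theta>)) summable_on UNIV"
    by (rule Infinite_Sum.abs_summable_summable[OF summable_on_mult_bounded[OF r, of _ 1]]) simp
  have ss: "(\<lambda>h. r h * sin (of_int h * \<theta>)) summable_on UNIV"
    by (rule Infinite_Sum.abs_summable_summable[OF summable_on_mult_bounded[OF r, of _ 1]]) simp
  have "(\<Sum>\<^sub>\<infinity>h. r h * sin (of_int h * \<theta>)) = (\<Sum>\<^sub>\<infinity>h. r (- h) * sin (of_int (- h) * \<theta>))"
    by (rule infsum_reindex_bij_betw[symmetric]) (rule bij_uminus)
  also have "\<dots> = - (\<Sum>\<^sub>\<infinity>h. r h * sin (of_int h * \<theta>))"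
    by (simp add: even infsum_uminus)
  finally have sin0: "(\<Sum>\<^sub>\<infinity>h. r h * sin (of_int h * \<theta>)) = 0" by simp
  have "(\<Sum>\<^sub>\<infinity>h. r h * cos (of_int h * \<theta> + \<delta>))
      = (\<Sum>\<^sub>\<infinity>h. cos \<delta> * (r h * cos (of_int h * \<theta>)) + (- sin \<delta>) * (r h * sin (of_int h * \<theta>)))"
    by (intro infsum_cong) (simp add: cos_add algebra_simps)
  also have "\<dots> = cos \<delta> * cos_series r \<theta> + (- sin \<delta>) * (\<Sum>\<^sub>\<infinity>h. r h * sin (of_int h * \<theta>))"
    by (subst infsum_add) (intro summable_on_cmult_right sc ss, intro summable_on_cmult_right sc ss,
        simp only: infsum_cmult_right' cos_series_def)
  finally show ?thesis by (simp add: sin0)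
qed

text \<open>The coefficient of \<open>X k\<close> in the linear combination of the normalised
  Fourier coefficients; \<open>js\<close> enumerates the index set, \<open>f\<close> is the spectral
  density.\<close>

definition trig_weight :: "(real \<Rightarrow> real) \<Rightarrow> nat \<Rightarrow> nat \<Rightarrow> (nat \<Rightarrow> nat) \<Rightarrow> (nat \<Rightarrow> real) \<Rightarrow> int \<Rightarrow> real" where
  "trig_weight f n p js c k =
     (\<Sum>i<p. c i / sqrt (pi * n * f (fourier_freq n (trig_freq n (js i)))) * trig n (js i) k)"

lemma trig_weight_bound:
  assumes f: "\<And>\<theta>. f0 \<le> f \<theta>" "0 < f0" and c: "\<And>i. i < p \<Longrightarrow> \<bar>c i\<bar> \<le> 1"
  shows "\<bar>trig_weight f n p js c k\<bar> \<le> (p / sqrt (pi * f0)) / sqrt n"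
\<comment> \<open>For \<open>n = 0\<close> both sides are \<open>0\<close>, as division by zero
  yields \<open>0\<close>.\<close>
proof (cases "n = 0")
  case False
  have "\<bar>trig_weight f n p js c k\<bar> \<le> (\<Sum>i<p. (1 / sqrt (pi * n * f0)) * 1)"
    unfolding trig_weight_def
  proof (rule order_trans[OF sum_abs sum_mono], unfold abs_mult, rule mult_mono)
    fix i assume "i \<in> {..<p}"
    have "sqrt (pi * n * f0) \<le> sqrt (pi * n * f (fourier_freq n (trig_freq n (js i))))"
      using f by (intro real_sqrt_le_mono mult_left_mono) auto
    moreover have "0 < sqrt (pi * n * f0)" using False f by simp
    ultimately show "\<bar>c i / sqrt (pi * n * f (fourier_freq n (trig_freq n (js i))))\<bar> \<le> 1 / sqrt (pi * n * f0)"
      unfolding abs_divide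
      by (intro frac_le order_trans[OF _ abs_ge_self]) (use c \<open>i \<in> {..<p}\<close> in auto)
    show "\<bar>trig n (js i) k\<bar> \<le> 1" by (simp add: trig_def)
  qed (use f in auto)
  also have "\<dots> = (p / sqrt (pi * f0)) / sqrt n"
    by (simp add: real_sqrt_mult mult_ac)
  finally show ?thesis .
qed (simp add: trig_weight_def)

text \<open>Two different indices with a common frequency are a cosine and a sine, a quarter turn
  apart.\<close>

lemma cos_trig_phase_diff:
  assumes "j \<in> {1..2 * num_freq n}" "j' \<in> {1..2 * num_freq n}" "trig_freq n j = trig_freq n j'"
  shows "cos (trig_phase n j - trig_phase n j') = (if j = j' then 1 else 0)"
  using assms by (auto simp: trig_freq_def trig_phase_def split: if_splits)

text \<open>Summation over the lag \<open>h\<close> turns the \<open>cos (h * \<theta>)\<close> from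
  orthogonality into \<open>cos_series r \<theta>\<close>, that is
  \<open>2 * pi * f \<theta>\<close>. With the factor \<open>n / 2\<close> this cancels the
  normalisation \<open>pi * n * f \<theta>\<close> exactly, and distinct indices contribute nothing;
  what remains is the sum of the squares of \<open>c\<close>.\<close>

lemma trig_weight_variance_periodic:
  fixes r :: "int \<Rightarrow> real"
  assumes r: "r summable_on UNIV" and even: "\<And>h. r (- h) = r h"
    and f: "\<And>\<theta>. f \<theta> = cos_series r \<theta> / (2 * pi)" "\<And>\<theta>. 0 < f \<theta>"
    and n: "0 < n" and js: "inj_on js {..<p}" "\<And>i. i < p \<Longrightarrow> js i \<in> {1..2 * num_freq n}"
    and c: "(\<Sum>i<p. (c i)\<^sup>2) = 1"
  shows "(\<Sum>\<^sub>\<infinity>h. r h * (\<Sum>k=1..n. trig_weight f n p js c (int k) * trig_weight f n p js c (int k + h))) = 1"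
proof -
  define \<theta> where "\<theta> i = fourier_freq n (trig_freq n (js i))" for i
  define g where "g i = c i / sqrt (pi * n * f (\<theta> i))" for i
  define u where "u i = trig n (js i)" for i
  define \<phi> where "\<phi> i = trig_phase n (js i)" for i
  define e where "e i l = (if trig_freq n (js i) = trig_freq n (js l) then 1 else 0 :: real)" for i l
  have W: "trig_weight f n p js c k = (\<Sum>i<p. g i * u i k)" for k
    by (simp add: trig_weight_def g_def u_def \<theta>_def)
  have circ: "(\<Sum>k=1..n. trig_weight f n p js c (int k) * trig_weight f n p js c (int k + h))
      = (\<Sum>i<p. \<Sum>l<p. g i * g l * e i l * (n / 2) * cos (of_int h * \<theta> i + (\<phi> i - \<phi> l)))" for h
  proof -
    have "(\<Sum>k=1..n. trig_weight f n p js c (int k) * trig_weight f n p js c (int k + h))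
        = (\<Sum>k=1..n. \<Sum>i<p. \<Sum>l<p. g i * g l * (u i (int k) * u l (int k + h)))"
      unfolding W sum_product by (simp add: mult_ac)
    also have "\<dots> = (\<Sum>i<p. \<Sum>k=1..n. \<Sum>l<p. g i * g l * (u i (int k) * u l (int k + h)))"
      by (rule sum.swap)
    also have "\<dots> = (\<Sum>i<p. \<Sum>l<p. \<Sum>k=1..n. g i * g l * (u i (int k) * u l (int k + h)))"
      by (rule sum.cong[OF refl]) (rule sum.swap)
    also have "\<dots> = (\<Sum>i<p. \<Sum>l<p. g i * g l * (\<Sum>k=1..n. u i (int k) * u l (int k + h)))"
      by (simp only: sum_distrib_left)
    also have "\<dots> = (\<Sum>i<p. \<Sum>l<p. g i * g l * e i l * (n / 2) * cos (of_int h * \<theta> i + (\<phi> i - \<phi> l)))"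
    proof (intro sum.cong refl)
      fix i l assume "i \<in> {..<p}" "l \<in> {..<p}"
      then have "js i \<in> {1..2 * num_freq n}" "js l \<in> {1..2 * num_freq n}" using js(2) by auto
      from trig_orthogonal[OF n this, of h]
      show "g i * g l * (\<Sum>k=1..n. u i (int k) * u l (int k + h))
          = g i * g l * e i l * (n / 2) * cos (of_int h * \<theta> i + (\<phi> i - \<phi> l))"
        by (simp add: u_def e_def \<theta>_def \<phi>_def)
    qed
    finally show ?thesis .
  qed
  have sm: "(\<lambda>h. r h * cos (of_int h * \<theta> i + d)) summable_on UNIV" for i d
    by (rule Infinite_Sum.abs_summable_summable[OF summable_on_mult_bounded[OF r, of _ 1]]) simp
  have "(\<Sum>\<^sub>\<infinity>h. r h * (\<Sum>k=1..n. trig_weight f n p js c (int k) * trig_weight f n p js c (int k + h)))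
      = (\<Sum>\<^sub>\<infinity>h. \<Sum>i<p. \<Sum>l<p. (g i * g l * e i l * (n / 2)) * (r h * cos (of_int h * \<theta> i + (\<phi> i - \<phi> l))))"
    unfolding circ by (simp add: sum_distrib_left mult_ac)
  also have "\<dots> = (\<Sum>i<p. \<Sum>\<^sub>\<infinity>h. \<Sum>l<p. (g i * g l * e i l * (n / 2)) * (r h * cos (of_int h * \<theta> i + (\<phi> i - \<phi> l))))"
    by (intro infsum_sum summable_on_sum summable_on_cmult_right sm)
  also have "\<dots> = (\<Sum>i<p. \<Sum>l<p. \<Sum>\<^sub>\<infinity>h. (g i * g l * e i l * (n / 2)) * (r h * cos (of_int h * \<theta> i + (\<phi> i - \<phi> l))))"
    by (intro sum.cong refl infsum_sum summable_on_cmult_right sm)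
  also have "\<dots> = (\<Sum>i<p. \<Sum>l<p. g i * g l * e i l * (n / 2) * (cos (\<phi> i - \<phi> l) * cos_series r (\<theta> i)))"
    by (simp only: infsum_cmult_right' cos_series_shift[OF r even])
  also have "\<dots> = (\<Sum>i<p. \<Sum>l<p. if l = i then (c i)\<^sup>2 else 0)"
  proof (intro sum.cong refl)
    fix i l assume il: "i \<in> {..<p}" "l \<in> {..<p}"
    then have J: "js i \<in> {1..2 * num_freq n}" "js l \<in> {1..2 * num_freq n}" using js(2) by auto
    have eq: "js i = js l \<longleftrightarrow> l = i" using js(1) il by (auto dest: inj_onD)
    have ec: "e i l * cos (\<phi> i - \<phi> l) = (if l = i then 1 else 0)"
      using cos_trig_phase_diff[OF J] eq by (auto simp: e_def \<phi>_def)
    have gg: "g i * g i * (n / 2) * cos_series r (\<theta> i) = (c i)\<^sup>2"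
    proof -
      have "0 < pi * n * f (\<theta> i)" using n f(2) by simp
      then have "g i * g i = (c i)\<^sup>2 / (pi * n * f (\<theta> i))"
        by (simp add: g_def power2_eq_square)
      moreover have "cos_series r (\<theta> i) = 2 * pi * f (\<theta> i)" by (simp add: f(1))
      ultimately show ?thesis using n f(2)[of "\<theta> i"] by (simp add: field_simps)
    qed
    have "g i * g l * e i l * (n / 2) * (cos (\<phi> i - \<phi> l) * cos_series r (\<theta> i))
        = (g i * g l * (n / 2) * cos_series r (\<theta> i)) * (e i l * cos (\<phi> i - \<phi> l))"
      by (simp add: mult_ac)
    also have "\<dots> = (if l = i then (c i)\<^sup>2 else 0)" unfolding ec using gg by auto
    finally show "g i * g l * e i l * (n / 2) * (cos (\<phi> i - \<phi> l) * cos_series r (\<theta> i))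
        = (if l = i then (c i)\<^sup>2 else 0)" .
  qed
  also have "\<dots> = 1" using c by simp
  finally show ?thesis .
qed

section \<open>From circulant to Toeplitz quadratic forms\<close>

lemma card_shift_out: "card {k \<in> {1..n}. int k + h \<notin> {1..int n}} \<le> min (nat \<bar>h\<bar>) n"
proof -
  let ?A = "{k \<in> {1..n}. int k + h \<notin> {1..int n}}"
  have "?A \<subseteq> {1..n}" by auto
  from card_mono[OF _ this] have 1: "card ?A \<le> n" by simp
  have "card ?A \<le> nat \<bar>h\<bar>"
  proof (cases "0 \<le> h")
    case True
    then have "?A \<subseteq> {n - nat h<..n}" by auto
    from card_mono[OF _ this] True show ?thesis by simp
  next
    case False
    then have "?A \<subseteq> {1..nat (- h)}" by auto
    from card_mono[OF _ this] False show ?thesis by simp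
  qed
  with 1 show ?thesis by simp
qed

text \<open>At lag \<open>h\<close>, a Toeplitz quadratic form and its circulant version differ in at most
  \<open>min \<bar>h\<bar> n\<close> boundary terms.\<close>

lemma toeplitz_circulant:
  fixes r a :: "int \<Rightarrow> real"
  assumes r: "r summable_on UNIV" and a: "\<And>k. \<bar>a k\<bar> \<le> C / sqrt n" and n: "0 < n" and F: "finite F"
  shows "\<bar>(\<Sum>k=1..n. \<Sum>l=1..n. a (int k) * a (int l) * r (int l - int k))
      - (\<Sum>\<^sub>\<infinity>h. r h * (\<Sum>k=1..n. a (int k) * a (int k + h)))\<bar>
    \<le> C\<^sup>2 * ((\<Sum>h\<in>F. \<bar>r h\<bar> * \<bar>of_int h\<bar>) / n + (\<Sum>\<^sub>\<infinity>h\<in>-F. \<bar>r h\<bar>))"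
proof -
  define inn where "inn h = {k \<in> {1..n}. int k + h \<in> {1..int n}}" for h
  define out where "out h = {k \<in> {1..n}. int k + h \<notin> {1..int n}}" for h
  define U where "U h = (\<Sum>k\<in>inn h. a (int k) * a (int k + h))" for h
  define D where "D h = (\<Sum>k\<in>out h. a (int k) * a (int k + h))" for h
  have split: "(\<Sum>k=1..n. a (int k) * a (int k + h)) = U h + D h" for h
  proof -
    have "{1..n} = inn h \<union> out h" by (auto simp: inn_def out_def)
    then show ?thesis unfolding U_def D_def
      by (simp only:) (rule sum.union_disjoint, auto simp: inn_def out_def)
  qed
  have aa: "\<bar>a k * a l\<bar> \<le> C\<^sup>2 / n" for k l
  proof -
    have "\<bar>a k * a l\<bar> \<le> (C / sqrt n) * (C / sqrt n)"
      unfolding abs_mult by (intro mult_mono a) (auto intro: order_trans[OF abs_ge_zero a])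
    then show ?thesis by (simp add: power2_eq_square)
  qed
  have sums: "\<bar>\<Sum>k\<in>K. a (int k) * a (int k + h)\<bar> \<le> real N * (C\<^sup>2 / n)" if "card K \<le> N" for K h N
  proof -
    have "\<bar>\<Sum>k\<in>K. a (int k) * a (int k + h)\<bar> \<le> (\<Sum>k\<in>K. C\<^sup>2 / n)"
      by (rule order_trans[OF sum_abs sum_mono]) (rule aa)
    also have "\<dots> \<le> real N * (C\<^sup>2 / n)" using that by (auto intro!: divide_right_mono mult_right_mono)
    finally show ?thesis .
  qed
  have D1: "\<bar>D h\<bar> \<le> \<bar>of_int h\<bar> * (C\<^sup>2 / n)" for h
    using sums[of "out h" "nat \<bar>h\<bar>" h] card_shift_out[of n h] by (simp add: D_def out_def)
  have D2: "\<bar>D h\<bar> \<le> C\<^sup>2" for h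
    using sums[of "out h" n h] card_shift_out[of n h] n by (simp add: D_def out_def)
  have U2: "\<bar>U h\<bar> \<le> C\<^sup>2" for h
  proof -
    have "inn h \<subseteq> {1..n}" by (auto simp: inn_def)
    from card_mono[OF _ this] have "card (inn h) \<le> n" by simp
    from sums[OF this, of h] n show ?thesis by (simp add: U_def)
  qed
  \<comment> \<open>Grouping the double sum by the lag \<open>h = l - k\<close>; lags beyond
    \<open>n\<close> in modulus have no inner pairs.\<close>
  have toep: "(\<Sum>k=1..n. \<Sum>l=1..n. a (int k) * a (int l) * r (int l - int k)) = (\<Sum>\<^sub>\<infinity>h. r h * U h)"
  proof -
    define H where "H = {- int n..int n}"
    have "(\<Sum>\<^sub>\<infinity>h. r h * U h) = (\<Sum>\<^sub>\<infinity>h\<in>H. r h * U h)"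
    proof (rule infsum_cong_neutral)
      fix h assume "h \<in> UNIV - H"
      then have "inn h = {}" by (auto simp: inn_def H_def)
      then show "r h * U h = 0" by (simp add: U_def)
    qed auto
    also have "\<dots> = (\<Sum>h\<in>H. r h * U h)" by (simp add: H_def)
    also have "\<dots> = (\<Sum>h\<in>H. \<Sum>k=1..n. if int k + h \<in> {1..int n} then a (int k) * a (int k + h) * r h else 0)"
    proof (rule sum.cong[OF refl])
      fix h
      have "r h * U h = (\<Sum>k\<in>inn h. a (int k) * a (int k + h) * r h)"
        by (simp add: U_def sum_distrib_left mult_ac)
      also have "\<dots> = (\<Sum>k=1..n. if int k + h \<in> {1..int n} then a (int k) * a (int k + h) * r h else 0)"
        unfolding inn_def by (rule sum.inter_filter) simp
      finally show "r h * U h = (\<Sum>k=1..n. if int k + h \<in> {1..int n} then a (int k) * a (int k + h) * r h else 0)" .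
    qed
    also have "\<dots> = (\<Sum>k=1..n. \<Sum>h\<in>H. if int k + h \<in> {1..int n} then a (int k) * a (int k + h) * r h else 0)"
      by (rule sum.swap)
    also have "\<dots> = (\<Sum>k=1..n. \<Sum>l=1..n. a (int k) * a (int l) * r (int l - int k))"
    proof (rule sum.cong[OF refl])
      fix k assume k: "k \<in> {1..n}"
      have "(\<Sum>h\<in>H. if int k + h \<in> {1..int n} then a (int k) * a (int k + h) * r h else 0)
          = (\<Sum>h | h \<in> H \<and> int k + h \<in> {1..int n}. a (int k) * a (int k + h) * r h)"
        by (rule sum.inter_filter[symmetric]) (simp add: H_def)
      also have "\<dots> = (\<Sum>l=1..n. a (int k) * a (int l) * r (int l - int k))"
        by (rule sum.reindex_bij_witness[where i = "\<lambda>l. int l - int k" and j = "\<lambda>h. nat (int k + h)"])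
           (use k in \<open>auto simp: H_def\<close>)
      finally show "(\<Sum>h\<in>H. if int k + h \<in> {1..int n} then a (int k) * a (int k + h) * r h else 0)
          = (\<Sum>l=1..n. a (int k) * a (int l) * r (int l - int k))" .
    qed
    finally show ?thesis by simp
  qed
  have sU: "(\<lambda>h. r h * U h) summable_on UNIV"
    by (rule Infinite_Sum.abs_summable_summable[OF summable_on_mult_bounded[OF r U2]])
  have sD: "(\<lambda>h. norm (r h * D h)) summable_on UNIV"
    by (rule summable_on_mult_bounded[OF r D2])
  have sD': "(\<lambda>h. \<bar>r h * D h\<bar>) summable_on A" for A
    using summable_on_subset_banach[OF sD, of A] by simp
  have "(\<Sum>\<^sub>\<infinity>h. r h * (\<Sum>k=1..n. a (int k) * a (int k + h))) = (\<Sum>\<^sub>\<infinity>h. r h * U h) + (\<Sum>\<^sub>\<infinity>h. r h * D h)"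
    unfolding split distrib_left by (rule infsum_add[OF sU Infinite_Sum.abs_summable_summable[OF sD]])
  then have "\<bar>(\<Sum>k=1..n. \<Sum>l=1..n. a (int k) * a (int l) * r (int l - int k))
      - (\<Sum>\<^sub>\<infinity>h. r h * (\<Sum>k=1..n. a (int k) * a (int k + h)))\<bar> = \<bar>\<Sum>\<^sub>\<infinity>h. r h * D h\<bar>"
    unfolding toep by simp
  also have "\<dots> \<le> (\<Sum>\<^sub>\<infinity>h. \<bar>r h * D h\<bar>)"
    using norm_infsum_bound[OF sD] by simp
  also have "\<dots> = (\<Sum>\<^sub>\<infinity>h\<in>F. \<bar>r h * D h\<bar>) + (\<Sum>\<^sub>\<infinity>h\<in>-F. \<bar>r h * D h\<bar>)"
    using infsum_Un_disjoint[OF sD'[of F] sD'[of "- F"]] by simp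
  \<comment> \<open>On the finite set \<open>F\<close> the bound linear in the lag gains a factor
    \<open>1 / n\<close>; outside \<open>F\<close> the trivial bound suffices because the tail of
    \<open>r\<close> is small.\<close>
  also have "\<dots> \<le> (\<Sum>h\<in>F. C\<^sup>2 * (\<bar>r h\<bar> * \<bar>of_int h\<bar> / n)) + (\<Sum>\<^sub>\<infinity>h\<in>-F. C\<^sup>2 * \<bar>r h\<bar>)"
  proof (rule add_mono)
    show "(\<Sum>\<^sub>\<infinity>h\<in>F. \<bar>r h * D h\<bar>) \<le> (\<Sum>h\<in>F. C\<^sup>2 * (\<bar>r h\<bar> * \<bar>of_int h\<bar> / n))"
      unfolding infsum_finite[OF F]
    proof (rule sum_mono)
      fix h
      have "\<bar>r h\<bar> * \<bar>D h\<bar> \<le> \<bar>r h\<bar> * (\<bar>of_int h\<bar> * (C\<^sup>2 / n))" by (intro mult_left_mono D1) auto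
      then show "\<bar>r h * D h\<bar> \<le> C\<^sup>2 * (\<bar>r h\<bar> * \<bar>of_int h\<bar> / n)" by (simp add: abs_mult mult_ac)
    qed
    show "(\<Sum>\<^sub>\<infinity>h\<in>-F. \<bar>r h * D h\<bar>) \<le> (\<Sum>\<^sub>\<infinity>h\<in>-F. C\<^sup>2 * \<bar>r h\<bar>)"
    proof (rule infsum_mono[OF sD'])
      show "(\<lambda>h. C\<^sup>2 * \<bar>r h\<bar>) summable_on - F"
        using summable_on_iff_abs_summable_on_real[THEN iffD1, OF summable_on_subset_banach[OF r, of "- F"]]
        by (intro summable_on_cmult_right) simp
      fix h
      have "\<bar>r h\<bar> * \<bar>D h\<bar> \<le> \<bar>r h\<bar> * C\<^sup>2" by (intro mult_left_mono D2) auto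
      then show "\<bar>r h * D h\<bar> \<le> C\<^sup>2 * \<bar>r h\<bar>" by (simp add: abs_mult mult_ac)
    qed
  qed
  also have "\<dots> = C\<^sup>2 * ((\<Sum>h\<in>F. \<bar>r h\<bar> * \<bar>of_int h\<bar>) / n + (\<Sum>\<^sub>\<infinity>h\<in>-F. \<bar>r h\<bar>))"
    by (simp only: infsum_cmult_right' sum_distrib_left sum_divide_distrib distrib_left)
  finally show ?thesis .
qed

lemma infsum_tail_small:
  fixes r :: "'i \<Rightarrow> real"
  assumes r: "r summable_on UNIV" and "0 < e"
  obtains F where "finite F" "(\<Sum>\<^sub>\<infinity>h\<in>-F. \<bar>r h\<bar>) \<le> e"
proof -
  have ra: "(\<lambda>h. \<bar>r h\<bar>) summable_on A" for A
    using summable_on_iff_abs_summable_on_real[THEN iffD1, OF summable_on_subset_banach[OF r, of A]] by simp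
  from infsum_finite_approximation[OF ra[of UNIV] \<open>0 < e\<close>]
  obtain F where F: "finite F" "dist (\<Sum>h\<in>F. \<bar>r h\<bar>) (\<Sum>\<^sub>\<infinity>h. \<bar>r h\<bar>) \<le> e" by blast
  have "(\<Sum>\<^sub>\<infinity>h. \<bar>r h\<bar>) = (\<Sum>h\<in>F. \<bar>r h\<bar>) + (\<Sum>\<^sub>\<infinity>h\<in>-F. \<bar>r h\<bar>)"
    using infsum_Un_disjoint[OF ra[of F] ra[of "- F"]] F(1) by simp
  with F show ?thesis by (intro that[of F]) (auto simp: dist_real_def)
qed

text \<open>The circulant form equals 1 exactly, so only the boundary error is left;
  \<open>F\<close> is fixed before \<open>n\<close>, and \<open>C\<close> depends on neither
  \<open>js\<close> nor \<open>c\<close>.\<close>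

lemma trig_weight_variance_tendsto:
  fixes r :: "int \<Rightarrow> real" and js :: "nat \<Rightarrow> nat \<Rightarrow> nat" and c :: "nat \<Rightarrow> nat \<Rightarrow> real"
  assumes r: "r summable_on UNIV" and even: "\<And>h. r (- h) = r h"
    and f: "\<And>\<theta>. f \<theta> = cos_series r \<theta> / (2 * pi)" and f0: "\<And>\<theta>. f0 \<le> f \<theta>" "0 < f0"
    and js: "\<forall>\<^sub>F n in sequentially. inj_on (js n) {..<p} \<and> (\<forall>i<p. js n i \<in> {1..2 * num_freq n})"
    and c: "\<And>n. (\<Sum>i<p. (c n i)\<^sup>2) = 1"
  shows "(\<lambda>n. \<Sum>k=1..n. \<Sum>l=1..n. trig_weight f n p (js n) (c n) (int k)
      * trig_weight f n p (js n) (c n) (int l) * r (int l - int k)) \<longlonglongrightarrow> 1"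
proof (rule tendstoI)
  fix e :: real assume "0 < e"
  define C where "C = p / sqrt (pi * f0)"
  have "0 < e / (2 * (C\<^sup>2 + 1))"
    using \<open>0 < e\<close> by (simp add: add_nonneg_pos)
  then obtain F where F: "finite F" "(\<Sum>\<^sub>\<infinity>h\<in>-F. \<bar>r h\<bar>) \<le> e / (2 * (C\<^sup>2 + 1))"
    by (rule infsum_tail_small[OF r])
  define R where "R = (\<Sum>h\<in>F. \<bar>r h\<bar> * \<bar>of_int h\<bar> :: real)"
  have c1: "\<bar>c n i\<bar> \<le> 1" if "i < p" for n i
  proof -
    have "(c n i)\<^sup>2 \<le> (\<Sum>i<p. (c n i)\<^sup>2)" by (rule member_le_sum) (use that in auto)
    then show ?thesis using c[of n] by (simp add: abs_square_le_1)
  qed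
  have "(\<lambda>n. C\<^sup>2 * (R / real n)) \<longlonglongrightarrow> C\<^sup>2 * 0"
    by (intro tendsto_mult_left lim_const_over_n)
  then have "\<forall>\<^sub>F n in sequentially. C\<^sup>2 * (R / real n) < e / 2"
    using \<open>0 < e\<close> by (intro order_tendstoD(2)) auto
  from this js eventually_gt_at_top[of 0]
  show "\<forall>\<^sub>F n in sequentially. dist (\<Sum>k=1..n. \<Sum>l=1..n. trig_weight f n p (js n) (c n) (int k)
      * trig_weight f n p (js n) (c n) (int l) * r (int l - int k)) 1 < e"
  proof eventually_elim
    case (elim n)
    let ?a = "trig_weight f n p (js n) (c n)"
    have per: "(\<Sum>\<^sub>\<infinity>h. r h * (\<Sum>k=1..n. ?a (int k) * ?a (int k + h))) = 1"
      using elim c by (intro trig_weight_variance_periodic r even f less_le_trans[OF f0(2,1)]) auto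
    have "\<bar>(\<Sum>k=1..n. \<Sum>l=1..n. ?a (int k) * ?a (int l) * r (int l - int k)) - 1\<bar>
        \<le> C\<^sup>2 * (R / n + (\<Sum>\<^sub>\<infinity>h\<in>-F. \<bar>r h\<bar>))"
      unfolding R_def per[symmetric]
      by (intro toeplitz_circulant r F elim) (simp only: C_def trig_weight_bound[OF f0 c1])
    also have "\<dots> \<le> C\<^sup>2 * (R / n) + C\<^sup>2 * (e / (2 * (C\<^sup>2 + 1)))"
      by (subst distrib_left, rule add_left_mono[OF mult_left_mono[OF F(2)]], simp)
    also have "C\<^sup>2 * (e / (2 * (C\<^sup>2 + 1))) \<le> e / 2"
    proof -
      have "C\<^sup>2 * e \<le> (C\<^sup>2 + 1) * e" using \<open>0 < e\<close> by simp
      moreover have "0 < C\<^sup>2 + 1" by (simp add: add_nonneg_pos)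
      ultimately show ?thesis by (simp add: field_simps)
    qed
    also have "C\<^sup>2 * (R / n) + e / 2 < e" using elim(1) by linarith
    finally show ?case by (simp add: dist_real_def)
  qed
qed

section \<open>The causal process\<close>

locale iid_innovations = prob_space M for M :: "'a measure" +
  fixes \<epsilon> :: "int \<Rightarrow> 'a \<Rightarrow> real"
  assumes indep: "indep_vars (\<lambda>_. borel) \<epsilon> UNIV"
    and ident: "\<And>k. distr M borel (\<epsilon> k) = distr M borel (\<epsilon> 0)"
begin

lemma measurable_innovation [measurable]: "\<epsilon> k \<in> borel_measurable M"
  using indep by (auto simp: indep_vars_def)

definition law :: "real measure" where
  "law = distr M borel (\<epsilon> 0)"

lemma sets_law [simp]: "sets law = sets borel"
  by (simp add: law_def)

lemma space_law [simp]: "space law = UNIV"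
  by (simp add: law_def)

lemma prob_space_law: "prob_space law"
  unfolding law_def by (rule prob_space_distr) measurable

sublocale BS: bernoulli_shift law
proof -
  interpret L: prob_space law by (rule prob_space_law)
  interpret product_prob_space "\<lambda>_::nat. law" UNIV ..
  show "bernoulli_shift law" by unfold_locales simp
qed

lemma sets_path_space: "sets BS.S = sets (Pi\<^sub>M UNIV (\<lambda>_. borel))"
  by (rule sets_PiM_cong) auto

definition past :: "int \<Rightarrow> 'a \<Rightarrow> nat \<Rightarrow> real" where
  "past k \<omega> = (\<lambda>i. \<epsilon> (k - int i) \<omega>)"

text \<open>Through this identity every \<open>X k\<close> with \<open>k \<le> n\<close> becomes a
  function of the single path \<open>past n\<close>.\<close>

lemma shift_past: "BS.shift i (past k \<omega>) = past (k - int i) \<omega>"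
  by (simp add: BS.shift_def past_def algebra_simps)

lemma measurable_past [measurable]: "past k \<in> measurable M BS.S"
proof (rule measurable_PiM_single')
  show "(\<lambda>\<omega>. past k \<omega> i) \<in> measurable M law" for i
    by (simp add: past_def measurable_cong_sets[OF refl sets_law])
qed simp

text \<open>Independence and equal marginals make the two-sided sequence a product measure, and an
  injective renumbering of equal factors preserves the product form.\<close>

lemma distr_past: "distr M BS.S (past k) = BS.S"
proof -
  let ?B = "Pi\<^sub>M (UNIV::int set) (\<lambda>_. borel) :: (int \<Rightarrow> real) measure"
  let ?L = "Pi\<^sub>M (UNIV::int set) (\<lambda>_. law)"
  have sets: "sets ?B = sets ?L" by (rule sets_PiM_cong) auto
  have "(\<lambda>i. distr M borel (\<epsilon> i)) = (\<lambda>_. law)"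
    unfolding law_def by (rule ext) (rule ident)
  then have eq: "distr M ?B (\<lambda>\<omega> i. \<epsilon> i \<omega>) = ?L"
    using indep indep_vars_iff_distr_eq_PiM[of UNIV \<epsilon> "\<lambda>_. borel"] by (simp add: restrict_UNIV)
  have m1: "(\<lambda>\<omega> i. \<epsilon> i \<omega>) \<in> measurable M ?B"
    by (rule measurable_PiM_single') auto
  have m2: "(\<lambda>z i. z (k - int i)) \<in> measurable ?B BS.S"
    by (rule measurable_PiM_single') (auto intro!: measurable_component_singleton simp: measurable_cong_sets[OF refl sets_law])
  have "distr M BS.S (past k) = distr (distr M ?B (\<lambda>\<omega> i. \<epsilon> i \<omega>)) BS.S (\<lambda>z i. z (k - int i))"
    by (simp add: distr_distr[OF m2 m1] comp_def past_def[abs_def])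
  also have "\<dots> = distr ?L (\<Pi>\<^sub>M i\<in>(UNIV::nat set). law) (\<lambda>z. \<lambda>i\<in>UNIV. z (k - int i))"
    by (simp add: eq restrict_UNIV)
  also have "\<dots> = (\<Pi>\<^sub>M i\<in>(UNIV::nat set). law)"
    by (rule distr_PiM_reindex[of UNIV "\<lambda>_. law" "\<lambda>i. k - int i"]) (auto intro: prob_space_law simp: inj_on_def)
  finally show ?thesis .
qed

lemma integral_past:
  fixes h :: "_ \<Rightarrow> _::{banach, second_countable_topology}"
  assumes "h \<in> borel_measurable BS.S"
  shows "(\<integral>\<omega>. h (past k \<omega>) \<partial>M) = (\<integral>x. h x \<partial>BS.S)"
  using integral_distr[OF measurable_past assms, of k] by (simp add: distr_past)

lemma rv_norm_past:
  "h \<in> borel_measurable BS.S \<Longrightarrow> rv_norm M (\<lambda>\<omega>. h (past k \<omega>)) = rv_norm BS.S h"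
  using rv_norm_distr[OF measurable_past, of h k] by (simp add: distr_past)

lemma square_integrable_past:
  "h \<in> square_integrable BS.S \<Longrightarrow> (\<lambda>\<omega>. h (past k \<omega>)) \<in> square_integrable M"
  by (rule square_integrable_distr[OF measurable_past]) (simp add: distr_past)

lemma space_past_algebra [simp]: "space (past_algebra M \<epsilon> k) = space M"
  unfolding past_algebra_def by (rule space_measure_of) auto

lemma sets_past_algebra_generator:
  "sets (past_algebra M \<epsilon> k) = sigma_sets (space M) {\<epsilon> i -` A \<inter> space M |i A. i \<le> k \<and> A \<in> sets borel}"
  unfolding past_algebra_def by (rule sets_measure_of) auto

lemma measurable_past_algebra: "past k \<in> measurable (past_algebra M \<epsilon> k) BS.S"
proof (rule measurable_PiM_single')
  fix i :: nat
  have "\<epsilon> (k - int i) \<in> measurable (past_algebra M \<epsilon> k) borel"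
    by (rule measurableI) (auto simp: sets_past_algebra_generator intro!: sigma_sets.Basic exI[of _ "k - int i"])
  then show "(\<lambda>\<omega>. past k \<omega> i) \<in> measurable (past_algebra M \<epsilon> k) law"
    by (simp add: past_def measurable_cong_sets[OF refl sets_law])
qed simp

text \<open>The generators are preimages of coordinate events under \<open>past k\<close>, so the
  whole past algebra is. This turns test events for conditional expectations into indicators on path
  space.\<close>

lemma sets_past_algebra:
  assumes "A \<in> sets (past_algebra M \<epsilon> k)"
  obtains B where "B \<in> sets BS.S" "A = past k -` B \<inter> space M"
proof -
  have "sets (past_algebra M \<epsilon> k) \<subseteq> sets (vimage_algebra (space M) (past k) BS.S)"
    unfolding sets_past_algebra_generator
  proof (rule sets.sigma_sets_subset', safe)
    fix i :: int and A :: "real set" assume i: "i \<le> k" and A: "A \<in> sets borel"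
    have "(\<lambda>x. x (nat (k - i))) \<in> measurable BS.S borel"
      using BS.measurable_component_S by (simp add: measurable_cong_sets[OF refl sets_law])
    then have "(\<lambda>x. x (nat (k - i))) -` A \<inter> space BS.S \<in> sets BS.S"
      using A by (rule measurable_sets)
    then have "past k -` ((\<lambda>x. x (nat (k - i))) -` A \<inter> space BS.S) \<inter> space M
        \<in> sets (vimage_algebra (space M) (past k) BS.S)"
      by (rule in_vimage_algebra)
    moreover have "past k -` ((\<lambda>x. x (nat (k - i))) -` A \<inter> space BS.S) \<inter> space M = \<epsilon> i -` A \<inter> space M"
      using i by (auto simp: past_def BS.space_S)
    ultimately show "\<epsilon> i -` A \<inter> space M \<in> sets (vimage_algebra (space M) (past k) BS.S)" by simp
  next
    show "space M \<in> sets (vimage_algebra (space M) (past k) BS.S)"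
      using sets.top[of "vimage_algebra (space M) (past k) BS.S"] by simp
  qed
  with assms have "A \<in> sets (vimage_algebra (space M) (past k) BS.S)" by auto
  then show ?thesis
    using that by (auto simp: sets_vimage_algebra2 BS.space_S)
qed

lemma subalgebra_past_algebra: "subalgebra M (past_algebra M \<epsilon> k)"
  unfolding subalgebra_def using measurable_sets[OF measurable_past]
  by (auto elim: sets_past_algebra)

text \<open>An event of the past is the preimage of some \<open>B\<close> under
  \<open>past k\<close>, and \<open>past k\<close> is \<open>past (k + l)\<close> shifted by
  \<open>l\<close>. The defining identity of the conditional expectation then becomes
  \<open>BS.avg_pow_adjoint\<close> for \<open>indicator B\<close>.\<close>

lemma cond_exp_past:
  assumes h: "h \<in> square_integrable BS.S"
  shows "AE \<omega> in M. real_cond_exp M (past_algebra M \<epsilon> k) (\<lambda>\<omega>. h (past (k + int l) \<omega>)) \<omega>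
    = (BS.avg ^^ l) h (past k \<omega>)"
proof -
  interpret F: finite_measure_subalgebra M "past_algebra M \<epsilon> k"
    by unfold_locales (rule subalgebra_past_algebra)
  have ah: "(BS.avg ^^ l) h \<in> square_integrable BS.S" by (rule BS.square_integrable_avg_pow[OF h])
  have [measurable]: "h \<in> borel_measurable BS.S" "(BS.avg ^^ l) h \<in> borel_measurable BS.S"
    using h ah by (auto intro: square_integrable_measurable)
  show ?thesis
  proof (rule F.real_cond_exp_charact)
    fix A assume "A \<in> sets (past_algebra M \<epsilon> k)"
    then obtain B where [measurable]: "B \<in> sets BS.S" and A: "A = past k -` B \<inter> space M"
      by (rule sets_past_algebra)
    have B: "indicator B \<in> square_integrable BS.S"
      by (rule BS.P.square_integrable_bounded[of _ 1]) (auto simp: indicator_def)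
    have past: "past k \<omega> = BS.shift l (past (k + int l) \<omega>)" for \<omega> by (simp add: shift_past)
    have "(\<integral>\<omega>\<in>A. h (past (k + int l) \<omega>) \<partial>M)
        = (\<integral>\<omega>. h (past (k + int l) \<omega>) * indicator B (BS.shift l (past (k + int l) \<omega>)) \<partial>M)"
      unfolding set_lebesgue_integral_def past[symmetric]
      by (intro Bochner_Integration.integral_cong) (auto simp: A indicator_def)
    also have "\<dots> = (\<integral>x. h x * indicator B (BS.shift l x) \<partial>BS.S)"
      by (rule integral_past) measurable
    also have "\<dots> = (\<integral>x. (BS.avg ^^ l) h x * indicator B x \<partial>BS.S)"
      by (rule BS.avg_pow_adjoint[OF h B])
    also have "\<dots> = (\<integral>\<omega>. (BS.avg ^^ l) h (past k \<omega>) * indicator B (past k \<omega>) \<partial>M)"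
      by (rule integral_past[symmetric]) measurable
    also have "\<dots> = (\<integral>\<omega>\<in>A. (BS.avg ^^ l) h (past k \<omega>) \<partial>M)"
      unfolding set_lebesgue_integral_def
      by (intro Bochner_Integration.integral_cong) (auto simp: A indicator_def)
    finally show "(\<integral>\<omega>\<in>A. h (past (k + int l) \<omega>) \<partial>M) = (\<integral>\<omega>\<in>A. (BS.avg ^^ l) h (past k \<omega>) \<partial>M)" .
  next
    show "integrable M (\<lambda>\<omega>. h (past (k + int l) \<omega>))" "integrable M (\<lambda>\<omega>. (BS.avg ^^ l) h (past k \<omega>))"
      by (intro square_integrable_integrable square_integrable_past h ah)+
    show "(\<lambda>\<omega>. (BS.avg ^^ l) h (past k \<omega>)) \<in> borel_measurable (past_algebra M \<epsilon> k)"
      by (rule measurable_compose[OF measurable_past_algebra]) measurable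
  qed
qed

lemma rv_norm_proj_op:
  assumes G: "G \<in> square_integrable BS.S"
  shows "rv_norm M (proj_op M \<epsilon> 0 (\<lambda>\<omega>. G (past (int l) \<omega>))) = rv_norm BS.S (BS.innov G l)"
proof -
  let ?X = "\<lambda>\<omega>. G (past (int l) \<omega>)"
  have [measurable]: "BS.innov G l \<in> borel_measurable BS.S"
    by (rule square_integrable_measurable[OF BS.square_integrable_innov[OF G]])
  have "AE \<omega> in M. real_cond_exp M (past_algebra M \<epsilon> 0) ?X \<omega> = (BS.avg ^^ l) G (past 0 \<omega>)"
    using cond_exp_past[OF G, of 0 l] by simp
  \<comment> \<open>Time \<open>-1\<close> lies \<open>Suc l\<close> steps before time
    \<open>l\<close>, and \<open>past (-1)\<close> is \<open>past 0\<close> shifted once.\<close>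
  moreover have "AE \<omega> in M. real_cond_exp M (past_algebra M \<epsilon> (0 - 1)) ?X \<omega>
      = (BS.avg ^^ Suc l) G (BS.shift 1 (past 0 \<omega>))"
    using cond_exp_past[OF G, of "-1" "Suc l"] by (simp add: shift_past)
  ultimately have "AE \<omega> in M. proj_op M \<epsilon> 0 ?X \<omega> = BS.innov G l (past 0 \<omega>)"
    by eventually_elim (simp add: proj_op_def BS.innov_def)
  then have "AE \<omega> in M. \<bar>proj_op M \<epsilon> 0 ?X \<omega>\<bar>\<^sup>2 = \<bar>BS.innov G l (past 0 \<omega>)\<bar>\<^sup>2"
    by eventually_elim simp
  moreover have [measurable]: "proj_op M \<epsilon> 0 ?X \<in> borel_measurable M"
    unfolding proj_op_def by measurable
  ultimately have "rv_norm M (proj_op M \<epsilon> 0 ?X) = rv_norm M (\<lambda>\<omega>. BS.innov G l (past 0 \<omega>))"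
    unfolding rv_norm_def by (subst integral_cong_AE) auto
  also have "\<dots> = rv_norm BS.S (BS.innov G l)" by (rule rv_norm_past) measurable
  finally show ?thesis .
qed

text \<open>With \<open>m = max k l\<close>, both factors are functions of
  \<open>past (m + d)\<close>, whose law is the same for every \<open>d\<close>.\<close>

lemma process_stationary:
  fixes G :: "(nat \<Rightarrow> real) \<Rightarrow> real"
  assumes [measurable]: "G \<in> borel_measurable BS.S"
  shows "(\<integral>\<omega>. G (past (k + d) \<omega>) * G (past (l + d) \<omega>) \<partial>M) = (\<integral>\<omega>. G (past k \<omega>) * G (past l \<omega>) \<partial>M)"
proof -
  define m where "m = max k l"
  define H where "H x = G (BS.shift (nat (m - k)) x) * G (BS.shift (nat (m - l)) x)" for x
  have [measurable]: "H \<in> borel_measurable BS.S" unfolding H_def[abs_def] by measurable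
  have H: "H (past (m + e) \<omega>) = G (past (k + e) \<omega>) * G (past (l + e) \<omega>)" for e \<omega>
    by (simp add: H_def shift_past m_def algebra_simps)
  have "(\<integral>\<omega>. H (past (m + d) \<omega>) \<partial>M) = (\<integral>\<omega>. H (past (m + 0) \<omega>) \<partial>M)"
    by (simp add: integral_past)
  then show ?thesis unfolding H by simp
qed

text \<open>Time reversal \<open>k = n - i\<close>, under which \<open>1..n\<close> corresponds to
  \<open>0..n - 1\<close>.\<close>

lemma weighted_sum_past:
  "(\<Sum>k=1..n. a (int k) * G (past (int k) \<omega>))
    = (\<Sum>i<n. a (int n - int i) * G (BS.shift i (past (int n) \<omega>)))"
  unfolding shift_past
  by (rule sum.reindex_bij_witness[where i = "\<lambda>i. n - i" and j = "\<lambda>k. n - k"]) (auto simp: of_nat_diff)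

lemma rv_norm_weighted_sum:
  assumes G: "G \<in> square_integrable BS.S"
  shows "(rv_norm M (\<lambda>\<omega>. \<Sum>k=1..n. a (int k) * G (past (int k) \<omega>)))\<^sup>2
    = (\<Sum>k=1..n. \<Sum>l=1..n. a (int k) * a (int l) * autocov M (\<lambda>k \<omega>. G (past k \<omega>)) (int l - int k))"
proof -
  have i: "integrable M (\<lambda>\<omega>. G (past k \<omega>) * G (past l \<omega>))" for k l
    by (intro square_integrable_mult square_integrable_past G)
  have cov: "(\<integral>\<omega>. G (past k \<omega>) * G (past l \<omega>) \<partial>M) = autocov M (\<lambda>k \<omega>. G (past k \<omega>)) (l - k)" for k l
    using process_stationary[OF square_integrable_measurable[OF G], of 0 k "l - k"] by (simp add: autocov_def)
  have "(rv_norm M (\<lambda>\<omega>. \<Sum>k=1..n. a (int k) * G (past (int k) \<omega>)))\<^sup>2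
      = (\<integral>\<omega>. (\<Sum>k=1..n. \<Sum>l=1..n. a (int k) * a (int l) * (G (past (int k) \<omega>) * G (past (int l) \<omega>))) \<partial>M)"
    unfolding rv_norm_square by (simp add: power2_eq_square sum_product mult_ac)
  also have "\<dots> = (\<Sum>k=1..n. \<Sum>l=1..n. a (int k) * a (int l) * (\<integral>\<omega>. G (past (int k) \<omega>) * G (past (int l) \<omega>) \<partial>M))"
    using i by (simp add: Bochner_Integration.integral_sum)
  finally show ?thesis unfolding cov .
qed

lemma autocov_even:
  assumes G: "G \<in> borel_measurable BS.S"
  shows "autocov M (\<lambda>k \<omega>. G (past k \<omega>)) (- h) = autocov M (\<lambda>k \<omega>. G (past k \<omega>)) h"
  using process_stationary[OF G, of 0 h "- h"] by (simp add: autocov_def mult.commute)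

end

section \<open>The spectral density as a cosine series\<close>

lemma spectral_density_cos_series:
  assumes "autocov M X summable_on UNIV"
  shows "spectral_density M X \<theta> = cos_series (autocov M X) \<theta> / (2 * pi)"
proof -
  let ?z = "\<lambda>k. complex_of_real (autocov M X k) * exp (\<i> * of_int k * of_real \<theta>)"
  have exp: "exp (\<i> * of_int k * of_real \<theta>) = cis (of_int k * \<theta>)" for k
    by (simp add: cis_conv_exp mult.assoc)
  have "(\<lambda>k. norm (autocov M X k)) summable_on UNIV"
    using assms by (rule summable_on_iff_abs_summable_on_real[THEN iffD1])
  then have "(\<lambda>k. norm (?z k)) summable_on UNIV"
    by (simp add: norm_mult exp)
  then have "?z summable_on UNIV" by (rule Infinite_Sum.abs_summable_summable)
  then have "Re (\<Sum>\<^sub>\<infinity>k. ?z k) = (\<Sum>\<^sub>\<infinity>k. Re (?z k))" by (rule infsum_Re[symmetric])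
  also have "\<dots> = cos_series (autocov M X) \<theta>"
    by (simp add: cos_series_def exp)
  finally have "Re (\<Sum>\<^sub>\<infinity>k. ?z k) = cos_series (autocov M X) \<theta>" .
  moreover have "spectral_density M X \<theta> = Re (complex_of_real (1 / (2 * pi)) * (\<Sum>\<^sub>\<infinity>k. ?z k))"
    by (simp add: spectral_density_def)
  moreover have "Re (complex_of_real a * z) = a * Re z" for a z by simp
  ultimately show ?thesis by simp
qed

text \<open>If the covariances were not summable, the infinite sum defining the spectral density
  would be \<open>0\<close> for every frequency.\<close>

lemma autocov_summable:
  assumes "0 < (INF \<theta>. spectral_density M X \<theta>)"
  shows "autocov M X summable_on UNIV"
proof (rule ccontr)
  assume not: "\<not> autocov M X summable_on UNIV"
  have "spectral_density M X \<theta> = 0" for \<theta>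
  proof -
    let ?z = "\<lambda>k. complex_of_real (autocov M X k) * exp (\<i> * of_int k * of_real \<theta>)"
    have "norm (exp (\<i> * of_int k * of_real \<theta>)) = 1" for k
      by (simp add: norm_exp_eq_Re)
    then have "norm (?z k) = norm (autocov M X k)" for k by (simp add: norm_mult)
    then have "\<not> ?z summable_on UNIV"
      using not unfolding summable_on_iff_abs_summable_on_complex summable_on_iff_abs_summable_on_real[of "autocov M X"]
      by simp
    then show ?thesis by (simp add: spectral_density_def infsum_not_exists)
  qed
  with assms show False by simp
qed

text \<open>A real infimum is a lower bound only of a set bounded below; the bound comes from the
  absolutely summable covariances.\<close>

lemma spectral_density_ge_INF:
  assumes "0 < (INF \<theta>. spectral_density M X \<theta>)"
  shows "(INF \<theta>. spectral_density M X \<theta>) \<le> spectral_density M X \<theta>"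
proof (rule cINF_lower)
  let ?r = "autocov M X"
  have r: "?r summable_on UNIV" by (rule autocov_summable[OF assms])
  have "- (\<Sum>\<^sub>\<infinity>k. \<bar>?r k\<bar>) / (2 * pi) \<le> spectral_density M X \<theta>" for \<theta>
  proof -
    have "(\<lambda>k. norm (?r k * cos (of_int k * \<theta>))) summable_on UNIV"
      by (rule summable_on_mult_bounded[OF r, of _ 1]) simp
    then have "\<bar>cos_series ?r \<theta>\<bar> \<le> (\<Sum>\<^sub>\<infinity>k. norm (?r k * cos (of_int k * \<theta>)))"
      unfolding cos_series_def using norm_infsum_bound by fastforce
    also have "\<dots> \<le> (\<Sum>\<^sub>\<infinity>k. \<bar>?r k\<bar>)"
    proof (rule infsum_mono)
      show "(\<lambda>k. norm (?r k * cos (of_int k * \<theta>))) summable_on UNIV" by fact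
      show "(\<lambda>k. \<bar>?r k\<bar>) summable_on UNIV"
        using summable_on_iff_abs_summable_on_real[THEN iffD1, OF r] by simp
      show "norm (?r k * cos (of_int k * \<theta>)) \<le> \<bar>?r k\<bar>" for k
        using mult_left_mono[OF abs_cos_le_one, of "\<bar>?r k\<bar>"] by (simp add: abs_mult)
    qed
    finally have "- (\<Sum>\<^sub>\<infinity>k. \<bar>?r k\<bar>) \<le> cos_series ?r \<theta>" by linarith
    then show ?thesis
      unfolding spectral_density_cos_series[OF r] by (intro divide_right_mono) auto
  qed
  then show "bdd_below (range (spectral_density M X))" by (rule bdd_belowI2)
qed simp

section \<open>Uniform convergence of distribution functions\<close>

text \<open>The finite grid in Polya's theorem, independent of \<open>N\<close>. Between
  neighbouring grid points the limit changes by less than \<open>e\<close>, and beyond the outer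
  ones it is within \<open>e\<close> of 0 or 1; monotonicity of both functions adds at most the
  error \<open>e\<close> at a grid point.\<close>

lemma (in real_distribution) cdf_grid:
  assumes cont: "\<And>x. isCont (cdf M) x" and "0 < e"
  shows "\<exists>K. finite K \<and> (\<forall>N. real_distribution N \<longrightarrow> (\<forall>x\<in>K. \<bar>cdf N x - cdf M x\<bar> < e) \<longrightarrow>
    (\<forall>x. \<bar>cdf N x - cdf M x\<bar> \<le> 2 * e))"
proof -
  let ?F = "cdf M"
  obtain A1 where A1: "\<And>x. x \<ge> A1 \<Longrightarrow> 1 - e < ?F x"
    using order_tendstoD(1)[OF cdf_lim_at_top_prob, of "1 - e"] \<open>0 < e\<close> by (auto simp: eventually_at_top_linorder)
  obtain A2 where A2: "\<And>x. x \<le> A2 \<Longrightarrow> ?F x < e"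
    using order_tendstoD(2)[OF cdf_lim_at_bot, of e] \<open>0 < e\<close> by (auto simp: eventually_at_bot_linorder)
  define A where "A = max \<bar>A1\<bar> \<bar>A2\<bar> + 1"
  have A: "0 < A" "1 - e < ?F A" "?F (- A) < e" by (auto simp: A_def intro!: A1 A2)
  have "uniformly_continuous_on {- A..A} ?F"
    using cont by (intro compact_uniformly_continuous continuous_at_imp_continuous_on) auto
  then obtain d where d: "0 < d" "\<And>x y. x \<in> {- A..A} \<Longrightarrow> y \<in> {- A..A} \<Longrightarrow> \<bar>y - x\<bar> < d \<Longrightarrow> \<bar>?F y - ?F x\<bar> < e"
    using \<open>0 < e\<close> unfolding uniformly_continuous_on_def dist_real_def by metis
  \<comment> \<open>So many cells that the mesh \<open>2 * A / m\<close> is below the modulus of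
    continuity \<open>d\<close>.\<close>
  obtain m :: nat where m: "2 * A / d < m" using reals_Archimedean2 by blast
  then have "0 < real m" using A(1) d(1) by (intro le_less_trans[OF _ m]) auto
  define s where "s = 2 * A / m"
  have s: "0 < s" "s < d" "real m * s = 2 * A"
    using A(1) \<open>0 < real m\<close> m d(1) by (auto simp: s_def field_simps)
  define t where "t i = - A + real i * s" for i
  show ?thesis
  proof (intro exI[of _ "t ` {..m}"] conjI allI impI)
    fix N :: "real measure" and x :: real
    assume N: "real_distribution N" and K: "\<forall>x\<in>t ` {..m}. \<bar>cdf N x - ?F x\<bar> < e"
    interpret N: real_distribution N by (rule N)
    have t: "\<bar>cdf N (t i) - ?F (t i)\<bar> < e" if "i \<le> m" for i using K that by auto
    have t0: "t 0 = - A" and tm: "t m = A" using s(3) by (auto simp: t_def)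
    consider "x \<le> - A" | "A \<le> x" | "- A < x" "x < A" by linarith
    then show "\<bar>cdf N x - ?F x\<bar> \<le> 2 * e"
    proof cases
      case 1
      have "cdf N x \<le> cdf N (- A)" "?F x \<le> ?F (- A)" using 1 by (auto intro: cdf_nondecreasing N.cdf_nondecreasing)
      moreover have "0 \<le> cdf N x" "0 \<le> ?F x" by (auto intro: cdf_nonneg N.cdf_nonneg)
      ultimately show ?thesis using t[of 0] A(3) by (simp add: t0 abs_le_iff abs_less_iff)
    next
      case 2
      have "cdf N A \<le> cdf N x" "?F A \<le> ?F x" using 2 by (auto intro: cdf_nondecreasing N.cdf_nondecreasing)
      moreover have "cdf N x \<le> 1" "?F x \<le> 1" by (auto intro: cdf_bounded_prob N.cdf_bounded_prob)
      ultimately show ?thesis using t[of m] A(2) by (simp add: tm abs_le_iff abs_less_iff)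
    next
      case 3
      define i where "i = nat \<lfloor>(x + A) / s\<rfloor>"
      have "0 \<le> (x + A) / s" using 3 s(1) by simp
      then have i: "real i \<le> (x + A) / s" "(x + A) / s < real i + 1"
        by (simp_all add: i_def of_nat_floor)
      have ti: "t i \<le> x" "x < t (Suc i)"
        using i s(1) by (auto simp: t_def field_simps)
      have "real i * s < real m * s" using ti(1) 3 s(3) by (simp add: t_def)
      then have im: "Suc i \<le> m" using s(1) by simp
      have "real (Suc i) * s \<le> real m * s" using im s(1) by (intro mult_right_mono) auto
      then have range: "t i \<in> {- A..A}" "t (Suc i) \<in> {- A..A}"
        using s ti 3 by (auto simp: t_def)
      have "\<bar>t (Suc i) - t i\<bar> < d" using s by (simp add: t_def algebra_simps)
      from d(2)[OF range this] have F: "\<bar>?F (t (Suc i)) - ?F (t i)\<bar> < e" .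
      have "cdf N (t i) \<le> cdf N x" "?F (t i) \<le> ?F x" "cdf N x \<le> cdf N (t (Suc i))" "?F x \<le> ?F (t (Suc i))"
        using ti by (auto intro: cdf_nondecreasing N.cdf_nondecreasing)
      then show ?thesis using t[of i] t[OF im] im F by (simp add: abs_le_iff abs_less_iff)
    qed
  qed simp
qed

lemma weak_conv_uniform_cdf:
  assumes "\<And>n. real_distribution (N n)" "real_distribution M" "weak_conv_m N M"
    and cont: "\<And>x. isCont (cdf M) x" and "0 < e"
  shows "\<forall>\<^sub>F n in sequentially. \<forall>x. \<bar>cdf (N n) x - cdf M x\<bar> \<le> e"
proof -
  interpret real_distribution M by fact
  obtain K where K: "finite K" "\<And>N. real_distribution N \<Longrightarrow> \<forall>x\<in>K. \<bar>cdf N x - cdf M x\<bar> < e / 2 \<Longrightarrow>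
      \<forall>x. \<bar>cdf N x - cdf M x\<bar> \<le> 2 * (e / 2)"
    using cdf_grid[OF cont, of "e / 2"] \<open>0 < e\<close> by auto
  have "\<forall>\<^sub>F n in sequentially. \<bar>cdf (N n) x - cdf M x\<bar> < e / 2" for x
  proof -
    have "(\<lambda>n. cdf (N n) x) \<longlonglongrightarrow> cdf M x"
      using assms(3) cont by (simp add: weak_conv_m_def weak_conv_def)
    from tendstoD[OF this, of "e / 2"] \<open>0 < e\<close> show ?thesis by (simp add: dist_real_def)
  qed
  then have "\<forall>\<^sub>F n in sequentially. \<forall>x\<in>K. \<bar>cdf (N n) x - cdf M x\<bar> < e / 2"
    using K(1) by (intro eventually_ball_finite) auto
  then show ?thesis
    by eventually_elim (use K(2)[OF assms(1)] in auto)
qed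

lemma isCont_cdf_std_normal: "isCont (cdf std_normal_distribution) x"
proof -
  interpret real_distribution std_normal_distribution by (rule real_dist_normal_dist)
  have "emeasure std_normal_distribution {x} = 0"
    by (subst emeasure_density) (auto intro!: nn_integral_null_set)
  then show ?thesis by (simp add: isCont_cdf measure_def)
qed

section \<open>The linear combinations of Fourier coefficients\<close>

lemma index_sets_nth:
  assumes "J \<in> index_sets m p"
  shows "inj_on (\<lambda>i. sorted_list_of_set J ! i) {..<p}" "i < p \<Longrightarrow> sorted_list_of_set J ! i \<in> {1..2 * m}"
proof -
  have J: "J \<subseteq> {1..2 * m}" "card J = p" using assms by (auto simp: index_sets_def)
  then have "finite J" by (meson finite_atLeastAtMost finite_subset)
  with J have "length (sorted_list_of_set J) = p" "set (sorted_list_of_set J) = J" by auto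
  with J show "i < p \<Longrightarrow> sorted_list_of_set J ! i \<in> {1..2 * m}" by (metis nth_mem subsetD)
  show "inj_on (\<lambda>i. sorted_list_of_set J ! i) {..<p}"
    using \<open>length (sorted_list_of_set J) = p\<close> by (intro inj_on_nth) auto
qed

lemma index_sets_nonempty: "p \<le> 2 * m \<Longrightarrow> index_sets m p \<noteq> {}"
  unfolding index_sets_def by (auto intro!: exI[of _ "{1..p}"])

lemma euclid_sphere_sum: "c \<in> euclid_sphere p \<Longrightarrow> (\<Sum>i<p. (c i)\<^sup>2) = 1"
  by (simp add: euclid_sphere_def L2_set_def)

lemma euclid_sphere_nonempty:
  assumes "1 \<le> p"
  shows "euclid_sphere p \<noteq> {}"
proof -
  have "(\<Sum>i<p. (if i = 0 then 1 else 0 :: real)\<^sup>2) = (\<Sum>i<p. if i = 0 then 1 else 0)"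
    by (rule sum.cong) auto
  also have "\<dots> = 1" using assms by simp
  finally have "(\<lambda>i\<in>{..<p}. if i = 0 then 1 else 0) \<in> euclid_sphere p"
    by (simp add: euclid_sphere_def L2_set_def)
  then show ?thesis by blast
qed

lemma coeff_vec_trig_weight:
  "(\<Sum>i<p. coeff_vec M X n J i \<omega> * c i)
    = (\<Sum>k=1..n. trig_weight (spectral_density M X) n p (\<lambda>i. sorted_list_of_set J ! i) c (int k) * X (int k) \<omega>)"
proof -
  let ?js = "\<lambda>i. sorted_list_of_set J ! i"
  let ?q = "\<lambda>i. sqrt (pi * n * spectral_density M X (fourier_freq n (trig_freq n (?js i))))"
  have "coeff_vec M X n J i \<omega> * c i = (\<Sum>k=1..n. c i / ?q i * trig n (?js i) (int k) * X (int k) \<omega>)" for i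
  proof -
    have "fourier_coeff M X n j \<omega> = (\<Sum>k=1..n. X (int k) \<omega> * trig n j (int k))
        / sqrt (pi * n * spectral_density M X (fourier_freq n (trig_freq n j)))" for j
      by (simp add: fourier_coeff_def Let_def trig_def trig_freq_def trig_phase_def cos_diff)
    then show ?thesis
      by (simp add: coeff_vec_def sum_distrib_left sum_divide_distrib sum_distrib_right mult_ac)
  qed
  then have "(\<Sum>i<p. coeff_vec M X n J i \<omega> * c i)
      = (\<Sum>i<p. \<Sum>k=1..n. c i / ?q i * trig n (?js i) (int k) * X (int k) \<omega>)" by simp
  also have "\<dots> = (\<Sum>k=1..n. \<Sum>i<p. c i / ?q i * trig n (?js i) (int k) * X (int k) \<omega>)"
    by (rule sum.swap)
  finally show ?thesis by (simp add: trig_weight_def sum_distrib_right)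
qed

context iid_innovations
begin

text \<open>Stated along arbitrary sequences of indices and unit vectors, so that worst choices can
  be inserted. The condition on \<open>js\<close> is only eventual, since for small \<open>n\<close>
  there are fewer than \<open>p\<close> indices.\<close>

lemma trig_sum_weak_conv:
  fixes js :: "nat \<Rightarrow> nat \<Rightarrow> nat" and c :: "nat \<Rightarrow> nat \<Rightarrow> real" and G :: "(nat \<Rightarrow> real) \<Rightarrow> real"
  defines "X \<equiv> causal_process \<epsilon> G"
  assumes G: "G \<in> borel_measurable (Pi\<^sub>M UNIV (\<lambda>_. borel))"
    and sq: "integrable M (\<lambda>\<omega>. \<bar>X 0 \<omega>\<bar>\<^sup>2)" and mean: "(\<integral>\<omega>. X 0 \<omega> \<partial>M) = 0"
    and sm: "summable (\<lambda>k::nat. rv_norm M (proj_op M \<epsilon> 0 (X (int k))))"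
    and pos: "0 < (INF \<theta>. spectral_density M X \<theta>)"
    and js: "\<forall>\<^sub>F n in sequentially. inj_on (js n) {..<p} \<and> (\<forall>i<p. js n i \<in> {1..2 * num_freq n})"
    and c: "\<And>n. (\<Sum>i<p. (c n i)\<^sup>2) = 1"
  defines "Z \<equiv> \<lambda>n \<omega>. \<Sum>k=1..n. trig_weight (spectral_density M X) n p (js n) (c n) (int k) * X (int k) \<omega>"
  shows "\<And>n. Z n \<in> borel_measurable M"
    and "weak_conv_m (\<lambda>n. distr M borel (Z n)) std_normal_distribution"
proof -
  have G' [measurable]: "G \<in> borel_measurable BS.S"
    using G by (simp add: measurable_cong_sets[OF sets_path_space refl])
  have X: "X = (\<lambda>k \<omega>. G (past k \<omega>))"
    by (simp add: X_def causal_process_def past_def fun_eq_iff)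
  have GL: "G \<in> square_integrable BS.S"
  proof -
    have "integrable (distr M BS.S (past 0)) (\<lambda>x. (G x)\<^sup>2)"
      using sq by (subst integrable_distr_eq) (auto simp: X)
    then show ?thesis by (simp add: distr_past square_integrable_def)
  qed
  have G0: "(\<integral>x. G x \<partial>BS.S) = 0"
    using mean integral_past[OF G', of 0] by (simp add: X)
  have sm': "summable (\<lambda>l. rv_norm BS.S (BS.innov G l))"
    using sm by (simp add: X rv_norm_proj_op[OF GL])
  define f where "f = spectral_density M X"
  define f0 where "f0 = (INF \<theta>. f \<theta>)"
  have f0: "f0 \<le> f \<theta>" "0 < f0" for \<theta>
    using spectral_density_ge_INF[OF pos] pos by (auto simp: f_def f0_def)
  define r where "r = autocov M X"
  have r: "r summable_on UNIV" unfolding r_def by (rule autocov_summable[OF pos])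
  have f: "f \<theta> = cos_series r \<theta> / (2 * pi)" for \<theta>
    unfolding f_def r_def by (rule spectral_density_cos_series[OF r[unfolded r_def]])
  have even: "r (- h) = r h" for h
    unfolding r_def X by (rule autocov_even[OF G'])
  define a where "a n = trig_weight f n p (js n) (c n)" for n
  define b where "b n i = a n (int n - int i)" for n i
  have Z: "Z n \<omega> = (\<Sum>i<n. b n i * G (BS.shift i (past (int n) \<omega>)))" for n \<omega>
    using weighted_sum_past[where a = "a n" and G = G and n = n and \<omega> = \<omega>]
    by (simp add: Z_def f_def a_def b_def X)
  define T where "T n x = (\<Sum>i<n. b n i * G (BS.shift i x))" for n x
  have T: "T n \<in> square_integrable BS.S" for n
    unfolding T_def[abs_def] by (rule BS.square_integrable_shift_sum[OF GL])
  have [measurable]: "T n \<in> borel_measurable BS.S" for n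
    by (rule square_integrable_measurable[OF T])
  have ZT: "Z n = (\<lambda>\<omega>. T n (past (int n) \<omega>))" for n by (simp add: fun_eq_iff Z T_def)
  show Zm: "Z n \<in> borel_measurable M" for n unfolding ZT by measurable
  \<comment> \<open>The variance is computed on \<open>M\<close>, where it is a Toeplitz form in the
    covariances, and carried to path space by the law of \<open>past n\<close>.\<close>
  have "(\<lambda>n. (rv_norm BS.S (T n))\<^sup>2) \<longlonglongrightarrow> 1"
  proof -
    have "(rv_norm BS.S (T n))\<^sup>2 = (\<Sum>k=1..n. \<Sum>l=1..n. a n (int k) * a n (int l) * r (int l - int k))" for n
    proof -
      have "rv_norm BS.S (T n) = rv_norm M (Z n)"
        unfolding ZT by (rule rv_norm_past[symmetric]) measurable
      also have "Z n = (\<lambda>\<omega>. \<Sum>k=1..n. a n (int k) * G (past (int k) \<omega>))"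
        by (simp add: Z_def X a_def f_def fun_eq_iff)
      finally show ?thesis by (simp only: rv_norm_weighted_sum[OF GL]) (simp add: r_def X)
    qed
    then show ?thesis
      using trig_weight_variance_tendsto[OF r even f f0 js c] by (simp add: a_def)
  qed
  then have "(\<lambda>n. sqrt ((rv_norm BS.S (T n))\<^sup>2)) \<longlonglongrightarrow> sqrt 1" by (rule tendsto_real_sqrt)
  then have var: "(\<lambda>n. rv_norm BS.S (T n)) \<longlonglongrightarrow> 1" by (simp add: rv_norm_nonneg)
  have c1: "\<bar>c n i\<bar> \<le> 1" if "i < p" for n i
  proof -
    have "(c n i)\<^sup>2 \<le> (\<Sum>i<p. (c n i)\<^sup>2)" by (rule member_le_sum) (use that in auto)
    then show ?thesis using c[of n] by (simp add: abs_square_le_1)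
  qed
  have char_T: "(\<lambda>n. CLINT x|BS.S. iexp (t * T n x)) \<longlonglongrightarrow> exp (- t\<^sup>2 / 2)" for t
    unfolding T_def
  proof (rule BS.weighted_sum_char_tendsto[OF GL G0 sm'])
    show "\<bar>b n i\<bar> \<le> (p / sqrt (pi * f0)) / sqrt n" for n i
      unfolding b_def a_def by (rule trig_weight_bound[OF f0 c1])
    show "0 \<le> p / sqrt (pi * f0)" using f0 by simp
  qed (rule var[unfolded T_def[abs_def]])
  show "weak_conv_m (\<lambda>n. distr M borel (Z n)) std_normal_distribution"
  proof (rule levy_continuity)
    show "real_distribution (distr M borel (Z n))" for n
      by (rule real_distribution_distr[OF Zm])
    show "real_distribution std_normal_distribution" by (rule real_dist_normal_dist)
    fix t
    have "char (distr M borel (Z n)) t = (CLINT x|BS.S. iexp (t * T n x))" for n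
    proof -
      have "char (distr M borel (Z n)) t = (CLINT \<omega>|M. iexp (t * Z n \<omega>))"
        unfolding char_def by (rule integral_distr[OF Zm]) measurable
      also have "\<dots> = (CLINT x|BS.S. iexp (t * T n x))"
        unfolding ZT by (rule integral_past) measurable
      finally show ?thesis .
    qed
    then show "(\<lambda>n. char (distr M borel (Z n)) t) \<longlonglongrightarrow> char std_normal_distribution t"
      using char_T[of t] by (simp add: char_std_normal_distribution)
  qed
qed

end

text \<open>A real supremum is meaningful only for nonempty sets bounded above, so each of the three
  nested suprema needs both facts.\<close>

lemma SUP_nonneg_le:
  fixes f :: "'i \<Rightarrow> real"
  assumes "A \<noteq> {}" "\<And>x. x \<in> A \<Longrightarrow> 0 \<le> f x" "\<And>x. x \<in> A \<Longrightarrow> f x \<le> e"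
  shows "0 \<le> (SUP x\<in>A. f x)" "(SUP x\<in>A. f x) \<le> e"
proof -
  obtain a where "a \<in> A" using assms(1) by blast
  then show "0 \<le> (SUP x\<in>A. f x)"
    using assms(2,3) by (intro cSUP_upper2[where x = a] bdd_aboveI2[where M = e]) auto
  show "(SUP x\<in>A. f x) \<le> e" using assms by (intro cSUP_least)
qed

theorem theorem2p1:
  fixes M :: "'a measure"
    and \<epsilon> :: "int \<Rightarrow> 'a \<Rightarrow> real"
    and G :: "(nat \<Rightarrow> real) \<Rightarrow> real"
    and X :: "int \<Rightarrow> 'a \<Rightarrow> real"
    and p :: nat
  assumes "prob_space M"
    and "prob_space.indep_vars M (\<lambda>_. borel) \<epsilon> UNIV"
    and "\<And>k. distr M borel (\<epsilon> k) = distr M borel (\<epsilon> 0)"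
    and "G \<in> borel_measurable (Pi\<^sub>M UNIV (\<lambda>_. borel))"
    and "X = causal_process \<epsilon> G"
    and "\<And>k. integrable M (\<lambda>\<omega>. \<bar>X k \<omega>\<bar>\<^sup>2)"
    and "\<And>k. (\<integral>\<omega>. X k \<omega> \<partial>M) = 0"
    and "summable (\<lambda>k::nat. rv_norm M (proj_op M \<epsilon> 0 (X (int k))))"
    and "(INF \<theta>. spectral_density M X \<theta>) > 0"
    and "p \<ge> 1"
  shows "(\<lambda>n. SUP J\<in>index_sets (num_freq n) p. SUP c\<in>euclid_sphere p. SUP x::real.
           \<bar>measure M {\<omega> \<in> space M. (\<Sum>i<p. coeff_vec M X n J i \<omega> * c i) \<le> x}
             - cdf std_normal_distribution x\<bar>) \<longlonglongrightarrow> 0"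
proof -
  interpret iid_innovations M \<epsilon>
    using assms(1-3) by (intro iid_innovations.intro iid_innovations_axioms.intro) auto
  define \<Delta> where "\<Delta> n J c x = \<bar>measure M {\<omega> \<in> space M. (\<Sum>i<p. coeff_vec M X n J i \<omega> * c i) \<le> x}
      - cdf std_normal_distribution x\<bar>" for n J c x
  have \<Delta>_nonneg: "0 \<le> \<Delta> n J c x" for n J c x by (simp add: \<Delta>_def)
  obtain c0 where c0: "c0 \<in> euclid_sphere p" using euclid_sphere_nonempty[OF \<open>p \<ge> 1\<close>] by blast
  \<comment> \<open>For \<open>n \<ge> p + 2\<close> one has
    \<open>2 * num_freq n \<ge> n - 2 \<ge> p\<close>.\<close>
  have J0: "\<forall>\<^sub>F n in sequentially. index_sets (num_freq n) p \<noteq> {}"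
    using eventually_ge_at_top[of "p + 2"]
    by eventually_elim (auto intro!: index_sets_nonempty simp: num_freq_def)
  have small: "\<forall>\<^sub>F n in sequentially. \<forall>J\<in>index_sets (num_freq n) p. \<forall>c\<in>euclid_sphere p. \<forall>x. \<Delta> n J c x \<le> e"
    if "0 < e" for e
  proof -
    define bad where "bad n Jc \<longleftrightarrow> (\<exists>x. e < \<Delta> n (fst Jc) (snd Jc) x)" for n Jc
    define good where "good n = index_sets (num_freq n) p \<times> euclid_sphere p" for n
    text \<open>A worst pair, or any admissible one, so that the limit theorem is needed only along
      one sequence of pairs.\<close>
    have "\<exists>Jc. snd Jc \<in> euclid_sphere p \<and> (good n \<noteq> {} \<longrightarrow> Jc \<in> good n) \<and>
        ((\<exists>Jc\<in>good n. bad n Jc) \<longrightarrow> bad n Jc)" for n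
    proof (cases "\<exists>Jc\<in>good n. bad n Jc")
      case True
      then obtain Jc where "Jc \<in> good n" "bad n Jc" by blast
      then show ?thesis by (intro exI[of _ Jc]) (auto simp: good_def)
    next
      case False
      show ?thesis
      proof (cases "good n = {}")
        case True
        \<comment> \<open>A placeholder for the small \<open>n\<close> without admissible index
          sets; the vector must still be a unit vector, as the limit theorem asks this for every
          \<open>n\<close>.\<close>
        then show ?thesis using c0 False by (intro exI[of _ "({}, c0)"]) auto
      next
        case ne: False
        then obtain Jc where "Jc \<in> good n" by blast
        then show ?thesis using False by (intro exI[of _ Jc]) (auto simp: good_def)
      qed
    qed
    then obtain Jc where Jc: "\<And>n. snd (Jc n) \<in> euclid_sphere p" "\<And>n. good n \<noteq> {} \<Longrightarrow> Jc n \<in> good n"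
        "\<And>n. \<exists>Jc\<in>good n. bad n Jc \<Longrightarrow> bad n (Jc n)"
      by metis
    define js where "js n i = sorted_list_of_set (fst (Jc n)) ! i" for n i
    define c where "c n = snd (Jc n)" for n
    have js: "\<forall>\<^sub>F n in sequentially. inj_on (js n) {..<p} \<and> (\<forall>i<p. js n i \<in> {1..2 * num_freq n})"
      using J0
    proof eventually_elim
      case (elim n)
      then have "good n \<noteq> {}" using c0 by (auto simp: good_def)
      then have "fst (Jc n) \<in> index_sets (num_freq n) p" using Jc(2)[of n] by (auto simp: good_def)
      from index_sets_nth[OF this] show ?case by (auto simp: js_def[abs_def])
    qed
    have c: "(\<Sum>i<p. (c n i)\<^sup>2) = 1" for n
      unfolding c_def by (rule euclid_sphere_sum[OF Jc(1)])
    define Z where "Z n \<omega> = (\<Sum>k=1..n. trig_weight (spectral_density M X) n p (js n) (c n) (int k) * X (int k) \<omega>)" for n \<omega>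
    have Z: "Z n \<in> borel_measurable M" "weak_conv_m (\<lambda>n. distr M borel (Z n)) std_normal_distribution" for n
      unfolding Z_def[abs_def]
      by (rule trig_sum_weak_conv[OF assms(4), folded assms(5), OF assms(6-9) js c])+
    have "\<forall>\<^sub>F n in sequentially. \<forall>x. \<bar>cdf (distr M borel (Z n)) x - cdf std_normal_distribution x\<bar> \<le> e"
      by (rule weak_conv_uniform_cdf[OF _ real_dist_normal_dist Z(2) isCont_cdf_std_normal \<open>0 < e\<close>])
         (rule real_distribution_distr[OF Z(1)])
    then show ?thesis
    proof eventually_elim
      case (elim n)
      have "cdf (distr M borel (Z n)) x
          = measure M {\<omega> \<in> space M. (\<Sum>i<p. coeff_vec M X n (fst (Jc n)) i \<omega> * snd (Jc n) i) \<le> x}" for x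
      proof -
        have "Z n \<omega> = (\<Sum>i<p. coeff_vec M X n (fst (Jc n)) i \<omega> * snd (Jc n) i)" for \<omega>
          unfolding coeff_vec_trig_weight Z_def js_def c_def ..
        then have "Z n -` {..x} \<inter> space M
            = {\<omega> \<in> space M. (\<Sum>i<p. coeff_vec M X n (fst (Jc n)) i \<omega> * snd (Jc n) i) \<le> x}" by auto
        then show ?thesis by (simp add: cdf_def2 measure_distr[OF Z(1)])
      qed
      \<comment> \<open>If any admissible pair were bad, the selected pair would be; it is not, so
        the bound holds for all pairs.\<close>
      with elim have "\<not> bad n (Jc n)" by (auto simp: bad_def \<Delta>_def not_less)
      with Jc(3)[of n] have "\<forall>Jc\<in>good n. \<not> bad n Jc" by blast
      then show ?case by (auto simp: good_def bad_def not_less)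
    qed
  qed
  show ?thesis
    unfolding \<Delta>_def[symmetric]
  proof (rule tendstoI)
    fix e :: real assume "0 < e"
    \<comment> \<open>Suprema preserve only the weak inequality, so half of \<open>e\<close> is used
      to end strictly below \<open>e\<close>.\<close>
    then have "0 < e / 2" by simp
    from small[OF this] J0
    show "\<forall>\<^sub>F n in sequentially. dist (SUP J\<in>index_sets (num_freq n) p. SUP c\<in>euclid_sphere p. SUP x. \<Delta> n J c x) 0 < e"
    proof eventually_elim
      case (elim n)
      have x: "0 \<le> (SUP x. \<Delta> n J c x)" "(SUP x. \<Delta> n J c x) \<le> e / 2"
        if "J \<in> index_sets (num_freq n) p" "c \<in> euclid_sphere p" for J c
        using elim(1) that by (intro SUP_nonneg_le[where e = "e / 2"]; auto simp: \<Delta>_nonneg)+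
      have c: "0 \<le> (SUP c\<in>euclid_sphere p. SUP x. \<Delta> n J c x)" "(SUP c\<in>euclid_sphere p. SUP x. \<Delta> n J c x) \<le> e / 2"
        if "J \<in> index_sets (num_freq n) p" for J
        by (rule SUP_nonneg_le[where e = "e / 2"]; use c0 x[OF that] in auto)+
      have "0 \<le> (SUP J\<in>index_sets (num_freq n) p. SUP c\<in>euclid_sphere p. SUP x. \<Delta> n J c x)"
        "(SUP J\<in>index_sets (num_freq n) p. SUP c\<in>euclid_sphere p. SUP x. \<Delta> n J c x) \<le> e / 2"
        by (rule SUP_nonneg_le[where e = "e / 2"]; use elim(2) c in auto)+
      with \<open>0 < e\<close> show ?case by (simp add: dist_real_def)
    qed
  qed
qed

end
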